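(* In the density estimation setting of the context, let $\alpha\in(0,1)$ and $\eta>0$, and with $\xi_n=(\log n)^{-3}$, $g=n^{-\frac1{2S+1}}$ define $$\bar r_\eta(t)=(2S+1)(1+\xi_n)\eta^{\frac1{2S+1}}\Big(\frac{2\log(1/t)V_{ng}}{4S^2}\Big)^{\frac S{2S+1}}n^{-\frac S{2S+1}} .$$ Then $$\inf_{f_X\in\Theta_0(M_S,r_S,\psi_n)}\mathbb P\big(\widehat f_{\tilde h_0(\alpha)}(0)\ge f_X(0)-\bar r_\eta(\alpha)\big)\ge1-\alpha-\mathrm{CE}_n,$$ $$\inf_{f_X\in\Theta_0(M_S,r_S,\psi_n)}\mathbb P\big(f_X(0)\ge\widehat f_{\tilde h_0(\alpha)}(0)-\bar r_\eta(\alpha)\big)\ge1-\alpha-\mathrm{CE}_n,$$ $$\inf_{f_X\in\Theta_0(M_S,r_S,\psi_n)}\mathbb P\Big(f_X(0)\in\big[\widehat f_{\tilde h_0(\frac\alpha2)}(0)-\bar r_\eta(\tfrac\alpha2),\ \widehat f_{\tilde h_0(\frac\alpha2)}(0)+\bar r_\eta(\tfrac\alpha2)\big]\Big)\ge1-\alpha-\mathrm{CE}_n',$$ where $\mathrm{CE}_n=O(e^{-n^{\kappa_1}})$ and $\mathrm{CE}_n'=O(e^{-n^{\kappa_2}})$ for constants $\kappa_1,\kappa_2>0$. Moreover, $$V_{ng}\xrightarrow[n\to\infty]{\mathbb P}f_X(0)\int_IK_I^2(u)\,du .$$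
   Context: Let $S\ge1$ be an integer and $X_1,\dots,X_n$ ($n$ even) i.i.d. with Lebesgue density $f_X$, which is uniformly bounded away from $0$ (on its support). The point $0$ is an interior point or a (left or right) boundary point of the support of $f_X$. Kernel: $K_I$ is bounded with support $I$, where $I=[-1,1]$ in the interior case and $I=[0,1]$ or $I=[-1,0]$ in the left or right boundary case, and $\int_IK_I(u)du=1$, $\int_Iu^kK_I(u)du=0$ for $k=1,\dots,S$. Function class: with $\psi_n=n^{-1/(2S+1)}\log n$, $f_X\in\Theta_0(M_S,r_S,\psi_n)$, the set of functions $\theta$ such that $\big|\theta(\epsilon)-\theta(0)-\sum_{s=1}^S\frac{\theta^{(s)}(0)}{s!}\epsilon^s\big|\le M_S\,r_S(|\epsilon|)|\epsilon|^S$ for all $|\epsilon|\le\psi_n$ (with $\epsilon$ in the support), where $\theta^{(s)}(0)$ is the ordinary (one-sided at a boundary point) derivative; $r_S:[0,\infty)\to[0,\infty)$ is nondecreasing, does not depend on $\theta$, $r_S(t)\to0$ as $t\downarrow0$; $M_S>0$ is a constant not depending on $\theta,n$ or bandwidth. The infima run over densities in this class. Estimator: $\widehat f_h(0)=\frac1{nh}\sum_{i=1}^nK_I(X_i/h)$. Variance proxy: $V_{ng}=\frac1{ng}\sum_{i=1}^{n/2}\big(K_I(X_{2i}/g)-K_I(X_{2i-1}/g)\big)^2$ with $g=n^{-1/(2S+1)}$. Bandwidth: $\hat h_0(t)=\big(\frac{2\log(1/t)V_{ng}}{4S^2\eta^2n}\big)^{1/(2S+1)}$; $\mathcal H_n=\{j\,n^{-1/(2S+1)}/(\log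 n)^4:1\le j\le[(\log n)^5]\}$ ($[\cdot]$ = integer part); $\tilde h_0(t)=\arg\min_{h\in\mathcal H_n}|h-\hat h_0(t)|$ (smallest minimizer in case of ties).
   Formalization: The infima run over densities of the class with a common lower bound c>0 on the support that also satisfy ψ_n I ⊂ supp f_X and f_X ≤ C on ψ_n I for a fixed arbitrary constant C; without these the uniform coverage claim is false. *)

theory Defs
  imports "HOL-Probability.Probability" "HOL-Library.Landau_Symbols"
begin

definition supp :: "(real \<Rightarrow> real) \<Rightarrow> real set" where
  "supp f = closure {x. f x \<noteq> 0}"

datatype position = Interior | Left_Boundary | Right_Boundary

fun kernel_interval :: "position \<Rightarrow> real set" where
  "kernel_interval Interior = {-1..1}"
| "kernel_interval Left_Boundary = {0..1}"
| "kernel_interval Right_Boundary = {-1..0}"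

fun zero_position :: "position \<Rightarrow> real set \<Rightarrow> bool" where
  "zero_position Interior D \<longleftrightarrow> 0 \<in> interior D"
| "zero_position Left_Boundary D \<longleftrightarrow> (\<exists>\<delta>>0. D \<inter> {-\<delta>..\<delta>} = {0..\<delta>})"
| "zero_position Right_Boundary D \<longleftrightarrow> (\<exists>\<delta>>0. D \<inter> {-\<delta>..\<delta>} = {-\<delta>..0})"

definition order_kernel :: "nat \<Rightarrow> position \<Rightarrow> (real \<Rightarrow> real) \<Rightarrow> bool" where
  "order_kernel S p K \<longleftrightarrow>
     K \<in> borel_measurable borel \<and> bounded (range K) \<and> supp K = kernel_interval p \<and>
     (LINT u:kernel_interval p|lborel. K u) = 1 \<and>
     (\<forall>k\<in>{1..S}. (LINT u:kernel_interval p|lborel. u ^ k * K u) = 0)"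

definition modulus :: "(real \<Rightarrow> real) \<Rightarrow> bool" where
  "modulus r \<longleftrightarrow> mono_on {0..} r \<and> (\<forall>t\<ge>0. 0 \<le> r t) \<and> (r \<longlongrightarrow> 0) (at_right 0)"

text \<open>Iterated derivative along \<open>D\<close>: the ordinary derivative at interior points of \<open>D\<close>,
  the one-sided one at endpoints of intervals.\<close>

primrec deriv_within :: "real set \<Rightarrow> nat \<Rightarrow> (real \<Rightarrow> real) \<Rightarrow> real \<Rightarrow> real" where
  "deriv_within D 0 f = f"
| "deriv_within D (Suc s) f = (\<lambda>x. vector_derivative (deriv_within D s f) (at x within D))"

definition differentiable_at_0 :: "real set \<Rightarrow> nat \<Rightarrow> (real \<Rightarrow> real) \<Rightarrow> bool" where
  "differentiable_at_0 D S f \<longleftrightarrow>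
     (\<forall>s<S. deriv_within D s f differentiable (at 0 within D)) \<and>
     (\<forall>s. Suc s < S \<longrightarrow>
        (\<forall>\<^sub>F x in at 0 within D. deriv_within D s f differentiable (at x within D)))"

definition theta0 ::
  "nat \<Rightarrow> real \<Rightarrow> (real \<Rightarrow> real) \<Rightarrow> real \<Rightarrow> real set \<Rightarrow> (real \<Rightarrow> real) set" where
  "theta0 S M r \<psi> D = {\<theta>. differentiable_at_0 D S \<theta> \<and>
     (\<forall>\<epsilon>\<in>D. \<bar>\<epsilon>\<bar> \<le> \<psi> \<longrightarrow>
        \<bar>\<theta> \<epsilon> - \<theta> 0 - (\<Sum>s=1..S. deriv_within D s \<theta> 0 / fact s * \<epsilon> ^ s)\<bar>
          \<le> M * r \<bar>\<epsilon>\<bar> * \<bar>\<epsilon>\<bar> ^ S)}"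

definition lebesgue_density :: "(real \<Rightarrow> real) \<Rightarrow> bool" where
  "lebesgue_density f \<longleftrightarrow> f \<in> borel_measurable borel \<and> (\<forall>x. 0 \<le> f x) \<and> (\<integral>\<^sup>+x. ennreal (f x) \<partial>lborel) = 1"

definition bandwidth_unit :: "nat \<Rightarrow> nat \<Rightarrow> real" where
  "bandwidth_unit S n = real n powr (- 1 / (2 * real S + 1))"

definition window :: "nat \<Rightarrow> nat \<Rightarrow> real" where
  "window S n = bandwidth_unit S n * ln (real n)"

text \<open>The last conjunct makes two standing properties uniform over the class: the set
  \<open>\<psi>\<^sub>n I\<close> (\<open>\<psi>\<^sub>n\<close> the window), on which the kernel estimator acts, lies in the support, and the densities are
  bounded there by a common constant \<open>C\<close>. Both hold for each fixed density of the class for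
  large \<open>n\<close> and suitable \<open>C\<close>. Without uniformity the coverage bounds fail: consider uniform
  densities on \<open>[-\<delta>, 1 - \<delta>]\<close> with \<open>\<delta>\<close> much smaller than the bandwidth, or densities equal
  to a constant of order \<open>1 / \<psi>\<^sub>n\<close> on \<open>[-\<psi>\<^sub>n, \<psi>\<^sub>n]\<close>.\<close>

definition density_class ::
  "nat \<Rightarrow> position \<Rightarrow> real \<Rightarrow> real \<Rightarrow> real \<Rightarrow> (real \<Rightarrow> real) \<Rightarrow> nat \<Rightarrow> (real \<Rightarrow> real) set" where
  "density_class S p c C M r n =
     {f. lebesgue_density f \<and> (\<forall>x\<in>supp f. c \<le> f x) \<and> zero_position p (supp f) \<and>
         f \<in> theta0 S M r (window S n) (supp f) \<and>
         (\<forall>u\<in>kernel_interval p. window S n * u \<in> supp f \<and> f (window S n * u) \<le> C)}"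

text \<open>Joint law of an i.i.d. sample \<open>X\<^sub>1, \<dots>, X\<^sub>n\<close> with density \<open>f\<close>; the \<open>X\<^sub>i\<close> are the
  coordinate projections.\<close>

definition sample :: "nat \<Rightarrow> (real \<Rightarrow> real) \<Rightarrow> (nat \<Rightarrow> real) measure" where
  "sample n f = (\<Pi>\<^sub>M i\<in>{1..n}. density lborel (\<lambda>x. ennreal (f x)))"

definition fhat :: "(real \<Rightarrow> real) \<Rightarrow> nat \<Rightarrow> real \<Rightarrow> (nat \<Rightarrow> real) \<Rightarrow> real" where
  "fhat K n h X = 1 / (real n * h) * (\<Sum>i=1..n. K (X i / h))"

definition Vhat :: "nat \<Rightarrow> (real \<Rightarrow> real) \<Rightarrow> nat \<Rightarrow> (nat \<Rightarrow> real) \<Rightarrow> real" where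
  "Vhat S K n X = (let g = bandwidth_unit S n in
     1 / (real n * g) * (\<Sum>i=1..n div 2. (K (X (2 * i) / g) - K (X (2 * i - 1) / g))\<^sup>2))"

definition hhat :: "nat \<Rightarrow> real \<Rightarrow> (real \<Rightarrow> real) \<Rightarrow> nat \<Rightarrow> real \<Rightarrow> (nat \<Rightarrow> real) \<Rightarrow> real" where
  "hhat S \<eta> K n t X =
     (2 * ln (1 / t) * Vhat S K n X / (4 * (real S)\<^sup>2 * \<eta>\<^sup>2 * real n)) powr (1 / (2 * real S + 1))"

definition bandwidths :: "nat \<Rightarrow> nat \<Rightarrow> real set" where
  "bandwidths S n = (\<lambda>j::nat. real j * bandwidth_unit S n / (ln (real n)) ^ 4)
     ` {1..nat \<lfloor>(ln (real n)) ^ 5\<rfloor>}"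

text \<open>The minimum selects the smallest minimizer. The grid is nonempty for \<open>n \<ge> 3\<close>.\<close>

definition htilde :: "nat \<Rightarrow> real \<Rightarrow> (real \<Rightarrow> real) \<Rightarrow> nat \<Rightarrow> real \<Rightarrow> (nat \<Rightarrow> real) \<Rightarrow> real" where
  "htilde S \<eta> K n t X = Min {h \<in> bandwidths S n.
     \<forall>h'\<in>bandwidths S n. \<bar>h - hhat S \<eta> K n t X\<bar> \<le> \<bar>h' - hhat S \<eta> K n t X\<bar>}"

definition radius :: "nat \<Rightarrow> real \<Rightarrow> (real \<Rightarrow> real) \<Rightarrow> nat \<Rightarrow> real \<Rightarrow> (nat \<Rightarrow> real) \<Rightarrow> real" where
  "radius S \<eta> K n t X =
     (2 * real S + 1) * (1 + ln (real n) powr (-3)) * \<eta> powr (1 / (2 * real S + 1)) *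
     (2 * ln (1 / t) * Vhat S K n X / (4 * (real S)\<^sup>2)) powr (real S / (2 * real S + 1)) *
     real n powr (- real S / (2 * real S + 1))"

definition fstar :: "nat \<Rightarrow> real \<Rightarrow> (real \<Rightarrow> real) \<Rightarrow> nat \<Rightarrow> real \<Rightarrow> (nat \<Rightarrow> real) \<Rightarrow> real" where
  "fstar S \<eta> K n t X = fhat K n (htilde S \<eta> K n t X) X"

end

theory Submission
  imports Defs
begin

text \<open>At a deterministic bandwidth \<open>h\<close> the estimator has variance about \<open>v / (n h)\<close>, where \<open>v\<close> is the
mean of the variance proxy.  Let \<open>h\<^sub>0\<close> be the selected bandwidth with the proxy replaced by \<open>v\<close>.
It satisfies \<open>n h\<^sub>0^(2S+1) = 2 ln (1/t) v / (4 S^2 \<eta>^2)\<close>, so that the sub-Gaussian deviation at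
level \<open>t\<close>, which is \<open>sqrt (2 ln (1/t) v / (n h\<^sub>0))\<close>, equals \<open>2 S \<eta> h\<^sub>0^S\<close>.  The radius is about
\<open>(2 S + 1) \<eta> h\<^sub>0^S\<close>.  The difference \<open>\<eta> h\<^sub>0^S\<close> is meant for the bias, but for a kernel of order
\<open>S\<close> the bias over the class is at most of order \<open>r (h\<^sub>0) h\<^sub>0^S\<close> and therefore negligible.  The surplus
enlarges the Chernoff exponent: the estimator at \<open>h\<^sub>0\<close> fails with probability at most
\<open>t powr \<beta>\<^sup>2\<close> for some \<open>\<beta> > 1\<close> (\<open>tail_event_bound\<close>).  This is less than \<open>t\<close> by a fixed amount, and
twice the bound at level \<open>\<alpha> / 2\<close> is less than \<open>\<alpha>\<close>.  Hence every other error only has to be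
\<open>o(1)\<close>, uniformly over the class, for the coverage to be at least \<open>1 - \<alpha>\<close> from some \<open>n\<close> on; the error
terms of the theorem can be taken to vanish from there on and to be \<open>1\<close> before.

It remains to replace the random bandwidth by \<open>h\<^sub>0\<close>.  By Chebyshev's inequality the proxy is within
\<open>1 / ln^5 n\<close> of its mean (\<open>variance_event_small\<close>), so the unrounded bandwidth is within one grid
spacing of \<open>h\<^sub>0\<close> and the rounded one is one of five grid points (\<open>htilde_is_gridpoint\<close>).  Their ratios
to \<open>h\<^sub>0\<close> tend to \<open>1\<close>.  As the kernel is only bounded and measurable, the comparison of the centred
estimators rests on the continuity of dilations in \<open>L\<^sup>2\<close> (\<open>dilation_L2_continuous\<close>): the difference has
variance \<open>o(1 / (n h\<^sub>0))\<close>, and Chebyshev's inequality shows that it is \<open>o(h\<^sub>0^S)\<close> in probability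
(\<open>transfer_event_small\<close>).

Uniformity rests on one estimate (\<open>density_oscillation\<close>).  On the window \<open>\<psi>\<close> a density of the class is
bounded and close to a polynomial of degree at most \<open>S\<close>.  A bounded polynomial has bounded
coefficients after rescaling, so the density oscillates by
\<open>O(h / \<psi>) + o(1)\<close> at scale \<open>h\<close>.  All variances therefore agree in the limit with those for a
constant density.  Since the class depends on \<open>n\<close>, limits are taken along a filter on pairs of a
sample size and a density (\<open>class_limit\<close>).  The consistency of the proxy is the same estimate
combined with Chebyshev's inequality.\<close>

section \<open>Sums of independent bounded variables\<close>

lemma exp_le_quadratic:
  fixes x b :: real
  assumes "\<bar>x\<bar> \<le> b"
  shows "exp x \<le> 1 + x + x\<^sup>2 / 2 * exp b"
proof -
  obtain t where t: "\<bar>t\<bar> \<le> \<bar>x\<bar>" "exp x = (\<Sum>m<2. x ^ m / fact m) + exp t / fact 2 * x ^ 2"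
    using Maclaurin_exp_le[of x 2] by blast
  have "exp t \<le> exp b"
    using t(1) assms by simp
  hence "exp t * x\<^sup>2 \<le> exp b * x\<^sup>2"
    by (intro mult_right_mono) auto
  with t(2) show ?thesis
    by (simp add: lessThan_Suc numeral_2_eq_2 field_simps)
qed

context prob_space
begin

lemma integrable_bounded:
  fixes X :: "'a \<Rightarrow> real"
  assumes "random_variable borel X" and "\<And>\<omega>. \<omega> \<in> space M \<Longrightarrow> \<bar>X \<omega>\<bar> \<le> B"
  shows "integrable M X"
  using assms by (intro integrable_const_bound[where B = B]) auto

text \<open>Chernoff's method with the exponent \<open>\<theta>\<close> left free.  The centred summands are at most \<open>2 B\<close>
in absolute value, so the quadratic bound for \<open>exp\<close> costs the factor \<open>exp (2 \<theta> B)\<close>.  This factor tends to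
\<open>1\<close> for small \<open>\<theta>\<close>, and then the bound is as good as the one for Gaussian variables.\<close>

lemma prob_sum_deviation_le_exp:
  fixes X :: "'i \<Rightarrow> 'a \<Rightarrow> real" and B \<mu> w a :: real
  assumes fin: "finite I" and indep: "indep_vars (\<lambda>_. borel) X I"
    and bdd: "\<And>i \<omega>. i \<in> I \<Longrightarrow> \<omega> \<in> space M \<Longrightarrow> \<bar>X i \<omega>\<bar> \<le> B"
    and mean: "\<And>i. i \<in> I \<Longrightarrow> expectation (X i) = \<mu>"
    and square: "\<And>i. i \<in> I \<Longrightarrow> expectation (\<lambda>\<omega>. (X i \<omega>)\<^sup>2) \<le> w"
    and \<theta>: "0 \<le> \<theta>" and w: "0 \<le> w"
  shows "prob {\<omega> \<in> space M. a \<le> (\<Sum>i\<in>I. X i \<omega>) - card I * \<mu>}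
    \<le> exp (- \<theta> * a + card I * (\<theta>\<^sup>2 * w / 2 * exp (2 * \<theta> * B)))"
proof -
  have rv [measurable]: "random_variable borel (X i)" if "i \<in> I" for i
    using indep that by (auto simp: indep_vars_def)
  define Y where "Y i \<omega> = exp (\<theta> * (X i \<omega> - \<mu>))" for i \<omega>
  have rvY [measurable]: "random_variable borel (Y i)" if "i \<in> I" for i
    unfolding Y_def using that by measurable
  have \<mu>: "\<bar>\<mu>\<bar> \<le> B" if "i \<in> I" for i
  proof -
    have "\<bar>expectation (X i)\<bar> \<le> expectation (\<lambda>\<omega>. \<bar>X i \<omega>\<bar>)"
      by (rule integral_abs_bound)
    also have "\<dots> \<le> expectation (\<lambda>\<omega>. B)"
    proof (rule integral_mono)
      show "integrable M (\<lambda>\<omega>. \<bar>X i \<omega>\<bar>)"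
        using that by (intro integrable_abs integrable_bounded[where B = B] bdd) auto
    qed (use that bdd in auto)
    finally show ?thesis using mean[OF that] by (simp add: prob_space)
  qed
  have dev: "\<bar>\<theta> * (X i \<omega> - \<mu>)\<bar> \<le> 2 * \<theta> * B" if "i \<in> I" "\<omega> \<in> space M" for i \<omega>
  proof -
    have "\<bar>X i \<omega> - \<mu>\<bar> \<le> 2 * B" using bdd[OF that] \<mu>[OF that(1)] by linarith
    hence "\<theta> * \<bar>X i \<omega> - \<mu>\<bar> \<le> \<theta> * (2 * B)" using \<theta> by (intro mult_left_mono)
    thus ?thesis using \<theta> by (simp add: abs_mult mult.assoc mult.left_commute)
  qed
  have intY: "integrable M (Y i)" if "i \<in> I" for i
  proof (rule integrable_bounded[where B = "exp (2 * \<theta> * B)"])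
    show "\<bar>Y i \<omega>\<bar> \<le> exp (2 * \<theta> * B)" if "\<omega> \<in> space M" for \<omega>
      using dev[OF \<open>i \<in> I\<close> that] by (auto simp: Y_def)
  qed (use that in measurable)
  have indepY: "indep_vars (\<lambda>_. borel) Y I"
    unfolding Y_def by (rule indep_vars_compose2[OF indep]) measurable
  have intX: "integrable M (X i)" "integrable M (\<lambda>\<omega>. (X i \<omega>)\<^sup>2)" if "i \<in> I" for i
  proof -
    show "integrable M (X i)"
      using that by (intro integrable_bounded[where B = B] bdd) auto
    show "integrable M (\<lambda>\<omega>. (X i \<omega>)\<^sup>2)"
    proof (rule integrable_bounded[where B = "B\<^sup>2"])
      show "\<bar>(X i \<omega>)\<^sup>2\<bar> \<le> B\<^sup>2" if "\<omega> \<in> space M" for \<omega>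
        using bdd[OF \<open>i \<in> I\<close> that] by (simp add: abs_le_square_iff[symmetric])
    qed (use that in measurable)
  qed
  have mgf: "expectation (Y i) \<le> exp (\<theta>\<^sup>2 * w / 2 * exp (2 * \<theta> * B))" if i: "i \<in> I" for i
  proof -
    have "expectation (Y i) \<le> expectation (\<lambda>\<omega>. 1 + \<theta> * (X i \<omega> - \<mu>)
        + (\<theta>\<^sup>2 / 2 * exp (2 * \<theta> * B)) * ((X i \<omega>)\<^sup>2 - 2 * \<mu> * X i \<omega> + \<mu>\<^sup>2))"
    proof (rule integral_mono)
      show "Y i \<omega> \<le> 1 + \<theta> * (X i \<omega> - \<mu>)
        + (\<theta>\<^sup>2 / 2 * exp (2 * \<theta> * B)) * ((X i \<omega>)\<^sup>2 - 2 * \<mu> * X i \<omega> + \<mu>\<^sup>2)" if "\<omega> \<in> space M" for \<omega>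
      proof -
        have "1 + \<theta> * (X i \<omega> - \<mu>)
            + (\<theta>\<^sup>2 / 2 * exp (2 * \<theta> * B)) * ((X i \<omega>)\<^sup>2 - 2 * \<mu> * X i \<omega> + \<mu>\<^sup>2)
          = 1 + \<theta> * (X i \<omega> - \<mu>) + (\<theta> * (X i \<omega> - \<mu>))\<^sup>2 / 2 * exp (2 * \<theta> * B)"
          by (simp add: power2_eq_square field_simps)
        thus ?thesis
          using exp_le_quadratic[OF dev[OF i that]] unfolding Y_def by linarith
      qed
    qed (intro Bochner_Integration.integrable_add Bochner_Integration.integrable_diff
        integrable_mult_right integrable_const intX intY i)+
    also have "\<dots> = 1 + \<theta>\<^sup>2 / 2 * exp (2 * \<theta> * B) * (expectation (\<lambda>\<omega>. (X i \<omega>)\<^sup>2) - \<mu>\<^sup>2)"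
      using intX[OF i] mean[OF i] by (simp add: prob_space power2_eq_square)
    also have "\<dots> \<le> 1 + \<theta>\<^sup>2 / 2 * exp (2 * \<theta> * B) * w"
    proof -
      have "expectation (\<lambda>\<omega>. (X i \<omega>)\<^sup>2) - \<mu>\<^sup>2 \<le> w"
        using square[OF i] zero_le_power2[of \<mu>] by linarith
      thus ?thesis by (intro add_left_mono mult_left_mono) auto
    qed
    also have "\<dots> \<le> exp (\<theta>\<^sup>2 * w / 2 * exp (2 * \<theta> * B))"
      using exp_ge_add_one_self[of "\<theta>\<^sup>2 * w / 2 * exp (2 * \<theta> * B)"] by (simp add: mult_ac)
    finally show ?thesis .
  qed
  have "prob {\<omega> \<in> space M. a \<le> (\<Sum>i\<in>I. X i \<omega>) - card I * \<mu>}
      \<le> prob {\<omega> \<in> space M. exp (\<theta> * a) \<le> (\<Prod>i\<in>I. Y i \<omega>)}"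
  proof (rule finite_measure_mono)
    show "{\<omega> \<in> space M. a \<le> (\<Sum>i\<in>I. X i \<omega>) - card I * \<mu>}
        \<subseteq> {\<omega> \<in> space M. exp (\<theta> * a) \<le> (\<Prod>i\<in>I. Y i \<omega>)}"
    proof safe
      fix \<omega> assume "a \<le> (\<Sum>i\<in>I. X i \<omega>) - card I * \<mu>"
      hence "\<theta> * a \<le> \<theta> * ((\<Sum>i\<in>I. X i \<omega>) - card I * \<mu>)" using \<theta> by (rule mult_left_mono)
      also have "\<dots> = (\<Sum>i\<in>I. \<theta> * (X i \<omega> - \<mu>))"
        by (simp add: sum_distrib_left[symmetric] sum_subtractf)
      finally show "exp (\<theta> * a) \<le> (\<Prod>i\<in>I. Y i \<omega>)"
        using fin by (simp add: Y_def exp_sum[symmetric])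
    qed
  qed measurable
  also have "\<dots> \<le> expectation (\<lambda>\<omega>. \<Prod>i\<in>I. Y i \<omega>) / exp (\<theta> * a)"
    by (intro integral_Markov_inequality_measure[where A = "space M"]
        indep_vars_integrable[OF fin indepY] intY)
      (auto simp: Y_def intro!: prod_nonneg)
  also have "expectation (\<lambda>\<omega>. \<Prod>i\<in>I. Y i \<omega>) = (\<Prod>i\<in>I. expectation (Y i))"
    by (intro indep_vars_lebesgue_integral[OF fin indepY] intY)
  also have "\<dots> \<le> (\<Prod>i\<in>I. exp (\<theta>\<^sup>2 * w / 2 * exp (2 * \<theta> * B)))"
    by (intro prod_mono conjI mgf) (auto simp: Y_def intro!: integral_nonneg)
  also have "\<dots> / exp (\<theta> * a) = exp (- \<theta> * a + card I * (\<theta>\<^sup>2 * w / 2 * exp (2 * \<theta> * B)))"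
    by (simp add: exp_of_nat_mult[symmetric] exp_diff[symmetric])
  finally show ?thesis by (simp add: divide_right_mono)
qed

lemma expectation_sum_square_indep:
  fixes Z :: "'i \<Rightarrow> 'a \<Rightarrow> real"
  assumes "finite I" and "indep_vars (\<lambda>_. borel) Z I"
    and "\<And>i \<omega>. i \<in> I \<Longrightarrow> \<omega> \<in> space M \<Longrightarrow> \<bar>Z i \<omega>\<bar> \<le> B"
    and "\<And>i. i \<in> I \<Longrightarrow> expectation (Z i) = 0"
  shows "expectation (\<lambda>\<omega>. (\<Sum>i\<in>I. Z i \<omega>)\<^sup>2) = (\<Sum>i\<in>I. expectation (\<lambda>\<omega>. (Z i \<omega>)\<^sup>2))"
  using assms
proof (induction I rule: finite_induct)
  case (insert j I)
  have rv [measurable]: "random_variable borel (Z i)" if "i \<in> insert j I" for i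
    using insert.prems(1) that by (auto simp: indep_vars_def)
  define T where "T \<omega> = (\<Sum>i\<in>I. Z i \<omega>)" for \<omega>
  have rvT [measurable]: "random_variable borel T"
    unfolding T_def by (intro borel_measurable_sum) auto
  have rvj [measurable]: "random_variable borel (Z j)" by auto
  have T: "\<bar>T \<omega>\<bar> \<le> card I * B" if "\<omega> \<in> space M" for \<omega>
  proof -
    have "\<bar>T \<omega>\<bar> \<le> (\<Sum>i\<in>I. \<bar>Z i \<omega>\<bar>)" unfolding T_def by (rule sum_abs)
    also have "\<dots> \<le> card I * B" by (rule sum_bounded_above) (use insert.prems that in auto)
    finally show ?thesis .
  qed
  have Zj: "\<bar>Z j \<omega>\<bar> \<le> B" if "\<omega> \<in> space M" for \<omega> using insert.prems that by auto
  have int: "integrable M (Z j)" "integrable M T"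
    by (intro integrable_bounded[OF rvj Zj] integrable_bounded[OF rvT T]; assumption)+
  have int2: "integrable M (\<lambda>\<omega>. (Z j \<omega>)\<^sup>2)" "integrable M (\<lambda>\<omega>. (T \<omega>)\<^sup>2)"
  proof -
    show "integrable M (\<lambda>\<omega>. (Z j \<omega>)\<^sup>2)"
    proof (rule integrable_bounded[where B = "B\<^sup>2"])
      show "\<bar>(Z j \<omega>)\<^sup>2\<bar> \<le> B\<^sup>2" if "\<omega> \<in> space M" for \<omega>
        using power_mono[OF Zj[OF that], of 2] by simp
    qed measurable
    show "integrable M (\<lambda>\<omega>. (T \<omega>)\<^sup>2)"
    proof (rule integrable_bounded[where B = "(card I * B)\<^sup>2"])
      show "\<bar>(T \<omega>)\<^sup>2\<bar> \<le> (card I * B)\<^sup>2" if "\<omega> \<in> space M" for \<omega>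
        using power_mono[OF T[OF that], of 2] by simp
    qed measurable
  qed
  have indep: "indep_var borel (Z j) borel T"
    unfolding T_def by (intro indep_vars_sum insert)
  have cross: "expectation (\<lambda>\<omega>. Z j \<omega> * T \<omega>) = 0" "integrable M (\<lambda>\<omega>. Z j \<omega> * T \<omega>)"
    using indep_var_lebesgue_integral[OF indep int] indep_var_integrable[OF indep int] insert.prems
    by auto
  have "expectation (\<lambda>\<omega>. (\<Sum>i\<in>insert j I. Z i \<omega>)\<^sup>2)
      = expectation (\<lambda>\<omega>. (Z j \<omega>)\<^sup>2 + (2 * (Z j \<omega> * T \<omega>) + (T \<omega>)\<^sup>2))"
    using insert.hyps by (simp add: T_def power2_sum algebra_simps)
  also have "\<dots> = expectation (\<lambda>\<omega>. (Z j \<omega>)\<^sup>2) + expectation (\<lambda>\<omega>. (T \<omega>)\<^sup>2)"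
    using cross int2 by simp
  also have "expectation (\<lambda>\<omega>. (T \<omega>)\<^sup>2) = (\<Sum>i\<in>I. expectation (\<lambda>\<omega>. (Z i \<omega>)\<^sup>2))"
    unfolding T_def using insert.prems
    by (intro insert.IH indep_vars_subset[OF insert.prems(1)]) auto
  finally show ?case using insert.hyps by simp
qed simp

text \<open>Chebyshev's inequality for the sum; second moments about zero bound the variances.\<close>

lemma prob_sum_deviation_le_square:
  fixes X :: "'i \<Rightarrow> 'a \<Rightarrow> real" and B \<mu> w a :: real
  assumes fin: "finite I" and indep: "indep_vars (\<lambda>_. borel) X I"
    and bdd: "\<And>i \<omega>. i \<in> I \<Longrightarrow> \<omega> \<in> space M \<Longrightarrow> \<bar>X i \<omega>\<bar> \<le> B"
    and mean: "\<And>i. i \<in> I \<Longrightarrow> expectation (X i) = \<mu>"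
    and square: "\<And>i. i \<in> I \<Longrightarrow> expectation (\<lambda>\<omega>. (X i \<omega>)\<^sup>2) \<le> w"
    and a: "0 < a"
  shows "prob {\<omega> \<in> space M. a \<le> \<bar>(\<Sum>i\<in>I. X i \<omega>) - card I * \<mu>\<bar>} \<le> card I * w / a\<^sup>2"
proof -
  have rv [measurable]: "random_variable borel (X i)" if "i \<in> I" for i
    using indep that by (auto simp: indep_vars_def)
  define Z where "Z i \<omega> = X i \<omega> - \<mu>" for i \<omega>
  have rvZ [measurable]: "random_variable borel (Z i)" if "i \<in> I" for i
    unfolding Z_def using that by measurable
  have intX: "integrable M (X i)" "integrable M (\<lambda>\<omega>. (X i \<omega>)\<^sup>2)" if "i \<in> I" for i
  proof -
    show "integrable M (X i)"
      using that by (intro integrable_bounded[where B = B] bdd) auto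
    show "integrable M (\<lambda>\<omega>. (X i \<omega>)\<^sup>2)"
    proof (rule integrable_bounded[where B = "B\<^sup>2"])
      show "\<bar>(X i \<omega>)\<^sup>2\<bar> \<le> B\<^sup>2" if "\<omega> \<in> space M" for \<omega>
        using power_mono[OF bdd[OF \<open>i \<in> I\<close> that], of 2] by simp
    qed (use that in measurable)
  qed
  have Zb: "\<bar>Z i \<omega>\<bar> \<le> B + \<bar>\<mu>\<bar>" if "i \<in> I" "\<omega> \<in> space M" for i \<omega>
    using bdd[OF that] unfolding Z_def by linarith
  have indepZ: "indep_vars (\<lambda>_. borel) Z I"
    unfolding Z_def by (rule indep_vars_compose2[OF indep]) measurable
  have Z0: "expectation (Z i) = 0" if "i \<in> I" for i
    unfolding Z_def using intX[OF that] mean[OF that] by (simp add: prob_space)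
  have Z2: "expectation (\<lambda>\<omega>. (Z i \<omega>)\<^sup>2) \<le> w" if "i \<in> I" for i
  proof -
    have "expectation (\<lambda>\<omega>. (Z i \<omega>)\<^sup>2) = expectation (\<lambda>\<omega>. (X i \<omega>)\<^sup>2) - \<mu>\<^sup>2"
      using variance_eq[OF intX[OF that]] mean[OF that] by (simp add: Z_def)
    thus ?thesis using square[OF that] zero_le_power2[of \<mu>] by linarith
  qed
  define T where "T \<omega> = (\<Sum>i\<in>I. Z i \<omega>)" for \<omega>
  have rvT [measurable]: "random_variable borel T"
    unfolding T_def by (intro borel_measurable_sum) auto
  have Tb: "\<bar>T \<omega>\<bar> \<le> card I * (B + \<bar>\<mu>\<bar>)" if "\<omega> \<in> space M" for \<omega>
  proof -
    have "\<bar>T \<omega>\<bar> \<le> (\<Sum>i\<in>I. \<bar>Z i \<omega>\<bar>)" unfolding T_def by (rule sum_abs)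
    also have "\<dots> \<le> card I * (B + \<bar>\<mu>\<bar>)" by (rule sum_bounded_above) (use Zb that in auto)
    finally show ?thesis .
  qed
  have "prob {\<omega> \<in> space M. a \<le> \<bar>(\<Sum>i\<in>I. X i \<omega>) - card I * \<mu>\<bar>} = prob {\<omega> \<in> space M. a \<le> \<bar>T \<omega>\<bar>}"
    by (simp add: T_def Z_def sum_subtractf)
  also have "\<dots> \<le> expectation (\<lambda>\<omega>. (T \<omega>)\<^sup>2) / a\<^sup>2"
  proof (rule second_moment_method)
    show "integrable M (\<lambda>\<omega>. (T \<omega>)\<^sup>2)"
    proof (rule integrable_bounded[where B = "(card I * (B + \<bar>\<mu>\<bar>))\<^sup>2"])
      show "\<bar>(T \<omega>)\<^sup>2\<bar> \<le> (card I * (B + \<bar>\<mu>\<bar>))\<^sup>2" if "\<omega> \<in> space M" for \<omega>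
        using power_mono[OF Tb[OF that], of 2] by simp
    qed measurable
  qed (use a in auto)
  also have "expectation (\<lambda>\<omega>. (T \<omega>)\<^sup>2) = (\<Sum>i\<in>I. expectation (\<lambda>\<omega>. (Z i \<omega>)\<^sup>2))"
    unfolding T_def by (rule expectation_sum_square_indep[OF fin indepZ Zb Z0])
  also have "\<dots> \<le> card I * w" by (rule sum_bounded_above) (rule Z2)
  finally show ?thesis by (simp add: divide_right_mono)
qed

end

text \<open>The union bound in the form needed for one event and finitely many others with a common bound.\<close>

lemma (in prob_space) prob_Un_UN_le:
  fixes a b :: real
  assumes "finite J" "N \<in> events" "\<And>j. j \<in> J \<Longrightarrow> E j \<in> events" "prob N \<le> a" "\<And>j. j \<in> J \<Longrightarrow> prob (E j) \<le> b"
  shows "prob (N \<union> (\<Union>j\<in>J. E j)) \<le> a + card J * b"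
proof -
  have "prob (N \<union> (\<Union>j\<in>J. E j)) \<le> prob N + prob (\<Union>j\<in>J. E j)"
    using assms by (intro measure_Un_le sets.finite_UN) auto
  also have "prob (\<Union>j\<in>J. E j) \<le> (\<Sum>j\<in>J. prob (E j))"
    using assms by (intro finite_measure_subadditive_finite) auto
  also have "\<dots> \<le> card J * b" using assms(5) by (intro sum_bounded_above) auto
  finally show ?thesis using assms(4) by simp
qed

lemma prob_space_density_of_lebesgue_density:
  assumes "lebesgue_density f"
  shows "prob_space (density lborel (\<lambda>x. ennreal (f x)))"
  using assms by (intro prob_spaceI) (simp add: lebesgue_density_def emeasure_density)

lemma prob_space_sample: "lebesgue_density f \<Longrightarrow> prob_space (sample n f)"
  unfolding sample_def by (intro prob_space_PiM prob_space_density_of_lebesgue_density)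

lemma measurable_sample_coordinate:
  "i \<in> {1..n} \<Longrightarrow> (\<lambda>X. X i) \<in> borel_measurable (sample n f)"
  unfolding sample_def by (rule measurable_PiM_component_rev[where f = "\<lambda>x. x"]) auto

lemma distr_sample_coordinate:
  assumes "lebesgue_density f" "i \<in> {1..n}"
  shows "distr (sample n f) borel (\<lambda>X. X i) = density lborel (\<lambda>x. ennreal (f x))"
proof -
  have "distr (sample n f) borel (\<lambda>X. X i)
      = distr (sample n f) (density lborel (\<lambda>x. ennreal (f x))) (\<lambda>X. X i)"
    by (rule distr_cong) auto
  also have "\<dots> = density lborel (\<lambda>x. ennreal (f x))"
    unfolding sample_def using assms
    by (intro distr_PiM_component prob_space_density_of_lebesgue_density)
  finally show ?thesis .
qed

lemma expectation_sample_coordinate: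
  fixes G :: "real \<Rightarrow> real"
  assumes f: "lebesgue_density f" and i: "i \<in> {1..n}" and G: "G \<in> borel_measurable borel"
  shows "integral\<^sup>L (sample n f) (\<lambda>X. G (X i)) = (LINT x|lborel. f x * G x)"
proof -
  have "integral\<^sup>L (sample n f) (\<lambda>X. G (X i)) = integral\<^sup>L (distr (sample n f) borel (\<lambda>X. X i)) G"
    using i G by (subst integral_distr) (auto intro!: measurable_sample_coordinate)
  also have "\<dots> = (LINT x|lborel. f x * G x)"
    using f G unfolding distr_sample_coordinate[OF f i]
    by (subst integral_density) (auto simp: lebesgue_density_def)
  finally show ?thesis .
qed

lemma indep_vars_sample:
  assumes f: "lebesgue_density f"
  shows "prob_space.indep_vars (sample n f) (\<lambda>_. borel) (\<lambda>i X. X i) {1..n}"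
proof -
  interpret prob_space "sample n f" by (rule prob_space_sample[OF f])
  show ?thesis
  proof (cases "n = 0")
    case True
    thus ?thesis unfolding indep_vars_def indep_sets_def by simp
  next
    case False
    have "distr (sample n f) (Pi\<^sub>M {1..n} (\<lambda>_. borel)) (\<lambda>X. \<lambda>i\<in>{1..n}. X i)
        = distr (sample n f) (sample n f) (\<lambda>X. X)"
      by (rule distr_cong)
        (auto simp: sample_def space_PiM PiE_def extensional_def fun_eq_iff intro!: sets_PiM_cong)
    also have "\<dots> = sample n f" by simp
    also have "\<dots> = Pi\<^sub>M {1..n} (\<lambda>i. distr (sample n f) borel (\<lambda>X. X i))"
      unfolding sample_def using distr_sample_coordinate[OF f, of _ n, unfolded sample_def]
      by (intro PiM_cong) auto
    finally show ?thesis using False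
      by (subst indep_vars_iff_distr_eq_PiM') (auto intro!: measurable_sample_coordinate)
  qed
qed

section \<open>Polynomials and dilations\<close>

text \<open>Induction on the degree: \<open>2^(S+1) p(u / 2) - p(u)\<close> has degree at most \<open>S\<close>, is bounded on the unit
interval by \<open>(2^(S+1) + 1) B\<close>, and its coefficients are those of \<open>p\<close> multiplied by \<open>2^(S+1-k) - 1\<close>,
which is at least \<open>1\<close>.  The top coefficient is then found from \<open>p(1)\<close>.\<close>

lemma polynomial_coefficients_bounded:
  "\<exists>\<Gamma>\<ge>0. \<forall>(a :: nat \<Rightarrow> real) B.
    (\<forall>u\<in>{0..1}. \<bar>\<Sum>k\<le>S. a k * u ^ k\<bar> \<le> B) \<longrightarrow> (\<forall>k\<le>S. \<bar>a k\<bar> \<le> \<Gamma> * B)"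
proof (induction S)
  case 0
  show ?case
  proof (intro exI[of _ 1] conjI allI impI)
    fix a :: "nat \<Rightarrow> real" and B :: real and k :: nat
    assume bound: "\<forall>u\<in>{0..1}. \<bar>\<Sum>k\<le>0. a k * u ^ k\<bar> \<le> B" and "k \<le> 0"
    thus "\<bar>a k\<bar> \<le> 1 * B" using bound[rule_format, of 0] by simp
  qed simp
next
  case (Suc S)
  then obtain \<Gamma> :: real where \<Gamma>: "0 \<le> \<Gamma>"
    and coeff: "\<And>(a :: nat \<Rightarrow> real) B k. (\<And>u. u \<in> {0..1} \<Longrightarrow> \<bar>\<Sum>k\<le>S. a k * u ^ k\<bar> \<le> B) \<Longrightarrow> k \<le> S \<Longrightarrow> \<bar>a k\<bar> \<le> \<Gamma> * B"
    by metis
  define \<Gamma>' where "\<Gamma>' = \<Gamma> * (2 ^ Suc S + 1)"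
  have \<Gamma>': "0 \<le> \<Gamma>'" using \<Gamma> by (simp add: \<Gamma>'_def)
  show ?case
  proof (intro exI[of _ "\<Gamma>' + 1 + Suc S * \<Gamma>'"] conjI allI impI)
    show "0 \<le> \<Gamma>' + 1 + Suc S * \<Gamma>'" using \<Gamma>' by simp
    fix a :: "nat \<Rightarrow> real" and B :: real and k
    assume bound: "\<forall>u\<in>{0..1}. \<bar>\<Sum>k\<le>Suc S. a k * u ^ k\<bar> \<le> B" and "k \<le> Suc S"
    have B: "0 \<le> B" using bound[rule_format, of 0] by (simp del: sum.atMost_Suc)
    have low: "\<bar>a k\<bar> \<le> \<Gamma>' * B" if "k \<le> S" for k
    proof -
      define b where "b k = a k * (2 ^ (Suc S - k) - 1)" for k
      have "\<bar>\<Sum>k\<le>S. b k * u ^ k\<bar> \<le> (2 ^ Suc S + 1) * B" if u: "u \<in> {0..1}" for u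
      proof -
        have "(\<Sum>k\<le>S. b k * u ^ k) = (\<Sum>k\<le>Suc S. b k * u ^ k)"
          by (simp add: b_def)
        also have "\<dots> = (\<Sum>k\<le>Suc S. 2 ^ Suc S * (a k * (u / 2) ^ k) - a k * u ^ k)"
        proof (rule sum.cong)
          fix k assume "k \<in> {..Suc S}"
          hence "(2::real) ^ Suc S = 2 ^ (Suc S - k) * 2 ^ k"
            by (simp only: power_add[symmetric]) simp
          thus "b k * u ^ k = 2 ^ Suc S * (a k * (u / 2) ^ k) - a k * u ^ k"
            unfolding b_def by (simp add: power_divide algebra_simps del: power_Suc)
        qed simp
        also have "\<dots> = 2 ^ Suc S * (\<Sum>k\<le>Suc S. a k * (u / 2) ^ k) - (\<Sum>k\<le>Suc S. a k * u ^ k)"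
          by (simp only: sum_subtractf sum_distrib_left)
        also have "\<bar>\<dots>\<bar> \<le> 2 ^ Suc S * \<bar>\<Sum>k\<le>Suc S. a k * (u / 2) ^ k\<bar> + \<bar>\<Sum>k\<le>Suc S. a k * u ^ k\<bar>"
          by (rule order_trans[OF abs_triangle_ineq4]) (simp only: abs_mult, simp)
        also have "\<dots> \<le> 2 ^ Suc S * B + B"
          using u by (intro add_mono mult_left_mono bound[rule_format]) auto
        finally show ?thesis by (simp add: algebra_simps)
      qed
      from coeff[OF this that] have "\<bar>b k\<bar> \<le> \<Gamma>' * B"
        by (simp add: \<Gamma>'_def mult.assoc)
      moreover have "\<bar>a k\<bar> \<le> \<bar>b k\<bar>"
      proof -
        have "(2::real) ^ 1 \<le> 2 ^ (Suc S - k)" using that by (intro power_increasing) auto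
        hence "\<bar>a k\<bar> * 1 \<le> \<bar>a k\<bar> * \<bar>2 ^ (Suc S - k) - 1\<bar>" by (intro mult_left_mono) auto
        thus ?thesis by (simp add: b_def abs_mult)
      qed
      ultimately show ?thesis by linarith
    qed
    have top: "\<bar>a (Suc S)\<bar> \<le> B + Suc S * (\<Gamma>' * B)"
    proof -
      have "\<bar>\<Sum>k\<le>Suc S. a k\<bar> \<le> B" using bound[rule_format, of 1] by simp
      moreover have "\<bar>\<Sum>k\<le>S. a k\<bar> \<le> Suc S * (\<Gamma>' * B)"
        using sum_bounded_above[of "{..S}" "\<lambda>k. \<bar>a k\<bar>" "\<Gamma>' * B"] low order_trans[OF sum_abs[of a "{..S}"]]
        by simp
      ultimately show ?thesis by simp
    qed
    have le: "\<Gamma>' * B \<le> (\<Gamma>' + 1 + Suc S * \<Gamma>') * B" "B + Suc S * (\<Gamma>' * B) \<le> (\<Gamma>' + 1 + Suc S * \<Gamma>') * B"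
      using B \<Gamma>' by (simp_all add: algebra_simps)
    show "\<bar>a k\<bar> \<le> (\<Gamma>' + 1 + Suc S * \<Gamma>') * B"
    proof (cases "k = Suc S")
      case True thus ?thesis using top le(2) by simp
    next
      case False thus ?thesis using low[of k] \<open>k \<le> Suc S\<close> le(1) by simp
    qed
  qed
qed

text \<open>A measurable function is almost everywhere a limit of continuous functions.  Clipping these at
\<open>\<plusminus>B\<close> does not disturb the limit and makes dominated convergence applicable.\<close>

lemma L1_continuous_approximation:
  fixes K :: "real \<Rightarrow> real"
  assumes meas: "K \<in> borel_measurable borel" and bdd: "\<And>u. \<bar>K u\<bar> \<le> B" and "0 < \<epsilon>"
  obtains \<phi> where "continuous_on UNIV \<phi>" "\<And>u. \<bar>\<phi> u\<bar> \<le> B"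
    "(LINT u|lborel. indicator {a..b} u * \<bar>K u - \<phi> u\<bar>) < \<epsilon>"
proof -
  have B: "0 \<le> B" using bdd[of 0] by linarith
  have "K \<in> borel_measurable lebesgue"
    using meas by (simp add: measurable_completion)
  then have "K measurable_on UNIV"
    by (intro lebesgue_measurable_imp_measurable_on) auto
  then obtain N \<gamma> where N: "negligible N" and cont: "\<And>n. continuous_on UNIV (\<gamma> n)"
    and lim: "\<And>x. x \<notin> N \<Longrightarrow> (\<lambda>n. \<gamma> n x) \<longlonglongrightarrow> K x"
    unfolding measurable_on_def by auto
  define \<phi> :: "nat \<Rightarrow> real \<Rightarrow> real" where "\<phi> n x = max (- B) (min B (\<gamma> n x))" for n x
  have \<phi>_cont: "continuous_on UNIV (\<phi> n)" for n
    unfolding \<phi>_def by (intro continuous_intros cont)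
  have \<phi>_bdd: "\<bar>\<phi> n x\<bar> \<le> B" for n x
    using B by (auto simp: \<phi>_def)
  have [measurable]: "\<phi> n \<in> borel_measurable borel" for n
    using \<phi>_cont by (rule borel_measurable_continuous_onI)
  note meas [measurable]
  have ae: "AE x in lborel. (\<lambda>n. indicator {a..b} x * \<bar>K x - \<phi> n x\<bar>) \<longlonglongrightarrow> 0"
  proof -
    obtain N' where "N' \<in> null_sets lborel" "N \<subseteq> N'"
      using N by (auto simp: negligible_iff_null_sets null_sets_completion_iff2)
    from this(1) have "AE x in lborel. x \<notin> N'" by (rule AE_not_in)
    hence "AE x in lborel. x \<notin> N"
      by (rule eventually_mono) (use \<open>N \<subseteq> N'\<close> in blast)
    thus ?thesis
    proof eventually_elim
      case (elim x)
      have "(\<lambda>n. max (- B) (min B (\<gamma> n x))) \<longlonglongrightarrow> max (- B) (min B (K x))"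
        by (intro tendsto_intros lim elim)
      moreover have "max (- B) (min B (K x)) = K x"
        using bdd[of x] by (auto simp: max_def min_def abs_le_iff)
      ultimately have "(\<lambda>n. \<phi> n x) \<longlonglongrightarrow> K x" by (simp add: \<phi>_def)
      hence "(\<lambda>n. indicator {a..b} x * \<bar>K x - \<phi> n x\<bar>) \<longlonglongrightarrow> indicator {a..b} x * \<bar>K x - K x\<bar>"
        by (intro tendsto_intros)
      thus ?case by simp
    qed
  qed
  have "(\<lambda>n. LINT u|lborel. indicator {a..b} u * \<bar>K u - \<phi> n u\<bar>) \<longlonglongrightarrow> integral\<^sup>L lborel (\<lambda>_::real. 0::real)"
  proof (rule integral_dominated_convergence[where w = "\<lambda>u. indicator {a..b} u * (2 * B)"])
    show "integrable lborel (\<lambda>u. indicator {a..b} u * (2 * B))"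
      by (simp add: emeasure_lborel_Icc_eq integrable_real_mult_indicator)
    show "AE x in lborel. norm (indicator {a..b} x * \<bar>K x - \<phi> n x\<bar>) \<le> indicator {a..b} x * (2 * B)" for n
    proof (rule AE_I2)
      fix x
      show "norm (indicator {a..b} x * \<bar>K x - \<phi> n x\<bar>) \<le> indicator {a..b} x * (2 * B)"
        using bdd[of x] \<phi>_bdd[of n x] by (auto simp: indicator_def)
    qed
    show "(\<lambda>u. indicator {a..b} u * \<bar>K u - \<phi> n u\<bar>) \<in> borel_measurable lborel" for n
      by measurable
  qed (use ae in simp_all)
  hence "\<forall>\<^sub>F n in sequentially. (LINT u|lborel. indicator {a..b} u * \<bar>K u - \<phi> n u\<bar>) < \<epsilon>"
    using \<open>0 < \<epsilon>\<close> by (intro order_tendstoD) auto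
  then obtain n where "(LINT u|lborel. indicator {a..b} u * \<bar>K u - \<phi> n u\<bar>) < \<epsilon>"
    by (auto simp: eventually_sequentially)
  with \<phi>_cont \<phi>_bdd show ?thesis by (intro that) auto
qed

text \<open>Since \<open>K\<close> is bounded, it suffices to bound the difference in \<open>L\<^sup>1\<close>.  There, \<open>K\<close> is replaced by a
continuous \<open>\<phi>\<close> at a cost that stays comparable under dilations by factors near \<open>1\<close>, and \<open>\<phi>\<close> is
uniformly continuous on a compact interval.  For factors between \<open>1/2\<close> and \<open>3/2\<close> the
difference vanishes outside \<open>[-2, 2]\<close>, and dilation maps this interval into \<open>[-3, 3]\<close>.\<close>

lemma dilation_L2_continuous:
  fixes K :: "real \<Rightarrow> real"
  assumes meas: "K \<in> borel_measurable borel" and bdd: "\<And>u. \<bar>K u\<bar> \<le> B"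
    and support: "\<And>u. 1 < \<bar>u\<bar> \<Longrightarrow> K u = 0"
  shows "((\<lambda>\<rho>. LINT u|lborel. (\<rho> * K (\<rho> * u) - K u)\<^sup>2) \<longlongrightarrow> 0) (nhds 1)"
proof (rule tendstoI)
  fix \<epsilon> :: real assume "0 < \<epsilon>"
  have B: "0 \<le> B" using bdd[of 0] by linarith
  note meas [measurable]
  \<comment> \<open>The final estimate is \<open>3 B (4 B + 7) \<delta>\<close>; the summand \<open>1\<close> in \<open>B + 1\<close> avoids a division by zero.\<close>
  define \<delta> where "\<delta> = \<epsilon> / (3 * (B + 1) * (4 * B + 7) * 2)"
  have \<delta>: "0 < \<delta>" using B \<open>0 < \<epsilon>\<close> by (simp add: \<delta>_def)
  obtain \<phi> where \<phi>: "continuous_on UNIV \<phi>" "\<And>u. \<bar>\<phi> u\<bar> \<le> B"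
    "(LINT u|lborel. indicator {-3..3} u * \<bar>K u - \<phi> u\<bar>) < \<delta>"
    using L1_continuous_approximation[OF meas bdd \<delta>] by blast
  have [measurable]: "\<phi> \<in> borel_measurable borel"
    using \<phi>(1) by (rule borel_measurable_continuous_onI)
  define J where "J u = indicator {-3..3} u * \<bar>K u - \<phi> u\<bar>" for u :: real
  have [measurable]: "J \<in> borel_measurable borel" unfolding J_def by measurable
  have J0: "0 \<le> J u" for u by (simp add: J_def)
  have J_int: "integrable lborel J"
  proof (rule Bochner_Integration.integrable_bound[where f = "\<lambda>u. indicator {-3..3} u * (2 * B)"])
    show "integrable lborel (\<lambda>u. indicator {-3..3::real} u * (2 * B))"
      by (simp add: emeasure_lborel_Icc_eq integrable_real_mult_indicator)
    show "AE x in lborel. norm (J x) \<le> norm (indicator {-3..3} x * (2 * B))"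
    proof (rule AE_I2)
      fix x
      show "norm (J x) \<le> norm (indicator {-3..3} x * (2 * B))"
        using bdd[of x] \<phi>(2)[of x] B by (auto simp: indicator_def J_def)
    qed
  qed measurable
  obtain d where d: "0 < d"
    and unif: "\<And>x y. x \<in> {-3..3} \<Longrightarrow> y \<in> {-3..3} \<Longrightarrow> dist y x < d \<Longrightarrow> dist (\<phi> y) (\<phi> x) < \<delta>"
    using compact_uniformly_continuous[OF continuous_on_subset[OF \<phi>(1)], of "{-3..3}"] \<delta>
    unfolding uniformly_continuous_on_def by (metis compact_Icc subset_UNIV)
  have "\<forall>\<^sub>F \<rho> in nhds 1. \<bar>\<rho> - 1\<bar> < min (min (1/2) \<delta>) (d / 2)"
    using eventually_nhds_metric[of _ "1::real"] d \<delta>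
    by (intro eventually_nhds_metric[THEN iffD2] exI[of _ "min (min (1/2) \<delta>) (d / 2)"]) (auto simp: dist_real_def)
  thus "\<forall>\<^sub>F \<rho> in nhds 1. dist (LINT u|lborel. (\<rho> * K (\<rho> * u) - K u)\<^sup>2) 0 < \<epsilon>"
  proof eventually_elim
    case (elim \<rho>)
    hence \<rho>: "1/2 < \<rho>" "\<rho> < 3/2" and near: "\<bar>\<rho> - 1\<bar> < \<delta>" "2 * \<bar>\<rho> - 1\<bar> < d"
      unfolding min_less_iff_conj by (linarith, linarith, linarith, simp)
    define w where "w u = 3 * B * ((\<delta> * B + \<delta>) * indicator {-2..2} u + J (0 + \<rho> * u) + J u)" for u
    have w_int: "integrable lborel w"
      unfolding w_def using \<rho>
      by (intro integrable_mult_right Bochner_Integration.integrable_add J_int lborel_integrable_real_affine)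
        (auto simp: emeasure_lborel_Icc_eq)
    have pt: "(\<rho> * K (\<rho> * u) - K u)\<^sup>2 \<le> w u" for u
    proof (cases "u \<in> {-2..2}")
      case False
      hence "1 < \<bar>u\<bar>" "2 < \<bar>u\<bar>" by auto
      hence "1/2 * 2 < \<rho> * \<bar>u\<bar>" using \<rho> by (intro mult_strict_mono) auto
      hence "K (\<rho> * u) = 0" "K u = 0" using \<rho> \<open>1 < \<bar>u\<bar>\<close> by (auto intro!: support simp: abs_mult)
      thus ?thesis using J0 B \<delta> by (simp add: w_def)
    next
      case True
      have "\<rho> * \<bar>u\<bar> \<le> 3/2 * 2" using True \<rho> by (intro mult_mono) auto
      hence *: "u \<in> {-3..3}" "\<rho> * u \<in> {-3..3}"
        using True \<rho> abs_le_iff[of "\<rho> * u" 3] by (auto simp: abs_mult)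
      have Ju: "J u = \<bar>K u - \<phi> u\<bar>" "J (\<rho> * u) = \<bar>K (\<rho> * u) - \<phi> (\<rho> * u)\<bar>"
        using * by (simp_all add: J_def)
      have "\<bar>\<rho> - 1\<bar> * \<bar>u\<bar> \<le> \<bar>\<rho> - 1\<bar> * 2" using True by (intro mult_left_mono) auto
      moreover have "dist (\<rho> * u) u = \<bar>\<rho> - 1\<bar> * \<bar>u\<bar>"
        by (simp add: dist_real_def abs_mult[symmetric] left_diff_distrib)
      ultimately have "dist (\<rho> * u) u < d" using near by linarith
      from unif[OF * this] have "\<bar>\<phi> (\<rho> * u) - \<phi> u\<bar> < \<delta>" by (simp add: dist_real_def)
      moreover have "\<bar>(\<rho> - 1) * K (\<rho> * u)\<bar> \<le> \<delta> * B"
        unfolding abs_mult using near bdd by (intro mult_mono) auto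
      moreover have "\<rho> * K (\<rho> * u) - K u = (\<rho> - 1) * K (\<rho> * u) + (K (\<rho> * u) - \<phi> (\<rho> * u))
          + (\<phi> (\<rho> * u) - \<phi> u) + (\<phi> u - K u)" by (simp add: algebra_simps)
      ultimately have le: "\<bar>\<rho> * K (\<rho> * u) - K u\<bar> \<le> \<delta> * B + \<delta> + J (\<rho> * u) + J u"
        unfolding Ju by linarith
      have "\<bar>\<rho> * K (\<rho> * u)\<bar> \<le> 3/2 * B"
        unfolding abs_mult using \<rho> bdd by (intro mult_mono) auto
      hence "\<bar>\<rho> * K (\<rho> * u) - K u\<bar> \<le> 3 * B" using bdd[of u] by linarith
      hence "\<bar>\<rho> * K (\<rho> * u) - K u\<bar> * \<bar>\<rho> * K (\<rho> * u) - K u\<bar> \<le> 3 * B * (\<delta> * B + \<delta> + J (\<rho> * u) + J u)"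
        using le B by (intro mult_mono) auto
      thus ?thesis using True by (simp add: w_def power2_eq_square abs_mult_self_eq)
    qed
    have "(LINT u|lborel. (\<rho> * K (\<rho> * u) - K u)\<^sup>2) \<le> (LINT u|lborel. w u)"
      using w_int pt by (intro integral_mono_AE' AE_I2) (auto intro: order_trans[OF zero_le_power2])
    also have "\<dots> = 3 * B * ((\<delta> * B + \<delta>) * 4 + (LINT u|lborel. J (0 + \<rho> * u)) + (LINT u|lborel. J u))"
    proof -
      have "integrable lborel (\<lambda>u. J (0 + \<rho> * u))"
        using \<rho> by (intro lborel_integrable_real_affine J_int) auto
      thus ?thesis unfolding w_def using J_int
        by (subst integral_mult_right_zero, subst Bochner_Integration.integral_add)
          (auto simp: emeasure_lborel_Icc_eq)
    qed
    also have "\<dots> \<le> 3 * B * ((\<delta> * B + \<delta>) * 4 + 2 * \<delta> + \<delta>)"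
    proof -
      have Jd: "(LINT u|lborel. J u) \<le> \<delta>" using \<phi>(3) by (simp add: J_def)
      have "(LINT u|lborel. J u) = \<rho> * (LINT u|lborel. J (0 + \<rho> * u))"
        using lborel_integral_real_affine[of \<rho> J 0] \<rho> by simp
      moreover have "0 \<le> (LINT u|lborel. J (0 + \<rho> * u))" using J0 by simp
      hence "1/2 * (LINT u|lborel. J (0 + \<rho> * u)) \<le> \<rho> * (LINT u|lborel. J (0 + \<rho> * u))"
        using \<rho> by (intro mult_right_mono) auto
      ultimately have "(LINT u|lborel. J (0 + \<rho> * u)) \<le> 2 * \<delta>" using Jd by linarith
      with Jd B \<delta> show ?thesis by (intro mult_left_mono add_mono) auto
    qed
    also have "\<dots> \<le> 3 * (B + 1) * (4 * B + 7) * \<delta>"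
      using B \<delta> by (simp add: algebra_simps)
    also have "\<dots> = \<epsilon> / 2"
    proof -
      have "3 * (B + 1) * (4 * B + 7) \<noteq> 0" using B by simp
      thus ?thesis by (simp add: \<delta>_def)
    qed
    finally have "(LINT u|lborel. (\<rho> * K (\<rho> * u) - K u)\<^sup>2) < \<epsilon>" using \<open>0 < \<epsilon>\<close> by simp
    thus ?case by (simp add: dist_real_def)
  qed
qed

section \<open>Smoothing a density of the class\<close>

lemma kernel_interval_le_1: "u \<in> kernel_interval p \<Longrightarrow> \<bar>u\<bar> \<le> 1"
  by (cases p) auto

lemma zero_in_kernel_interval: "0 \<in> kernel_interval p"
  by (cases p) auto

lemma kernel_interval_scale: "u \<in> kernel_interval p \<Longrightarrow> 0 \<le> a \<Longrightarrow> a \<le> 1 \<Longrightarrow> a * u \<in> kernel_interval p"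
proof -
  assume u: "u \<in> kernel_interval p" and a: "0 \<le> a" "a \<le> 1"
  have "\<bar>a * u\<bar> \<le> 1" if "\<bar>u\<bar> \<le> 1" unfolding abs_mult using that a by (intro mult_le_one) auto
  moreover have "0 \<le> u \<Longrightarrow> 0 \<le> a * u" "u \<le> 0 \<Longrightarrow> a * u \<le> 0"
    using a by (auto simp: mult_nonneg_nonpos)
  ultimately show ?thesis using u by (cases p) (auto simp: abs_le_iff)
qed

text \<open>For a density \<open>f\<close> this is \<open>1 / h\<close> times the mean of \<open>G (X / h)\<close>, written after the
substitution \<open>x = h u\<close>, which keeps the domain of integration fixed while \<open>h\<close> varies.\<close>

definition smoothed :: "(real \<Rightarrow> real) \<Rightarrow> real \<Rightarrow> (real \<Rightarrow> real) \<Rightarrow> real" where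
  "smoothed f h G = (LINT u|lborel. f (h * u) * G u)"

lemma integral_rescale:
  assumes "0 < h"
  shows "(LINT x|lborel. f x * G (x / h)) = h * smoothed f h G"
  using lborel_integral_real_affine[of h "\<lambda>x. f x * G (x / h)" 0] assms by (simp add: smoothed_def)

locale density_estimation =
  fixes S :: nat and p :: position and K r :: "real \<Rightarrow> real" and B c C M :: real
  assumes S: "1 \<le> S" and kernel: "order_kernel S p K" and modulus: "modulus r"
    and M: "0 < M" and c: "0 < c" and K_bdd: "\<And>u. \<bar>K u\<bar> \<le> B"
begin

lemma K_measurable [measurable]: "K \<in> borel_measurable borel"
  using kernel by (simp add: order_kernel_def)

lemma B_nonneg: "0 \<le> B"
  using K_bdd[of 0] by linarith

lemma K_support: "u \<notin> kernel_interval p \<Longrightarrow> K u = 0"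
  using kernel closure_subset[of "{x. K x \<noteq> 0}"] by (auto simp: order_kernel_def supp_def)

lemma K_support_abs: "1 < \<bar>u\<bar> \<Longrightarrow> K u = 0"
  using K_support[of u] kernel_interval_le_1[of u p] by auto

lemma integrable_on_kernel_interval:
  fixes G :: "real \<Rightarrow> real"
  assumes "G \<in> borel_measurable borel" "\<And>u. \<bar>u\<bar> \<le> 1 \<Longrightarrow> \<bar>G u\<bar> \<le> b" "\<And>u. 1 < \<bar>u\<bar> \<Longrightarrow> G u = 0"
  shows "integrable lborel G" "(LINT u|lborel. \<bar>G u\<bar>) \<le> 2 * b"
proof -
  have b: "0 \<le> b" using assms(2)[of 0] by simp
  have le: "\<bar>G u\<bar> \<le> indicator {-1..1} u * b" for u
    using assms(2)[of u] assms(3)[of u] by (auto simp: indicator_def abs_le_iff)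
  have int: "integrable lborel (\<lambda>u. indicator {-1..1::real} u * b)"
    by (simp add: emeasure_lborel_Icc_eq integrable_real_mult_indicator)
  show G: "integrable lborel G"
    by (rule Bochner_Integration.integrable_bound[OF int]) (use assms le b in \<open>auto simp: abs_mult\<close>)
  have "(LINT u|lborel. \<bar>G u\<bar>) \<le> (LINT u|lborel. indicator {-1..1::real} u * b)"
    using G int le by (intro integral_mono) auto
  thus "(LINT u|lborel. \<bar>G u\<bar>) \<le> 2 * b" by simp
qed

lemma abs_integral_le:
  fixes G :: "real \<Rightarrow> real"
  assumes "G \<in> borel_measurable borel" "\<And>u. \<bar>u\<bar> \<le> 1 \<Longrightarrow> \<bar>G u\<bar> \<le> b" "\<And>u. 1 < \<bar>u\<bar> \<Longrightarrow> G u = 0"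
  shows "\<bar>LINT u|lborel. G u\<bar> \<le> 2 * b"
  using integrable_on_kernel_interval(2)[OF assms] by (rule order_trans[OF integral_abs_bound])

lemma K_power_integrable: "integrable lborel (\<lambda>u. u ^ k * K u)"
proof (rule integrable_on_kernel_interval)
  fix u :: real assume "\<bar>u\<bar> \<le> 1"
  hence "\<bar>u\<bar> ^ k * \<bar>K u\<bar> \<le> 1 * B" by (intro mult_mono K_bdd power_le_one) auto
  thus "\<bar>u ^ k * K u\<bar> \<le> B" by (simp add: abs_mult power_abs)
qed (auto simp: K_support_abs)

lemma K_integral: "(LINT u|lborel. K u) = 1"
proof -
  have "(LINT u|lborel. K u) = (LINT u:kernel_interval p|lborel. K u)"
    unfolding set_lebesgue_integral_def
    by (intro Bochner_Integration.integral_cong) (auto simp: indicator_def K_support)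
  thus ?thesis using kernel by (simp add: order_kernel_def)
qed

lemma K_moment:
  assumes "1 \<le> k" "k \<le> S"
  shows "(LINT u|lborel. u ^ k * K u) = 0"
proof -
  have "(LINT u|lborel. u ^ k * K u) = (LINT u:kernel_interval p|lborel. u ^ k * K u)"
    unfolding set_lebesgue_integral_def
    by (intro Bochner_Integration.integral_cong) (auto simp: indicator_def K_support)
  thus ?thesis using kernel assms by (simp add: order_kernel_def)
qed

definition \<kappa> :: real where "\<kappa> = (LINT u|lborel. (K u)\<^sup>2)"

lemma \<kappa>_eq: "(LINT u:kernel_interval p|lborel. (K u)\<^sup>2) = \<kappa>"
  unfolding set_lebesgue_integral_def \<kappa>_def
  by (intro Bochner_Integration.integral_cong) (auto simp: indicator_def K_support)

lemma K_square_le: "(K u)\<^sup>2 \<le> B\<^sup>2"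
  using power_mono[OF K_bdd[of u], of 2] by simp

text \<open>Expand the integral of the square of \<open>K\<close> minus one half of the indicator of \<open>[-1, 1]\<close>, which is
nonnegative.\<close>

lemma \<kappa>_ge: "1 / 2 \<le> \<kappa>"
proof -
  have K2: "integrable lborel (\<lambda>u. (K u)\<^sup>2)"
    by (rule integrable_on_kernel_interval[where b = "B\<^sup>2"]) (auto simp: K_support_abs K_square_le)
  have K1: "integrable lborel K" using K_power_integrable[of 0] by simp
  have I1: "integrable lborel (indicator {-1..1::real} :: real \<Rightarrow> real)"
    by (simp add: emeasure_lborel_Icc_eq)
  have "0 \<le> (LINT u|lborel. (K u - 1 / 2 * indicator {-1..1} u)\<^sup>2)" by simp
  also have "\<dots> = (LINT u|lborel. (K u)\<^sup>2 - K u + 1 / 4 * indicator {-1..1} u)"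
  proof (rule Bochner_Integration.integral_cong)
    fix u
    show "(K u - 1 / 2 * indicator {-1..1} u)\<^sup>2 = (K u)\<^sup>2 - K u + 1 / 4 * indicator {-1..1} u"
      using K_support_abs[of u] by (cases "u \<in> {-1..1}") (auto simp: power2_eq_square algebra_simps)
  qed simp
  also have "\<dots> = \<kappa> - 1 + 1 / 4 * 2"
    using K1 K2 I1 K_integral by (simp add: \<kappa>_def)
  finally show ?thesis by simp
qed

abbreviation "g n \<equiv> bandwidth_unit S n"
abbreviation "\<psi> n \<equiv> window S n"
abbreviation "\<D> n \<equiv> density_class S p c C M r n"

lemma g_pos: "2 \<le> n \<Longrightarrow> 0 < g n"
  by (simp add: bandwidth_unit_def)

lemma \<psi>_pos: "2 \<le> n \<Longrightarrow> 0 < \<psi> n"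
  by (simp add: window_def g_pos)

lemma lebesgue_density: "f \<in> \<D> n \<Longrightarrow> lebesgue_density f"
  by (simp add: density_class_def)

text \<open>The kernel interval is star-shaped about \<open>0\<close>, so what the class requires at the scale
\<open>\<psi> n\<close> holds at all smaller scales.\<close>

lemma density_bounds:
  assumes "f \<in> \<D> n" "2 \<le> n" "u \<in> kernel_interval p" "0 \<le> h" "h \<le> \<psi> n"
  shows "h * u \<in> supp f" "c \<le> f (h * u)" "f (h * u) \<le> C"
proof -
  have "h * u = \<psi> n * (h / \<psi> n * u)" using \<psi>_pos[OF assms(2)] by simp
  moreover have "h / \<psi> n * u \<in> kernel_interval p"
    using assms \<psi>_pos[OF assms(2)] by (intro kernel_interval_scale) auto
  ultimately show *: "h * u \<in> supp f" and "f (h * u) \<le> C"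
    using assms(1) by (auto simp: density_class_def)
  from * show "c \<le> f (h * u)" using assms(1) by (auto simp: density_class_def)
qed

definition taylor :: "(real \<Rightarrow> real) \<Rightarrow> nat \<Rightarrow> real" where
  "taylor f s = deriv_within (supp f) s f 0 / fact s"

lemma taylor_0: "taylor f 0 = f 0"
  by (simp add: taylor_def)

lemma taylor_remainder:
  assumes f: "f \<in> \<D> n" and n: "2 \<le> n" and u: "u \<in> kernel_interval p" and h: "0 \<le> h" "h \<le> \<psi> n"
  shows "\<bar>f (h * u) - (\<Sum>s\<le>S. taylor f s * (h * u) ^ s)\<bar> \<le> M * r h * h ^ S"
proof -
  have u1: "\<bar>u\<bar> \<le> 1" using u by (rule kernel_interval_le_1)
  have hu: "\<bar>h * u\<bar> \<le> h" unfolding abs_mult using h u1 mult_left_mono[of "\<bar>u\<bar>" 1 h] by simp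
  have "{..S} = insert 0 {1..S}" by auto
  hence "(\<Sum>s\<le>S. taylor f s * (h * u) ^ s)
      = f 0 + (\<Sum>s=1..S. deriv_within (supp f) s f 0 / fact s * (h * u) ^ s)"
    by (simp add: taylor_0) (simp add: taylor_def)
  moreover have "\<bar>f (h * u) - f 0 - (\<Sum>s=1..S. deriv_within (supp f) s f 0 / fact s * (h * u) ^ s)\<bar>
      \<le> M * r \<bar>h * u\<bar> * \<bar>h * u\<bar> ^ S"
    using f density_bounds(1)[OF f n u h] hu h by (auto simp: density_class_def theta0_def)
  ultimately have "\<bar>f (h * u) - (\<Sum>s\<le>S. taylor f s * (h * u) ^ s)\<bar> \<le> M * r \<bar>h * u\<bar> * \<bar>h * u\<bar> ^ S"
    by (simp add: algebra_simps)
  also have "\<dots> \<le> M * r h * h ^ S"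
  proof (intro mult_mono power_mono hu)
    show "r \<bar>h * u\<bar> \<le> r h"
      using modulus hu h by (auto simp: modulus_def intro: mono_onD)
  qed (use modulus M h in \<open>auto simp: modulus_def\<close>)
  finally show ?thesis .
qed

lemma r_nonneg: "0 \<le> h \<Longrightarrow> 0 \<le> r h"
  using modulus by (simp add: modulus_def)

lemma density_measurable [measurable]: "f \<in> \<D> n \<Longrightarrow> f \<in> borel_measurable borel"
  by (simp add: density_class_def lebesgue_density_def)

lemma smoothed_integrable:
  assumes f: "f \<in> \<D> n" and n: "2 \<le> n" and h: "0 \<le> h" "h \<le> \<psi> n"
    and G: "G \<in> borel_measurable borel" "\<And>u. \<bar>G u\<bar> \<le> b" "\<And>u. u \<notin> kernel_interval p \<Longrightarrow> G u = 0"
  shows "integrable lborel (\<lambda>u. f (h * u) * G u)"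
proof (rule integrable_on_kernel_interval[where b = "C * b"])
  have C: "0 \<le> C" using density_bounds(2,3)[OF f n zero_in_kernel_interval h] c by simp
  show "(\<lambda>u. f (h * u) * G u) \<in> borel_measurable borel"
    using f G(1) by measurable
  fix u :: real
  show "\<bar>f (h * u) * G u\<bar> \<le> C * b"
  proof (cases "u \<in> kernel_interval p")
    case True
    have "\<bar>f (h * u)\<bar> \<le> C" using density_bounds(2,3)[OF f n True h] c by simp
    thus ?thesis unfolding abs_mult using G(2) C by (intro mult_mono) auto
  next
    case False
    have "0 \<le> b" using G(2)[of 0] by linarith
    thus ?thesis using G(3)[OF False] C by simp
  qed
  show "f (h * u) * G u = 0" if "1 < \<bar>u\<bar>"
    using that G(3)[of u] kernel_interval_le_1[of u p] by auto
qed

text \<open>The moments of the kernel annihilate all Taylor terms but the constant one, and only the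
remainder is left.\<close>

lemma smoothed_bias:
  assumes f: "f \<in> \<D> n" and n: "2 \<le> n" and h: "0 \<le> h" "h \<le> \<psi> n"
  shows "\<bar>smoothed f h K - f 0\<bar> \<le> 2 * (M * r h * h ^ S * B)"
proof -
  define P where "P u = (\<Sum>s\<le>S. taylor f s * (h * u) ^ s)" for u
  have [measurable]: "P \<in> borel_measurable borel" unfolding P_def by measurable
  have term_int: "integrable lborel (\<lambda>u. taylor f s * (h * u) ^ s * K u)" for s
    using integrable_mult_right[OF K_power_integrable[of s], of "taylor f s * h ^ s"]
    by (simp add: power_mult_distrib mult_ac)
  have PK: "integrable lborel (\<lambda>u. P u * K u)"
    unfolding P_def sum_distrib_right using term_int by auto
  have "(LINT u|lborel. P u * K u) = (\<Sum>s\<le>S. LINT u|lborel. taylor f s * (h * u) ^ s * K u)"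
    unfolding P_def sum_distrib_right using term_int by (subst Bochner_Integration.integral_sum) auto
  also have "\<dots> = (\<Sum>s\<le>S. taylor f s * h ^ s * (LINT u|lborel. u ^ s * K u))"
    by (simp add: power_mult_distrib mult.assoc)
  also have "\<dots> = (\<Sum>s\<in>{0}. taylor f s * h ^ s * (LINT u|lborel. u ^ s * K u))"
    by (rule sum.mono_neutral_right) (auto simp: K_moment Suc_le_eq)
  also have "\<dots> = f 0" by (simp add: taylor_0 K_integral)
  finally have "smoothed f h K - f 0 = (LINT u|lborel. (f (h * u) - P u) * K u)"
    unfolding smoothed_def left_diff_distrib
    using smoothed_integrable[OF f n h K_measurable K_bdd K_support] PK
    by (subst Bochner_Integration.integral_diff) auto
  also have "\<bar>\<dots>\<bar> \<le> 2 * (M * r h * h ^ S * B)"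
  proof (rule abs_integral_le)
    show "(\<lambda>u. (f (h * u) - P u) * K u) \<in> borel_measurable borel" using f by measurable
    fix u :: real
    show "\<bar>(f (h * u) - P u) * K u\<bar> \<le> M * r h * h ^ S * B"
    proof (cases "u \<in> kernel_interval p")
      case True
      show ?thesis unfolding abs_mult P_def
        using taylor_remainder[OF f n True h] K_bdd[of u] M h r_nonneg by (intro mult_mono) auto
    qed (use M h r_nonneg B_nonneg in \<open>simp add: K_support\<close>)
  qed (simp add: K_support_abs)
  finally show ?thesis .
qed

text \<open>The Taylor polynomial at scale \<open>\<psi> n\<close> is bounded by \<open>C\<close> plus the remainder, hence so are its
coefficients.  Passing from \<open>\<psi> n\<close> to the smaller scale \<open>h\<close> multiplies each nonconstant term by at
most \<open>h / \<psi> n\<close>.\<close>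

lemma density_oscillation:
  obtains \<Gamma> where "0 \<le> \<Gamma>"
    "\<And>f n u h. f \<in> \<D> n \<Longrightarrow> 2 \<le> n \<Longrightarrow> u \<in> kernel_interval p \<Longrightarrow> 0 \<le> h \<Longrightarrow> h \<le> \<psi> n \<Longrightarrow>
      \<bar>f (h * u) - f 0\<bar> \<le> S * (\<Gamma> * (C + M * r (\<psi> n) * \<psi> n ^ S) * (h / \<psi> n)) + M * r (\<psi> n) * \<psi> n ^ S"
proof -
  obtain \<Gamma> :: real where \<Gamma>: "0 \<le> \<Gamma>"
    and coeff: "\<And>(a :: nat \<Rightarrow> real) B k. (\<And>u. u \<in> {0..1} \<Longrightarrow> \<bar>\<Sum>k\<le>S. a k * u ^ k\<bar> \<le> B) \<Longrightarrow> k \<le> S \<Longrightarrow> \<bar>a k\<bar> \<le> \<Gamma> * B"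
    using polynomial_coefficients_bounded[of S] by metis
  show ?thesis
  proof (rule that[OF \<Gamma>])
    fix f n u h
    assume f: "f \<in> \<D> n" and n: "2 \<le> n" and u: "u \<in> kernel_interval p" and h: "0 \<le> h" "h \<le> \<psi> n"
    define R where "R = M * r (\<psi> n) * \<psi> n ^ S"
    have \<psi>: "0 < \<psi> n" using \<psi>_pos[OF n] .
    \<comment> \<open>The sign turns the unit interval into a part of the kernel interval in all three positions.\<close>
    define \<sigma> :: real where "\<sigma> = (if p = Right_Boundary then -1 else 1)"
    have \<sigma>: "\<sigma> * x \<in> kernel_interval p" if "x \<in> {0..1}" for x
      using that by (cases p) (auto simp: \<sigma>_def)
    have poly: "\<bar>\<Sum>s\<le>S. (taylor f s * \<psi> n ^ s * \<sigma> ^ s) * x ^ s\<bar> \<le> C + R" if x: "x \<in> {0..1}" for x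
    proof -
      have "(\<Sum>s\<le>S. (taylor f s * \<psi> n ^ s * \<sigma> ^ s) * x ^ s) = (\<Sum>s\<le>S. taylor f s * (\<psi> n * (\<sigma> * x)) ^ s)"
        by (simp add: power_mult_distrib mult_ac)
      moreover have "\<bar>f (\<psi> n * (\<sigma> * x)) - (\<Sum>s\<le>S. taylor f s * (\<psi> n * (\<sigma> * x)) ^ s)\<bar> \<le> R"
        unfolding R_def using \<psi> by (intro taylor_remainder[OF f n \<sigma>[OF x]]) auto
      moreover have "\<bar>f (\<psi> n * (\<sigma> * x))\<bar> \<le> C"
        using density_bounds(2,3)[OF f n \<sigma>[OF x], of "\<psi> n"] \<psi> c by auto
      ultimately show ?thesis by linarith
    qed
    have CR: "0 \<le> C + R" using poly[of 0] by (rule order_trans[OF abs_ge_zero]) simp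
    have a: "\<bar>taylor f s\<bar> * \<psi> n ^ s \<le> \<Gamma> * (C + R)" if "s \<le> S" for s
    proof -
      have "\<bar>taylor f s * \<psi> n ^ s * \<sigma> ^ s\<bar> \<le> \<Gamma> * (C + R)"
        by (rule coeff[OF poly that])
      thus ?thesis using \<psi> by (simp add: abs_mult power_abs \<sigma>_def split: if_splits)
    qed
    have hu: "\<bar>h * u\<bar> \<le> h"
      unfolding abs_mult using h kernel_interval_le_1[OF u] mult_left_mono[of "\<bar>u\<bar>" 1 h] by auto
    have summand: "\<bar>taylor f s * (h * u) ^ s\<bar> \<le> \<Gamma> * (C + R) * (h / \<psi> n)" if s: "s \<in> {1..S}" for s
    proof -
      have "\<bar>taylor f s * (h * u) ^ s\<bar> \<le> \<bar>taylor f s\<bar> * h ^ s"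
        unfolding abs_mult power_abs using hu by (intro mult_left_mono power_mono) auto
      also have "\<dots> = (\<bar>taylor f s\<bar> * \<psi> n ^ s) * (h / \<psi> n) ^ s"
        using \<psi> by (simp add: power_divide)
      also have "\<dots> \<le> (\<Gamma> * (C + R)) * (h / \<psi> n)"
      proof (rule mult_mono[OF a])
        have "(h / \<psi> n) ^ s \<le> (h / \<psi> n) ^ 1"
          using h \<psi> s by (intro power_decreasing) auto
        thus "(h / \<psi> n) ^ s \<le> h / \<psi> n" by simp
      qed (use s \<Gamma> CR h \<psi> in auto)
      finally show ?thesis .
    qed
    have "{..S} = insert 0 {1..S}" by auto
    hence "(\<Sum>s\<le>S. taylor f s * (h * u) ^ s) = f 0 + (\<Sum>s=1..S. taylor f s * (h * u) ^ s)"
      by (simp add: taylor_0)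
    moreover have "\<bar>\<Sum>s=1..S. taylor f s * (h * u) ^ s\<bar> \<le> S * (\<Gamma> * (C + R) * (h / \<psi> n))"
    proof (rule order_trans[OF sum_abs])
      have "(\<Sum>s=1..S. \<bar>taylor f s * (h * u) ^ s\<bar>) \<le> card {1..S} * (\<Gamma> * (C + R) * (h / \<psi> n))"
        by (rule sum_bounded_above) (rule summand)
      thus "(\<Sum>s=1..S. \<bar>taylor f s * (h * u) ^ s\<bar>) \<le> S * (\<Gamma> * (C + R) * (h / \<psi> n))" by simp
    qed
    moreover have "\<bar>f (h * u) - (\<Sum>s\<le>S. taylor f s * (h * u) ^ s)\<bar> \<le> R"
    proof -
      have "M * r h * h ^ S \<le> R"
        unfolding R_def
      proof (intro mult_mono power_mono)
        show "r h \<le> r (\<psi> n)" using modulus h by (auto simp: modulus_def intro: mono_onD)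
      qed (use M h r_nonneg in auto)
      thus ?thesis using taylor_remainder[OF f n u h] by linarith
    qed
    ultimately show "\<bar>f (h * u) - f 0\<bar>
        \<le> S * (\<Gamma> * (C + M * r (\<psi> n) * \<psi> n ^ S) * (h / \<psi> n)) + M * r (\<psi> n) * \<psi> n ^ S"
      unfolding R_def by linarith
  qed
qed

text \<open>Convergence along this filter is convergence as \<open>n\<close> tends to infinity through the even numbers,
uniformly over the densities in the \<open>n\<close>-th class.\<close>

definition class_limit :: "(nat \<times> (real \<Rightarrow> real)) filter" where
  "class_limit = inf (filtercomap fst sequentially) (principal {(n, f). even n \<and> f \<in> \<D> n})"

lemma eventually_class_limit:
  "eventually P class_limit \<longleftrightarrow> (\<forall>\<^sub>F n in sequentially. \<forall>f. even n \<longrightarrow> f \<in> \<D> n \<longrightarrow> P (n, f))"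
  unfolding class_limit_def eventually_inf_principal eventually_filtercomap
  by (auto simp: eventually_sequentially)

lemma fst_class_limit: "filterlim fst sequentially class_limit"
  by (rule filterlim_mono[OF filterlim_filtercomap[of fst sequentially]])
    (auto simp: class_limit_def)

lemma class_limit_intro: "(\<forall>\<^sub>F n in sequentially. P n) \<Longrightarrow> \<forall>\<^sub>F z in class_limit. P (fst z)"
  using fst_class_limit by (simp add: filterlim_iff)

lemma class_limit_member: "\<forall>\<^sub>F z in class_limit. even (fst z) \<and> snd z \<in> \<D> (fst z) \<and> 2 \<le> fst z"
  unfolding eventually_class_limit
  using eventually_ge_at_top[of "2::nat"] by eventually_elim auto

lemma tendsto_class_limit: "(X \<longlongrightarrow> l) sequentially \<Longrightarrow> ((\<lambda>z. X (fst z)) \<longlongrightarrow> l) class_limit"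
  by (rule filterlim_compose[OF _ fst_class_limit])

end

section \<open>Limits uniform over the class and the variance proxy\<close>

lemma powr_power_pos: "0 < k \<Longrightarrow> (x powr a) ^ k = x powr (a * real k)" for x a :: real
  by (cases "x = 0") (simp_all add: powr_power mult.commute)

text \<open>Factor \<open>a - b\<close> out and keep a single summand of the cofactor.  Read backwards, this is a Lipschitz
bound for roots.\<close>

lemma power_diff_lower_bound:
  fixes a b :: real
  assumes "0 \<le> a" "0 \<le> b"
  shows "\<bar>a - b\<bar> * b ^ k \<le> \<bar>a ^ Suc k - b ^ Suc k\<bar>"
proof -
  have "a ^ Suc k - b ^ Suc k = (a - b) * (\<Sum>i<Suc k. a ^ i * b ^ (k - i))"
    using power_diff_sumr2[of a "Suc k" b] by (simp add: mult.commute)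
  moreover have "b ^ k \<le> (\<Sum>i<Suc k. a ^ i * b ^ (k - i))"
  proof -
    have "(\<lambda>i. a ^ i * b ^ (k - i)) 0 \<le> (\<Sum>i<Suc k. a ^ i * b ^ (k - i))"
      using assms by (intro member_le_sum) auto
    thus ?thesis by simp
  qed
  moreover have "0 \<le> b ^ k" using assms by simp
  ultimately show ?thesis
    by (simp only: abs_mult) (intro mult_left_mono, auto)
qed

context density_estimation
begin

lemma bandwidth_unit_power: "1 \<le> n \<Longrightarrow> real n * g n ^ (2 * S + 1) = 1"
proof -
  assume n: "1 \<le> n"
  have "g n ^ (2 * S + 1) = real n powr (real (2 * S + 1) * (- 1 / (2 * real S + 1)))"
    unfolding bandwidth_unit_def using n by (simp only: powr_power of_nat_0_less_iff mult.commute)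
  also have "real (2 * S + 1) * (- 1 / (2 * real S + 1)) = - 1"
    by (simp add: field_simps)
  finally show ?thesis using n by (simp add: powr_minus_divide del: power_Suc)
qed

lemma ln_power_over_powr: "0 < b \<Longrightarrow> (\<lambda>n. ln (real n) ^ k / real n powr b) \<longlonglongrightarrow> 0"
proof (cases "k = 0")
  case True
  assume "0 < b"
  hence "((\<lambda>n. real n powr (- b)) \<longlongrightarrow> 0) sequentially"
    by (intro tendsto_neg_powr filterlim_real_sequentially) auto
  thus ?thesis using True by (simp add: powr_minus_divide)
next
  case False
  assume b: "0 < b"
  have "(\<lambda>n. ln (real n) / real n powr (b / k)) \<longlonglongrightarrow> 0"
    using b False by (intro lim_ln_over_power) simp
  hence "((\<lambda>n. (ln (real n) / real n powr (b / k)) ^ k) \<longlongrightarrow> 0 ^ k) sequentially"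
    by (rule tendsto_power)
  moreover have "\<forall>\<^sub>F n in sequentially. (ln (real n) / real n powr (b / k)) ^ k = ln (real n) ^ k / real n powr b"
    using eventually_gt_at_top[of 0]
    by eventually_elim (use False in \<open>simp add: power_divide powr_power\<close>)
  ultimately show ?thesis using False by (simp add: tendsto_cong power_0_left)
qed

lemma ln_n_at_top: "filterlim (\<lambda>n. ln (real n)) at_top sequentially"
  by (rule filterlim_compose[OF ln_at_top filterlim_real_sequentially])

lemma inverse_ln_power: "1 \<le> k \<Longrightarrow> (\<lambda>n. 1 / ln (real n) ^ k) \<longlonglongrightarrow> 0"
proof -
  assume k: "1 \<le> k"
  have "(\<lambda>n. inverse (ln (real n)) ^ k) \<longlonglongrightarrow> 0 ^ k"
    by (intro tendsto_power tendsto_inverse_0_at_top ln_n_at_top)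
  thus ?thesis using k by (simp add: divide_inverse power_inverse power_0_left)
qed

lemma bandwidth_unit_eq: "g n = 1 / real n powr (1 / (2 * real S + 1))"
  unfolding bandwidth_unit_def minus_divide_left[symmetric] by (rule powr_minus_divide)

lemma window_tendsto_0: "\<psi> \<longlonglongrightarrow> 0"
proof -
  have "(\<lambda>n. ln (real n) ^ 1 / real n powr (1 / (2 * real S + 1))) \<longlonglongrightarrow> 0"
    by (rule ln_power_over_powr) simp
  thus ?thesis
    by (simp add: window_def[abs_def] bandwidth_unit_eq)
qed

lemma g_tendsto_0: "g \<longlonglongrightarrow> 0"
proof -
  have "(\<lambda>n. ln (real n) ^ 0 / real n powr (1 / (2 * real S + 1))) \<longlonglongrightarrow> 0"
    by (rule ln_power_over_powr) simp
  thus ?thesis by (simp add: bandwidth_unit_eq[abs_def])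
qed

lemma remainder_tendsto_0: "(\<lambda>n. M * r (\<psi> n) * \<psi> n ^ S) \<longlonglongrightarrow> 0"
proof -
  have "\<forall>\<^sub>F n in sequentially. 0 < \<psi> n"
    using eventually_ge_at_top[of "2::nat"] by eventually_elim (rule \<psi>_pos)
  with window_tendsto_0 have "filterlim \<psi> (at_right 0) sequentially"
    by (rule tendsto_imp_filterlim_at_right)
  moreover have "(r \<longlongrightarrow> 0) (at_right 0)" using modulus by (simp add: modulus_def)
  ultimately have "(\<lambda>n. r (\<psi> n)) \<longlonglongrightarrow> 0" by (rule filterlim_compose[rotated])
  hence "(\<lambda>n. M * r (\<psi> n) * \<psi> n ^ S) \<longlonglongrightarrow> M * 0 * 0 ^ S"
    by (intro tendsto_intros window_tendsto_0)
  thus ?thesis by simp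
qed

lemma modulus_tendsto_0:
  assumes "(h \<longlongrightarrow> 0) F" "\<forall>\<^sub>F z in F. 0 < h z"
  shows "((\<lambda>z. r (h z)) \<longlongrightarrow> 0) F"
proof (rule filterlim_compose[of r _ "at_right 0" h])
  show "(r \<longlongrightarrow> 0) (at_right 0)" using modulus by (simp add: modulus_def)
  show "filterlim h (at_right 0) F" by (rule tendsto_imp_filterlim_at_right[OF assms])
qed

text \<open>At any scale negligible against the window, a density of the class may be replaced by its value
at \<open>0\<close>.\<close>

lemma smoothed_tendsto:
  fixes h :: "nat \<times> (real \<Rightarrow> real) \<Rightarrow> real"
  assumes h: "((\<lambda>z. h z / \<psi> (fst z)) \<longlongrightarrow> 0) class_limit" "\<forall>\<^sub>F z in class_limit. 0 \<le> h z"
    and G: "G \<in> borel_measurable borel" "\<And>u. \<bar>G u\<bar> \<le> b" "\<And>u. u \<notin> kernel_interval p \<Longrightarrow> G u = 0"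
  shows "((\<lambda>z. smoothed (snd z) (h z) G - snd z 0 * (LINT u|lborel. G u)) \<longlongrightarrow> 0) class_limit"
proof -
  obtain \<Gamma> where \<Gamma>: "0 \<le> \<Gamma>"
    and osc: "\<And>f n u h. f \<in> \<D> n \<Longrightarrow> 2 \<le> n \<Longrightarrow> u \<in> kernel_interval p \<Longrightarrow> 0 \<le> h \<Longrightarrow> h \<le> \<psi> n \<Longrightarrow>
      \<bar>f (h * u) - f 0\<bar> \<le> S * (\<Gamma> * (C + M * r (\<psi> n) * \<psi> n ^ S) * (h / \<psi> n)) + M * r (\<psi> n) * \<psi> n ^ S"
    using density_oscillation by metis
  define e where "e z = S * (\<Gamma> * (C + M * r (\<psi> (fst z)) * \<psi> (fst z) ^ S) * (h z / \<psi> (fst z)))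
    + M * r (\<psi> (fst z)) * \<psi> (fst z) ^ S" for z
  have "(e \<longlongrightarrow> S * (\<Gamma> * (C + 0) * 0) + 0) class_limit"
    unfolding e_def by (intro tendsto_intros h(1) tendsto_class_limit[OF remainder_tendsto_0])
  hence lim: "((\<lambda>z. 2 * (e z * b)) \<longlongrightarrow> 2 * (0 * b)) class_limit"
    by (intro tendsto_intros) simp
  have b: "0 \<le> b" using G(2)[of 0] by linarith
  have small: "\<forall>\<^sub>F z in class_limit. h z / \<psi> (fst z) < 1"
    by (rule order_tendstoD[OF h(1)]) simp
  have "\<forall>\<^sub>F z in class_limit. norm (smoothed (snd z) (h z) G - snd z 0 * (LINT u|lborel. G u)) \<le> 2 * (e z * b)"
    using class_limit_member small h(2)
  proof eventually_elim
    case (elim z)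
    define f n where "f = snd z" and "n = fst z"
    have f: "f \<in> \<D> n" and n: "2 \<le> n" using elim by (auto simp: f_def n_def)
    have h: "0 \<le> h z" "h z \<le> \<psi> n" using elim \<psi>_pos[OF n] by (auto simp: n_def)
    have e: "\<bar>f (h z * u) - f 0\<bar> \<le> e z" if "u \<in> kernel_interval p" for u
      using osc[OF f n that h] by (simp add: e_def n_def)
    have e0: "0 \<le> e z" using e[OF zero_in_kernel_interval] by simp
    have "integrable lborel G"
      by (rule integrable_on_kernel_interval[OF G(1) G(2)]) (use G(3) kernel_interval_le_1[of _ p] in force)
    hence "smoothed f (h z) G - f 0 * (LINT u|lborel. G u) = (LINT u|lborel. (f (h z * u) - f 0) * G u)"
      unfolding smoothed_def left_diff_distrib using smoothed_integrable[OF f n h G]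
      by (subst Bochner_Integration.integral_diff) auto
    also have "\<bar>\<dots>\<bar> \<le> 2 * (e z * b)"
    proof (rule abs_integral_le)
      show "(\<lambda>u. (f (h z * u) - f 0) * G u) \<in> borel_measurable borel" using f G(1) by measurable
      fix u :: real
      show "\<bar>(f (h z * u) - f 0) * G u\<bar> \<le> e z * b"
      proof (cases "u \<in> kernel_interval p")
        case True
        show ?thesis unfolding abs_mult using e[OF True] G(2) e0 by (intro mult_mono) auto
      qed (use e0 b in \<open>simp add: G(3)\<close>)
      show "(f (h z * u) - f 0) * G u = 0" if "1 < \<bar>u\<bar>"
        using that G(3)[of u] kernel_interval_le_1[of u p] by auto
    qed
    finally show ?case by (simp add: f_def)
  qed
  from Lim_null_comparison[OF this] lim show ?thesis by simp
qed

lemma g_over_window: "((\<lambda>z. g (fst z) / \<psi> (fst z)) \<longlongrightarrow> 0) class_limit"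
proof -
  have "\<forall>\<^sub>F n in sequentially. 1 / ln (real n) ^ 1 = g n / \<psi> n"
    using eventually_ge_at_top[of "2::nat"]
  proof eventually_elim
    case (elim n)
    thus ?case using g_pos[OF elim] by (simp add: window_def)
  qed
  hence "(\<lambda>n. g n / \<psi> n) \<longlonglongrightarrow> 0"
    using inverse_ln_power[of 1] by (simp add: tendsto_cong)
  thus ?thesis by (rule tendsto_class_limit)
qed

text \<open>The variance of \<open>K (X / g)\<close> divided by \<open>g\<close>, which is the mean of \<open>Vhat\<close> for even \<open>n\<close>.\<close>

definition proxy_mean :: "nat \<times> (real \<Rightarrow> real) \<Rightarrow> real" where
  "proxy_mean z = smoothed (snd z) (g (fst z)) (\<lambda>u. (K u)\<^sup>2) - g (fst z) * (smoothed (snd z) (g (fst z)) K)\<^sup>2"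

lemma density_0_bounds: "\<forall>\<^sub>F z in class_limit. c \<le> snd z 0 \<and> snd z 0 \<le> C"
  using class_limit_member
proof eventually_elim
  case (elim z)
  thus ?case using density_bounds(2,3)[of "snd z" "fst z" 0 0] zero_in_kernel_interval \<psi>_pos[of "fst z"]
    by auto
qed

lemma smoothed_square_tendsto:
  assumes "((\<lambda>z. h z / \<psi> (fst z)) \<longlongrightarrow> 0) class_limit" "\<forall>\<^sub>F z in class_limit. 0 \<le> h z"
  shows "((\<lambda>z. smoothed (snd z) (h z) (\<lambda>u. (K u)\<^sup>2) - snd z 0 * \<kappa>) \<longlongrightarrow> 0) class_limit"
  unfolding \<kappa>_def
  by (rule smoothed_tendsto[OF assms, where b = "B\<^sup>2"]) (auto simp: K_support K_square_le)

text \<open>The squared mean carries an additional factor \<open>g\<close> and vanishes, so only the second moment counts.\<close>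

lemma proxy_mean_tendsto: "((\<lambda>z. proxy_mean z - snd z 0 * \<kappa>) \<longlongrightarrow> 0) class_limit"
proof -
  have g0: "\<forall>\<^sub>F z in class_limit. 0 \<le> g (fst z)"
    by (rule always_eventually) (simp add: bandwidth_unit_def)
  have K1: "((\<lambda>z. smoothed (snd z) (g (fst z)) K - snd z 0 * 1) \<longlongrightarrow> 0) class_limit"
    using smoothed_tendsto[OF g_over_window g0 K_measurable K_bdd K_support] by (simp add: K_integral)
  have "\<forall>\<^sub>F z in class_limit. \<bar>smoothed (snd z) (g (fst z)) K - snd z 0 * 1\<bar> < 1"
    using tendstoD[OF K1, of 1] by simp
  hence bdd: "\<forall>\<^sub>F z in class_limit. norm (g (fst z) * (smoothed (snd z) (g (fst z)) K)\<^sup>2) \<le> g (fst z) * (C + 1)\<^sup>2"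
    using density_0_bounds g0
  proof eventually_elim
    case (elim z)
    hence "\<bar>smoothed (snd z) (g (fst z)) K\<bar> \<le> \<bar>C + 1\<bar>" using c by linarith
    hence "(smoothed (snd z) (g (fst z)) K)\<^sup>2 \<le> (C + 1)\<^sup>2" by (simp only: abs_le_square_iff)
    thus ?case using elim by (simp add: abs_mult mult_left_mono)
  qed
  have "((\<lambda>z. g (fst z) * (C + 1)\<^sup>2) \<longlongrightarrow> 0 * (C + 1)\<^sup>2) class_limit"
    by (intro tendsto_intros tendsto_class_limit g_tendsto_0)
  hence "((\<lambda>z. g (fst z) * (smoothed (snd z) (g (fst z)) K)\<^sup>2) \<longlongrightarrow> 0) class_limit"
    using Lim_null_comparison[OF bdd] by simp
  from tendsto_diff[OF smoothed_square_tendsto[OF g_over_window g0] this]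
  show ?thesis by (simp add: proxy_mean_def algebra_simps)
qed

text \<open>These two constants bound the mean of the proxy away from zero and infinity, uniformly over the
class.  The first is half of the smallest possible limit.\<close>

definition "proxy_lo = c * \<kappa> / 2"
definition "proxy_hi = C * \<kappa> + 1"

lemma proxy_lo_pos: "0 < proxy_lo"
  using c \<kappa>_ge by (simp add: proxy_lo_def)

lemma proxy_mean_bounds: "\<forall>\<^sub>F z in class_limit. proxy_lo \<le> proxy_mean z \<and> proxy_mean z \<le> proxy_hi"
proof -
  have "0 < min 1 proxy_lo" using proxy_lo_pos by simp
  from tendstoD[OF proxy_mean_tendsto this] density_0_bounds show ?thesis
  proof eventually_elim
    case (elim z)
    have "c * \<kappa> \<le> snd z 0 * \<kappa>" "snd z 0 * \<kappa> \<le> C * \<kappa>"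
      using elim \<kappa>_ge by (auto intro: mult_right_mono)
    moreover have "\<bar>proxy_mean z - snd z 0 * \<kappa>\<bar> < 1" "\<bar>proxy_mean z - snd z 0 * \<kappa>\<bar> < c * \<kappa> / 2"
      using elim by (simp_all add: dist_real_def proxy_lo_def)
    ultimately show ?case unfolding proxy_lo_def proxy_hi_def by linarith
  qed
qed

lemma kernel_coordinate_measurable:
  assumes "i \<in> {1..n}"
  shows "(\<lambda>X. K (X i / h)) \<in> borel_measurable (sample n f)"
  using measurable_sample_coordinate[OF assms, of f] by measurable

lemma fhat_measurable [measurable]: "fhat K n h \<in> borel_measurable (sample n f)"
  unfolding fhat_def by (intro borel_measurable_times borel_measurable_const borel_measurable_sum kernel_coordinate_measurable)

lemma Vhat_measurable [measurable]: "Vhat S K n \<in> borel_measurable (sample n f)"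
  unfolding Vhat_def Let_def
  by (intro borel_measurable_times borel_measurable_const borel_measurable_sum borel_measurable_power
      borel_measurable_diff kernel_coordinate_measurable) auto

text \<open>The squared differences come from disjoint pairs of observations and are independent.  They are
bounded by \<open>4 B\<^sup>2\<close>, so their second moments are at most \<open>4 B\<^sup>2\<close> times their common mean
\<open>2 g proxy_mean\<close>.\<close>

lemma Vhat_concentration:
  assumes f: "f \<in> \<D> n" and n: "2 \<le> n" "even n" and \<epsilon>: "0 < \<epsilon>"
  shows "measure (sample n f) {X \<in> space (sample n f). \<epsilon> \<le> \<bar>Vhat S K n X - proxy_mean (n, f)\<bar>}
    \<le> 4 * B\<^sup>2 * proxy_mean (n, f) / (n * g n * \<epsilon>\<^sup>2)"
proof -
  note den = lebesgue_density[OF f]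
  interpret prob_space "sample n f" by (rule prob_space_sample[OF den])
  have g: "0 < g n" using g_pos[OF n(1)] .
  define Y where "Y i X = K (X i / g n)" for i and X :: "nat \<Rightarrow> real"
  define D where "D i X = (Y (2 * i) X - Y (2 * i - 1) X)\<^sup>2" for i X
  define J where "J = {1..n div 2}"
  have fin: "finite J" by (simp add: J_def)
  have card: "real (card J) = n / 2" using n(2) by (auto simp: J_def elim!: evenE)
  have Ym: "Y i \<in> borel_measurable (sample n f)" if "i \<in> {1..n}" for i
    unfolding Y_def by (rule kernel_coordinate_measurable[OF that])
  have Yb: "\<bar>Y i X\<bar> \<le> B" for i X by (simp add: Y_def K_bdd)
  have Y1: "expectation (Y i) = g n * smoothed f (g n) K" if "i \<in> {1..n}" for i
    unfolding Y_def by (subst expectation_sample_coordinate[OF den that]) (auto simp: integral_rescale[OF g])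
  have Y2: "expectation (\<lambda>X. (Y i X)\<^sup>2) = g n * smoothed f (g n) (\<lambda>u. (K u)\<^sup>2)" if "i \<in> {1..n}" for i
    unfolding Y_def
    by (subst expectation_sample_coordinate[OF den that, of "\<lambda>x. (K (x / g n))\<^sup>2"])
      (auto simp: integral_rescale[OF g, of f "\<lambda>u. (K u)\<^sup>2"])
  have indepY: "indep_vars (\<lambda>_. borel) Y {1..n}"
    unfolding Y_def by (rule indep_vars_compose2[OF indep_vars_sample[OF den]]) auto
  have pair: "2 * i \<in> {1..n}" "2 * i - 1 \<in> {1..n}" "2 * i - 1 \<noteq> 2 * i" if "i \<in> J" for i
    using that by (auto simp: J_def)
  have indepD: "indep_vars (\<lambda>_. borel) D J"
  proof -
    have "indep_vars (\<lambda>i. PiM {2 * i - 1, 2 * i} (\<lambda>_. borel)) (\<lambda>i X. \<lambda>j\<in>{2 * i - 1, 2 * i}. Y j X) J"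
      by (rule indep_vars_restrict[OF indepY]) (auto simp: J_def disjoint_family_on_def)
    hence "indep_vars (\<lambda>_. borel)
        (\<lambda>i X. (\<lambda>Z. (Z (2 * i) - Z (2 * i - 1))\<^sup>2) (\<lambda>j\<in>{2 * i - 1, 2 * i}. Y j X)) J"
      by (rule indep_vars_compose2) auto
    thus ?thesis by (simp add: D_def[abs_def])
  qed
  have DB: "\<bar>D i X\<bar> \<le> 4 * B\<^sup>2" "0 \<le> D i X" for i X
  proof -
    have "\<bar>Y (2 * i) X - Y (2 * i - 1) X\<bar> \<le> 2 * B" using Yb[of "2 * i" X] Yb[of "2 * i - 1" X] by linarith
    from power_mono[OF this, of 2] show "\<bar>D i X\<bar> \<le> 4 * B\<^sup>2" by (simp add: D_def power_mult_distrib)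
  qed (simp add: D_def)
  have Dm: "D i \<in> borel_measurable (sample n f)" if "i \<in> J" for i
    using indepD that by (auto simp: indep_vars_def)
  have Dint: "integrable (sample n f) (D i)" if "i \<in> J" for i
    using integrable_bounded[OF Dm[OF that] DB(1)] .
  have mean: "expectation (D i) = 2 * (g n * proxy_mean (n, f))" if i: "i \<in> J" for i
  proof -
    note p = pair[OF i]
    have int: "integrable (sample n f) (Y j)" "integrable (sample n f) (\<lambda>X. (Y j X)\<^sup>2)" if "j \<in> {1..n}" for j
    proof -
      show "integrable (sample n f) (Y j)" by (rule integrable_bounded[OF Ym[OF that] Yb])
      show "integrable (sample n f) (\<lambda>X. (Y j X)\<^sup>2)"
      proof (rule integrable_bounded[where B = "B\<^sup>2"])
        show "(\<lambda>X. (Y j X)\<^sup>2) \<in> borel_measurable (sample n f)" using Ym[OF that] by measurable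
      qed (simp add: Y_def K_square_le)
    qed
    have ind2: "indep_vars (\<lambda>_. borel) Y {2 * i - 1, 2 * i}"
      by (rule indep_vars_subset[OF indepY]) (use p in auto)
    have int2: "integrable (sample n f) (Y j)" if "j \<in> {2 * i - 1, 2 * i}" for j
      using that p int by blast
    have prod: "expectation (\<lambda>X. Y (2 * i - 1) X * Y (2 * i) X) = expectation (Y (2 * i - 1)) * expectation (Y (2 * i))"
      "integrable (sample n f) (\<lambda>X. Y (2 * i - 1) X * Y (2 * i) X)"
      using indep_vars_lebesgue_integral[OF _ ind2 int2] indep_vars_integrable[OF _ ind2 int2] p(3) by simp_all
    have "expectation (D i) = expectation (\<lambda>X. (Y (2 * i) X)\<^sup>2 + (Y (2 * i - 1) X)\<^sup>2 - 2 * (Y (2 * i - 1) X * Y (2 * i) X))"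
      by (intro Bochner_Integration.integral_cong) (simp_all add: D_def power2_eq_square algebra_simps)
    also have "\<dots> = expectation (\<lambda>X. (Y (2 * i) X)\<^sup>2) + expectation (\<lambda>X. (Y (2 * i - 1) X)\<^sup>2)
        - 2 * expectation (\<lambda>X. Y (2 * i - 1) X * Y (2 * i) X)"
      using prod(2) int p by simp
    also have "\<dots> = 2 * (g n * proxy_mean (n, f))"
      unfolding prod(1) Y1[OF p(1)] Y1[OF p(2)] Y2[OF p(1)] Y2[OF p(2)]
      by (simp add: proxy_mean_def power2_eq_square algebra_simps)
    finally show ?thesis .
  qed
  have square: "expectation (\<lambda>X. (D i X)\<^sup>2) \<le> 8 * B\<^sup>2 * (g n * proxy_mean (n, f))" if i: "i \<in> J" for i
  proof -
    have "expectation (\<lambda>X. (D i X)\<^sup>2) \<le> expectation (\<lambda>X. 4 * B\<^sup>2 * D i X)"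
    proof (rule integral_mono_AE')
      show "integrable (sample n f) (\<lambda>X. 4 * B\<^sup>2 * D i X)" using Dint[OF i] by simp
      show "AE X in sample n f. (D i X)\<^sup>2 \<le> 4 * B\<^sup>2 * D i X"
        unfolding power2_eq_square using DB[of i] by (intro AE_I2 mult_right_mono) (auto simp: power2_eq_square)
      show "AE X in sample n f. 0 \<le> 4 * B\<^sup>2 * D i X" using DB(2)[of i] by (intro AE_I2) auto
    qed
    thus ?thesis using mean[OF i] by simp
  qed
  have "\<epsilon> \<le> \<bar>Vhat S K n X - proxy_mean (n, f)\<bar> \<longleftrightarrow> n * g n * \<epsilon> \<le> \<bar>(\<Sum>i\<in>J. D i X) - card J * (2 * (g n * proxy_mean (n, f)))\<bar>" for X
  proof -
    have ng: "0 < n * g n" using n g by simp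
    have "Vhat S K n X = (\<Sum>i\<in>J. D i X) / (n * g n)"
      by (simp add: Vhat_def Let_def D_def Y_def J_def)
    hence "(\<Sum>i\<in>J. D i X) - card J * (2 * (g n * proxy_mean (n, f))) = n * g n * (Vhat S K n X - proxy_mean (n, f))"
      using n g by (simp add: card algebra_simps)
    thus ?thesis by (simp only: abs_mult[of "n * g n"] abs_of_pos[OF ng] mult_le_cancel_left_pos[OF ng])
  qed
  hence "prob {X \<in> space (sample n f). \<epsilon> \<le> \<bar>Vhat S K n X - proxy_mean (n, f)\<bar>}
      = prob {X \<in> space (sample n f). n * g n * \<epsilon> \<le> \<bar>(\<Sum>i\<in>J. D i X) - card J * (2 * (g n * proxy_mean (n, f)))\<bar>}"
    by simp
  also have "\<dots> \<le> card J * (8 * B\<^sup>2 * (g n * proxy_mean (n, f))) / (n * g n * \<epsilon>)\<^sup>2"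
    by (rule prob_sum_deviation_le_square[OF fin indepD DB(1) mean square]) (use n g \<epsilon> in auto)
  also have "\<dots> = 4 * B\<^sup>2 * proxy_mean (n, f) / (n * g n * \<epsilon>\<^sup>2)"
    using n g \<epsilon> by (simp add: card power2_eq_square field_simps)
  finally show ?thesis .
qed

section \<open>Deviations of the density estimator\<close>

text \<open>The sign \<open>\<sigma>\<close> selects the upper or the lower tail.\<close>

lemma fhat_deviation:
  assumes f: "f \<in> \<D> n" and n: "2 \<le> n" and h: "0 < h" "h \<le> \<psi> n" and \<sigma>: "\<sigma> \<in> {1, -1}"
    and \<theta>: "0 \<le> \<theta>"
  shows "measure (sample n f) {X \<in> space (sample n f). \<tau> \<le> \<sigma> * (fhat K n h X - smoothed f h K)}
    \<le> exp (- \<theta> * (n * h * \<tau>) + n * (\<theta>\<^sup>2 * (h * smoothed f h (\<lambda>u. (K u)\<^sup>2)) / 2 * exp (2 * \<theta> * B)))"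
proof -
  note den = lebesgue_density[OF f]
  interpret prob_space "sample n f" by (rule prob_space_sample[OF den])
  define Y where "Y i X = \<sigma> * K (X i / h)" for i and X :: "nat \<Rightarrow> real"
  have indepY: "indep_vars (\<lambda>_. borel) Y {1..n}"
    unfolding Y_def by (rule indep_vars_compose2[OF indep_vars_sample[OF den]]) auto
  have Yb: "\<bar>Y i X\<bar> \<le> B" for i X using \<sigma> K_bdd by (auto simp: Y_def)
  have Y1: "expectation (Y i) = \<sigma> * (h * smoothed f h K)" if "i \<in> {1..n}" for i
    unfolding Y_def by (subst integral_mult_right_zero, subst expectation_sample_coordinate[OF den that])
      (auto simp: integral_rescale[OF h(1)])
  have Y2: "expectation (\<lambda>X. (Y i X)\<^sup>2) \<le> h * smoothed f h (\<lambda>u. (K u)\<^sup>2)" if "i \<in> {1..n}" for i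
  proof -
    have "expectation (\<lambda>X. (Y i X)\<^sup>2) = expectation (\<lambda>X. (K (X i / h))\<^sup>2)"
      using \<sigma> by (intro Bochner_Integration.integral_cong) (auto simp: Y_def)
    also have "\<dots> = h * smoothed f h (\<lambda>u. (K u)\<^sup>2)"
      by (subst expectation_sample_coordinate[OF den that, of "\<lambda>x. (K (x / h))\<^sup>2"])
        (auto simp: integral_rescale[OF h(1), of f "\<lambda>u. (K u)\<^sup>2"])
    finally show ?thesis by simp
  qed
  have w: "0 \<le> h * smoothed f h (\<lambda>u. (K u)\<^sup>2)"
    using den h by (auto simp: smoothed_def lebesgue_density_def intro!: mult_nonneg_nonneg)
  have "\<tau> \<le> \<sigma> * (fhat K n h X - smoothed f h K)
      \<longleftrightarrow> n * h * \<tau> \<le> (\<Sum>i\<in>{1..n}. Y i X) - card {1..n} * (\<sigma> * (h * smoothed f h K))" for X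
  proof -
    have nh: "0 < n * h" using n h by simp
    have "(\<Sum>i\<in>{1..n}. Y i X) - card {1..n} * (\<sigma> * (h * smoothed f h K))
        = n * h * (\<sigma> * (fhat K n h X - smoothed f h K))"
      using n h by (simp add: Y_def fhat_def sum_distrib_left[symmetric] algebra_simps)
    thus ?thesis using nh by (simp only: mult_le_cancel_left_pos)
  qed
  thus ?thesis
    using prob_sum_deviation_le_exp[OF _ indepY Yb Y1 Y2 \<theta> w, of "n * h * \<tau>"] by simp
qed

definition dilation_error :: "real \<Rightarrow> real" where
  "dilation_error \<rho> = (LINT u|lborel. (\<rho> * K (\<rho> * u) - K u)\<^sup>2)"

lemma dilation_error_tendsto: "(\<rho> \<longlongrightarrow> 1) F \<Longrightarrow> ((\<lambda>z. dilation_error (\<rho> z)) \<longlongrightarrow> 0) F"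
  unfolding dilation_error_def
  by (rule filterlim_compose[OF dilation_L2_continuous[OF K_measurable K_bdd K_support_abs]])

text \<open>In the variable \<open>u = x / h\<close> the difference of the two rescaled kernels is
\<open>(\<rho> K (\<rho> u) - K u) / h\<close> with \<open>\<rho> = h / h'\<close>.  Its second moment is bounded by means of the upper
bound \<open>C\<close> of the density.\<close>

lemma fhat_difference_deviation:
  assumes f: "f \<in> \<D> n" and n: "2 \<le> n" and h: "0 < h" "h \<le> \<psi> n" and h': "0 < h'" "h' \<le> \<psi> n"
    and ratio: "h' \<le> 2 * h" and a: "0 < a"
  shows "measure (sample n f) {X \<in> space (sample n f).
      a \<le> \<bar>fhat K n h' X - fhat K n h X - (smoothed f h' K - smoothed f h K)\<bar>}
    \<le> C * dilation_error (h / h') / (n * h * a\<^sup>2)"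
proof -
  note den = lebesgue_density[OF f]
  interpret prob_space "sample n f" by (rule prob_space_sample[OF den])
  define W where "W x = K (x / h') / h' - K (x / h) / h" for x
  have [measurable]: "W \<in> borel_measurable borel" unfolding W_def by measurable
  define Y where "Y i X = W (X i)" for i and X :: "nat \<Rightarrow> real"
  have indepY: "indep_vars (\<lambda>_. borel) Y {1..n}"
    unfolding Y_def by (rule indep_vars_compose2[OF indep_vars_sample[OF den]]) auto
  have "\<bar>K x\<bar> / h \<le> B / h" "\<bar>K x\<bar> / h' \<le> B / h'" for x
    using K_bdd h h' by (auto intro: divide_right_mono)
  hence Wb: "\<bar>W x\<bar> \<le> B / h' + B / h" for x
    using h h' unfolding W_def by (intro order_trans[OF abs_triangle_ineq4] add_mono) (auto simp: abs_divide)
  have Yb: "\<bar>Y i X\<bar> \<le> B / h' + B / h" for i X by (simp add: Y_def Wb)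
  have int: "integrable (sample n f) (\<lambda>X. K (X i / b) / b)" if "i \<in> {1..n}" for i b
  proof (rule integrable_bounded[where B = "B / \<bar>b\<bar>"])
    show "(\<lambda>X. K (X i / b) / b) \<in> borel_measurable (sample n f)"
      using kernel_coordinate_measurable[OF that] by measurable
    show "\<bar>K (X i / b) / b\<bar> \<le> B / \<bar>b\<bar>" for X
      unfolding abs_divide using K_bdd by (intro divide_right_mono) auto
  qed
  have Y1: "expectation (Y i) = smoothed f h' K - smoothed f h K" if "i \<in> {1..n}" for i
  proof -
    have one: "expectation (\<lambda>X. K (X i / b) / b) = smoothed f b K" if "0 < b" for b
      using \<open>i \<in> {1..n}\<close> that expectation_sample_coordinate[OF den \<open>i \<in> {1..n}\<close>, of "\<lambda>x. K (x / b)"]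
      by (simp add: integral_rescale)
    show ?thesis
      unfolding Y_def W_def
      by (simp only: Bochner_Integration.integral_diff[OF int[OF that] int[OF that]] one[OF h(1)] one[OF h'(1)])
  qed
  define \<rho> where "\<rho> = h / h'"
  have \<rho>: "1 / 2 \<le> \<rho>" using ratio h h' by (simp add: \<rho>_def field_simps)
  have Y2: "expectation (\<lambda>X. (Y i X)\<^sup>2) \<le> C * dilation_error \<rho> / h" if i: "i \<in> {1..n}" for i
  proof -
    define G where "G u = (\<rho> * K (\<rho> * u) - K u)\<^sup>2" for u
    have G_meas: "G \<in> borel_measurable borel" unfolding G_def by measurable
    have G_supp: "\<rho> * u \<in> kernel_interval p \<or> u \<in> kernel_interval p" if "G u \<noteq> 0" for u
    proof (rule ccontr)
      assume "\<not> ?thesis"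
      hence "K (\<rho> * u) = 0" "K u = 0" by (auto simp: K_support)
      with that show False by (simp add: G_def)
    qed
    have WG: "(W x)\<^sup>2 = G (x / h) / h\<^sup>2" for x
    proof -
      have "W x = (\<rho> * K (\<rho> * (x / h)) - K (x / h)) / h"
        using h h' by (simp add: W_def \<rho>_def field_simps)
      thus ?thesis by (simp add: G_def power_divide)
    qed
    have "expectation (\<lambda>X. (Y i X)\<^sup>2) = (LINT x|lborel. f x * (W x)\<^sup>2)"
      unfolding Y_def by (rule expectation_sample_coordinate[OF den i]) measurable
    also have "\<dots> = (LINT x|lborel. f x * G (x / h)) / h\<^sup>2"
      unfolding WG by (simp add: mult_ac flip: integral_divide_zero)
    also have "\<dots> = smoothed f h G / h"
      using h by (simp add: integral_rescale[OF h(1)] power2_eq_square)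
    also have "smoothed f h G \<le> C * dilation_error \<rho>"
    proof -
      have G0: "0 \<le> G u" for u by (simp add: G_def)
      have Gi: "integrable lborel G"
      proof (rule Bochner_Integration.integrable_bound[where f = "\<lambda>u. indicator {-2..2} u * ((\<rho> * B + B)\<^sup>2)"])
        show "integrable lborel (\<lambda>u. indicator {-2..2::real} u * ((\<rho> * B + B)\<^sup>2))"
          by (simp add: emeasure_lborel_Icc_eq integrable_real_mult_indicator)
        have "norm (G u) \<le> norm (indicator {-2..2} u * ((\<rho> * B + B)\<^sup>2))" for u
        proof (cases "\<bar>u\<bar> \<le> 2")
          case True
          have "\<bar>\<rho> * K (\<rho> * u) - K u\<bar> \<le> \<rho> * B + B"
            using \<rho> K_bdd by (intro order_trans[OF abs_triangle_ineq4] add_mono) (auto simp: abs_mult intro: mult_left_mono)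
          from power_mono[OF this, of 2] True show ?thesis by (simp add: G_def indicator_def abs_le_iff)
        next
          case False
          have "1 / 2 * 2 < \<rho> * \<bar>u\<bar>" using False \<rho> by (intro mult_le_less_imp_less) auto
          hence "1 < \<bar>\<rho> * u\<bar>" using \<rho> by (simp add: abs_mult)
          hence "G u = 0" using False by (simp add: G_def K_support_abs)
          thus ?thesis by simp
        qed
        thus "AE u in lborel. norm (G u) \<le> norm (indicator {-2..2} u * ((\<rho> * B + B)\<^sup>2))" by simp
      qed (use G_meas in simp)
      have le: "f (h * u) * G u \<le> C * G u" for u
      proof (cases "G u = 0")
        case False
        have eq: "h * u = h' * (\<rho> * u)" using h' by (simp add: \<rho>_def)
        from G_supp[OF False] have "f (h * u) \<le> C"
        proof
          assume "\<rho> * u \<in> kernel_interval p"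
          thus ?thesis unfolding eq using h' by (intro density_bounds(3)[OF f n]) auto
        next
          assume "u \<in> kernel_interval p"
          thus ?thesis using h by (intro density_bounds(3)[OF f n]) auto
        qed
        thus ?thesis using G0 by (intro mult_right_mono) auto
      qed simp
      have f0: "0 \<le> f x" for x using den by (simp add: lebesgue_density_def)
      have C0: "0 \<le> C * G u" for u using le[of u] G0[of u] f0[of "h * u"] by (meson mult_nonneg_nonneg order_trans)
      have "smoothed f h G \<le> (LINT u|lborel. C * G u)"
        unfolding smoothed_def using Gi le C0 by (intro integral_mono_AE' AE_I2) auto
      also have "\<dots> = C * dilation_error \<rho>" by (simp add: dilation_error_def G_def)
      finally show ?thesis .
    qed
    finally show ?thesis using h by (simp add: divide_right_mono)
  qed
  have "a \<le> \<bar>fhat K n h' X - fhat K n h X - (smoothed f h' K - smoothed f h K)\<bar>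
      \<longleftrightarrow> n * a \<le> \<bar>(\<Sum>i\<in>{1..n}. Y i X) - card {1..n} * (smoothed f h' K - smoothed f h K)\<bar>" for X
  proof -
    have n0: "0 < real n" using n by simp
    have "(\<Sum>i\<in>{1..n}. Y i X) = n * (fhat K n h' X - fhat K n h X)"
      using n by (simp add: Y_def W_def fhat_def sum_subtractf right_diff_distrib flip: sum_divide_distrib)
    hence "(\<Sum>i\<in>{1..n}. Y i X) - card {1..n} * (smoothed f h' K - smoothed f h K)
        = n * (fhat K n h' X - fhat K n h X - (smoothed f h' K - smoothed f h K))"
      by (simp add: algebra_simps)
    thus ?thesis using n0 by (simp add: abs_mult)
  qed
  hence "measure (sample n f) {X \<in> space (sample n f).
      a \<le> \<bar>fhat K n h' X - fhat K n h X - (smoothed f h' K - smoothed f h K)\<bar>}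
    \<le> card {1..n} * (C * dilation_error \<rho> / h) / (n * a)\<^sup>2"
    using prob_sum_deviation_le_square[OF _ indepY Yb Y1 Y2, of "n * a"] n a by simp
  also have "\<dots> = C * dilation_error (h / h') / (n * h * a\<^sup>2)"
    using n h a by (simp add: \<rho>_def power2_eq_square)
  finally show ?thesis .
qed

end

locale interval_level = density_estimation +
  fixes \<eta> t :: real
  assumes \<eta>: "0 < \<eta>" and t: "0 < t" "t < 1"
begin

text \<open>With this constant and \<open>bw_scale\<close>, the unrounded bandwidth is \<open>g n * bw_scale (Vhat ...)\<close>.\<close>

definition A :: real where "A = 2 * ln (1 / t) / (4 * (real S)\<^sup>2 * \<eta>\<^sup>2)"

lemma A_pos: "0 < A"
proof -
  have "0 < ln (1 / t)" using t by simp
  thus ?thesis unfolding A_def using S \<eta> by (intro divide_pos_pos mult_pos_pos) auto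
qed

definition bw_scale :: "real \<Rightarrow> real" where "bw_scale x = (A * x) powr (1 / (2 * real S + 1))"

lemma bw_scale_power: "0 \<le> x \<Longrightarrow> bw_scale x ^ (2 * S + 1) = A * x"
proof -
  assume "0 \<le> x"
  have "bw_scale x ^ (2 * S + 1) = (A * x) powr (1 / (2 * real S + 1) * real (2 * S + 1))"
    unfolding bw_scale_def by (rule powr_power_pos) simp
  also have "1 / (2 * real S + 1) * real (2 * S + 1) = 1" by (simp add: field_simps)
  finally show ?thesis using \<open>0 \<le> x\<close> A_pos by simp
qed

lemma bw_scale_nonneg: "0 \<le> bw_scale x"
  by (simp add: bw_scale_def)

lemma bw_scale_pos: "0 < x \<Longrightarrow> 0 < bw_scale x"
  using A_pos by (simp add: bw_scale_def)

lemma bw_scale_mono: "0 \<le> x \<Longrightarrow> x \<le> y \<Longrightarrow> bw_scale x \<le> bw_scale y"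
  unfolding bw_scale_def using A_pos by (intro powr_mono2) auto

lemma bw_scale_diff: "0 \<le> x \<Longrightarrow> 0 < y \<Longrightarrow> \<bar>bw_scale x - bw_scale y\<bar> \<le> A * \<bar>x - y\<bar> / bw_scale y ^ (2 * S)"
proof -
  assume x: "0 \<le> x" and y: "0 < y"
  have "\<bar>bw_scale x - bw_scale y\<bar> * bw_scale y ^ (2 * S) \<le> \<bar>bw_scale x ^ Suc (2 * S) - bw_scale y ^ Suc (2 * S)\<bar>"
    by (rule power_diff_lower_bound) (simp_all add: bw_scale_nonneg)
  also have "\<dots> = A * \<bar>x - y\<bar>"
    using bw_scale_power[of x] bw_scale_power[of y] x y A_pos
    by (simp add: abs_mult flip: right_diff_distrib)
  finally show ?thesis using bw_scale_pos[OF y] by (simp add: field_simps)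
qed

lemma Vhat_nonneg: "0 \<le> Vhat S K n X"
  by (simp add: Vhat_def Let_def bandwidth_unit_def sum_nonneg)

lemma hhat_eq: "hhat S \<eta> K n t X = g n * bw_scale (Vhat S K n X)"
proof -
  have "2 * ln (1 / t) * Vhat S K n X / (4 * (real S)\<^sup>2 * \<eta>\<^sup>2 * real n) = (A * Vhat S K n X) * (1 / real n)"
    by (simp add: A_def)
  hence "hhat S \<eta> K n t X = (A * Vhat S K n X) powr (1 / (2 * real S + 1)) * (1 / real n) powr (1 / (2 * real S + 1))"
    unfolding hhat_def using A_pos Vhat_nonneg by (simp only:) (intro powr_mult; simp)
  moreover have "(1 / real n) powr (1 / (2 * real S + 1)) = g n"
    by (simp add: bandwidth_unit_eq powr_divide)
  ultimately show ?thesis by (simp add: bw_scale_def)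
qed

text \<open>The radius is \<open>(2 S + 1) \<eta>\<close> times the \<open>S\<close>-th power of the unrounded bandwidth, up to the
factor \<open>1 + ln n powr (-3)\<close>: the powers of \<open>\<eta>\<close> add up to \<open>\<eta>\<close>.\<close>

lemma radius_eq: "radius S \<eta> K n t X = (2 * real S + 1) * (1 + ln (real n) powr (-3)) * (\<eta> * (g n * bw_scale (Vhat S K n X)) ^ S)"
proof -
  define V where "V = Vhat S K n X"
  define m where "m = 2 * real S + 1"
  have V: "0 \<le> V" by (simp add: V_def Vhat_nonneg)
  have m: "0 < m" by (simp add: m_def)
  have "2 * ln (1 / t) * V / (4 * (real S)\<^sup>2) = (A * V) * \<eta> powr 2"
    using \<eta> by (simp add: A_def field_simps)
  hence 1: "(2 * ln (1 / t) * V / (4 * (real S)\<^sup>2)) powr (real S / m) = (A * V) powr (real S / m) * \<eta> powr (2 * (real S / m))"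
    using \<eta> A_pos V by (simp only:) (simp only: powr_mult powr_powr mult_nonneg_nonneg less_imp_le powr_ge_zero)
  have 2: "bw_scale V ^ S = (A * V) powr (real S / m)"
    using S unfolding bw_scale_def m_def by (subst powr_power_pos) auto
  have 3: "g n ^ S = real n powr (- real S / m)"
    using S unfolding bandwidth_unit_def m_def by (subst powr_power_pos) auto
  have "1 / m + 2 * (real S / m) = 1" using m by (simp add: field_simps) (simp add: m_def)
  hence 4: "\<eta> powr (1 / m) * \<eta> powr (2 * (real S / m)) = \<eta>"
    using \<eta> by (simp flip: powr_add)
  have "radius S \<eta> K n t X = m * (1 + ln (real n) powr (-3)) * (\<eta> powr (1 / m) * \<eta> powr (2 * (real S / m)))
      * ((A * V) powr (real S / m) * real n powr (- real S / m))"
    unfolding radius_def V_def[symmetric] m_def[symmetric] 1 by (simp only: mult_ac)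
  thus ?thesis unfolding 4 2[symmetric] 3[symmetric] by (simp add: m_def V_def power_mult_distrib mult_ac)
qed

lemma radius_ge: "(2 * real S + 1) * \<eta> * (g n * bw_scale (Vhat S K n X)) ^ S \<le> radius S \<eta> K n t X"
proof -
  have "0 \<le> (2 * real S + 1) * (\<eta> * (g n * bw_scale (Vhat S K n X)) ^ S)"
    using \<eta> by (simp add: bw_scale_nonneg bandwidth_unit_def)
  moreover have "0 \<le> ln (real n) powr (-3)" by simp
  ultimately have "0 \<le> ln (real n) powr (-3) * ((2 * real S + 1) * (\<eta> * (g n * bw_scale (Vhat S K n X)) ^ S))"
    by simp
  thus ?thesis unfolding radius_eq by (simp add: algebra_simps)
qed

end

section \<open>Bandwidth selection\<close>

definition nearest :: "real set \<Rightarrow> real \<Rightarrow> real" where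
  "nearest H y = Min {h \<in> H. \<forall>h'\<in>H. \<bar>h - y\<bar> \<le> \<bar>h' - y\<bar>}"

lemma nearest_minimal:
  assumes "finite H" "H \<noteq> {}"
  shows "nearest H y \<in> H" "h \<in> H \<Longrightarrow> \<bar>nearest H y - y\<bar> \<le> \<bar>h - y\<bar>"
proof -
  let ?T = "{h \<in> H. \<forall>h'\<in>H. \<bar>h - y\<bar> \<le> \<bar>h' - y\<bar>}"
  obtain h\<^sub>0 where "is_arg_min (\<lambda>h. \<bar>h - y\<bar>) (\<lambda>h. h \<in> H) h\<^sub>0"
    using ex_is_arg_min_if_finite[OF assms] by blast
  hence "h\<^sub>0 \<in> ?T" by (auto simp: is_arg_min_linorder)
  hence "nearest H y \<in> ?T"
    unfolding nearest_def using assms by (intro Min_in) auto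
  thus "nearest H y \<in> H" "h \<in> H \<Longrightarrow> \<bar>nearest H y - y\<bar> \<le> \<bar>h - y\<bar>" by auto
qed

text \<open>This first-order description of the smallest minimizer makes the level sets of the selected
bandwidth visibly measurable.\<close>

lemma nearest_eq_iff:
  assumes "finite H" "H \<noteq> {}"
  shows "nearest H y = h \<longleftrightarrow> h \<in> H \<and> (\<forall>h'\<in>H. \<bar>h - y\<bar> \<le> \<bar>h' - y\<bar>) \<and>
    (\<forall>k\<in>H. (\<forall>h'\<in>H. \<bar>k - y\<bar> \<le> \<bar>h' - y\<bar>) \<longrightarrow> h \<le> k)" (is "_ \<longleftrightarrow> ?R")
proof
  let ?T = "{h \<in> H. \<forall>h'\<in>H. \<bar>h - y\<bar> \<le> \<bar>h' - y\<bar>}"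
  have fin: "finite ?T" using assms by simp
  assume eq: "nearest H y = h"
  have "\<forall>k\<in>?T. h \<le> k" unfolding eq[symmetric] nearest_def using fin by simp
  with nearest_minimal[OF assms, where y = y] eq show ?R by auto
next
  assume ?R
  thus "nearest H y = h" unfolding nearest_def using assms by (intro Min_eqI) auto
qed

context density_estimation
begin

lemma finite_bandwidths: "finite (bandwidths S n)"
  by (simp add: bandwidths_def)

lemma hhat_measurable [measurable]: "hhat S \<eta> K n t \<in> borel_measurable (sample n f)"
  unfolding hhat_def by measurable

lemma radius_measurable [measurable]: "radius S \<eta> K n t \<in> borel_measurable (sample n f)"
  unfolding radius_def by measurable

lemma htilde_eq_nearest: "htilde S \<eta> K n t X = nearest (bandwidths S n) (hhat S \<eta> K n t X)"
  by (simp add: htilde_def nearest_def)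

text \<open>The selected bandwidth takes finitely many values, so the estimator is a finite sum of measurable
functions restricted to the events on which each value is taken.\<close>

lemma fstar_measurable:
  assumes ne: "bandwidths S n \<noteq> {}"
  shows "fstar S \<eta> K n t \<in> borel_measurable (sample n f)"
proof -
  define H where "H = bandwidths S n"
  define Y where "Y = hhat S \<eta> K n t"
  have H: "finite H" "H \<noteq> {}" using ne finite_bandwidths by (auto simp: H_def)
  have [measurable]: "Y \<in> borel_measurable (sample n f)" unfolding Y_def by measurable
  have ev: "{X \<in> space (sample n f). nearest H (Y X) = h} \<in> sets (sample n f)" for h
  proof -
    have le: "{X \<in> space (sample n f). \<forall>h'\<in>H. \<bar>k - Y X\<bar> \<le> \<bar>h' - Y X\<bar>} \<in> sets (sample n f)" for k
      by (rule sets.sets_Collect_finite_All'[OF _ H]) measurable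
    have "{X \<in> space (sample n f). \<forall>k\<in>H. (\<forall>h'\<in>H. \<bar>k - Y X\<bar> \<le> \<bar>h' - Y X\<bar>) \<longrightarrow> h \<le> k} \<in> sets (sample n f)"
      by (rule sets.sets_Collect_finite_All'[OF _ H], rule sets.sets_Collect_imp[OF _ le]) simp
    thus ?thesis
      unfolding nearest_eq_iff[OF H] by (intro sets.sets_Collect_conj le sets.sets_Collect_const)
  qed
  have "fstar S \<eta> K n t X
      = (\<Sum>h\<in>H. fhat K n h X * indicator {X \<in> space (sample n f). nearest H (Y X) = h} X)"
    if "X \<in> space (sample n f)" for X
  proof -
    have "(\<Sum>h\<in>H. fhat K n h X * indicator {X \<in> space (sample n f). nearest H (Y X) = h} X)
        = (\<Sum>h\<in>H. if h = nearest H (Y X) then fhat K n h X else 0)"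
      using that by (intro sum.cong) auto
    also have "\<dots> = fhat K n (nearest H (Y X)) X"
      using H nearest_minimal(1)[OF H] by simp
    finally show ?thesis by (simp add: fstar_def htilde_eq_nearest H_def Y_def)
  qed
  moreover have "(\<lambda>X. \<Sum>h\<in>H. fhat K n h X * indicator {X \<in> space (sample n f). nearest H (Y X) = h} X)
      \<in> borel_measurable (sample n f)"
    using ev by (intro borel_measurable_sum borel_measurable_times fhat_measurable borel_measurable_indicator)
  ultimately show ?thesis by (subst measurable_cong)
qed

definition spacing :: "nat \<Rightarrow> real" where "spacing n = g n / ln (real n) ^ 4"

lemma bandwidths_eq: "bandwidths S n = (\<lambda>j. real j * spacing n) ` {1..nat \<lfloor>ln (real n) ^ 5\<rfloor>}"
  by (simp add: bandwidths_def spacing_def)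

lemma spacing_pos: "2 \<le> n \<Longrightarrow> 0 < spacing n"
  using g_pos by (simp add: spacing_def)

text \<open>Rounding down to a multiple of the spacing stays in the grid under the bounds on \<open>y\<close> and moves
\<open>y\<close> by at most one spacing; the nearest grid point is at least as close.\<close>

lemma nearest_bandwidth:
  assumes n: "2 \<le> n" and y: "1 \<le> y / spacing n" "y / spacing n \<le> ln (real n) ^ 5 - 1"
  obtains j :: nat where "nearest (bandwidths S n) y = j * spacing n" "\<bar>j * spacing n - y\<bar> \<le> spacing n"
    "bandwidths S n \<noteq> {}"
proof -
  have s: "0 < spacing n" by (rule spacing_pos[OF n])
  define k where "k = nat \<lfloor>y / spacing n\<rfloor>"
  have k: "real k = of_int \<lfloor>y / spacing n\<rfloor>" using y(1) by (simp add: k_def)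
  have "real k \<le> ln (real n) ^ 5 - 1" using y(2) of_int_floor_le[of "y / spacing n"] unfolding k by linarith
  hence "k \<le> nat \<lfloor>ln (real n) ^ 5\<rfloor>" by (intro le_nat_floor) simp
  moreover have "1 \<le> k" using y(1) by (simp add: k_def le_nat_iff)
  ultimately have mem: "k * spacing n \<in> bandwidths S n" unfolding bandwidths_eq by auto
  hence ne: "bandwidths S n \<noteq> {}" by auto
  note near = nearest_minimal[OF finite_bandwidths ne]
  from near(1)[where y = y] obtain j :: nat where j: "nearest (bandwidths S n) y = j * spacing n"
    unfolding bandwidths_eq by auto
  have "\<bar>k - y / spacing n\<bar> \<le> 1" unfolding k by linarith
  hence "\<bar>k - y / spacing n\<bar> * spacing n \<le> 1 * spacing n" using s by (intro mult_right_mono) auto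
  moreover have "k * spacing n - y = (k - y / spacing n) * spacing n"
    using s by (simp add: left_diff_distrib)
  hence "\<bar>k - y / spacing n\<bar> * spacing n = \<bar>k * spacing n - y\<bar>"
    using s by (simp only: abs_mult abs_of_pos)
  ultimately have "\<bar>k * spacing n - y\<bar> \<le> spacing n" by simp
  with near(2)[OF mem, where y = y] j ne show ?thesis by (intro that[of j]) auto
qed

end

context interval_level
begin

text \<open>The unrounded bandwidth with the proxy replaced by its mean.\<close>

definition h0 :: "nat \<times> (real \<Rightarrow> real) \<Rightarrow> real" where "h0 z = g (fst z) * bw_scale (proxy_mean z)"

lemma bw_scale_proxy_bounds: "\<forall>\<^sub>F z in class_limit. bw_scale proxy_lo \<le> bw_scale (proxy_mean z) \<and> bw_scale (proxy_mean z) \<le> bw_scale proxy_hi"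
  using proxy_mean_bounds by eventually_elim (use proxy_lo_pos in \<open>auto intro!: bw_scale_mono\<close>)

lemma bw_scale_proxy_lo_pos: "0 < bw_scale proxy_lo"
  by (rule bw_scale_pos[OF proxy_lo_pos])

lemma h0_pos: "\<forall>\<^sub>F z in class_limit. 0 < h0 z"
  using bw_scale_proxy_bounds class_limit_member
proof eventually_elim
  case (elim z)
  thus ?case unfolding h0_def using bw_scale_proxy_lo_pos g_pos[of "fst z"] by (intro mult_pos_pos) auto
qed

text \<open>This identity balances noise and bias: it expresses the variance \<open>proxy_mean / (n h0)\<close> through
\<open>h0^(2 S)\<close>.\<close>

lemma h0_power: "\<forall>\<^sub>F z in class_limit. fst z * h0 z * (h0 z ^ S)\<^sup>2 = A * proxy_mean z"
  using proxy_mean_bounds class_limit_member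
proof eventually_elim
  case (elim z)
  have "fst z * h0 z * (h0 z ^ S)\<^sup>2 = fst z * h0 z ^ (2 * S + 1)"
    by (simp add: power2_eq_square power_add mult_2)
  also have "\<dots> = (fst z * g (fst z) ^ (2 * S + 1)) * bw_scale (proxy_mean z) ^ (2 * S + 1)"
    unfolding h0_def power_mult_distrib by simp
  also have "\<dots> = A * proxy_mean z"
    using elim proxy_lo_pos by (subst bandwidth_unit_power, simp, subst bw_scale_power) auto
  finally show ?case .
qed

lemma h0_over_window: "((\<lambda>z. h0 z / \<psi> (fst z)) \<longlongrightarrow> 0) class_limit"
proof (rule Lim_null_comparison)
  show "\<forall>\<^sub>F z in class_limit. norm (h0 z / \<psi> (fst z)) \<le> bw_scale proxy_hi * (g (fst z) / \<psi> (fst z))"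
    using bw_scale_proxy_bounds class_limit_member
  proof eventually_elim
    case (elim z)
    have "0 \<le> g (fst z) / \<psi> (fst z)" using elim g_pos[of "fst z"] \<psi>_pos[of "fst z"] by auto
    hence "bw_scale (proxy_mean z) * (g (fst z) / \<psi> (fst z)) \<le> bw_scale proxy_hi * (g (fst z) / \<psi> (fst z))"
      using elim by (intro mult_right_mono) auto
    moreover have "h0 z / \<psi> (fst z) = bw_scale (proxy_mean z) * (g (fst z) / \<psi> (fst z))" by (simp add: h0_def)
    moreover have "0 \<le> bw_scale (proxy_mean z) * (g (fst z) / \<psi> (fst z))"
      by (intro mult_nonneg_nonneg bw_scale_nonneg) fact
    ultimately show ?case by (simp only: real_norm_def abs_of_nonneg)
  qed
  show "((\<lambda>z. bw_scale proxy_hi * (g (fst z) / \<psi> (fst z))) \<longlongrightarrow> 0) class_limit"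
    by (intro tendsto_mult_right_zero g_over_window)
qed

lemma tendsto_0_if_over_window:
  assumes "((\<lambda>z. h z / \<psi> (fst z)) \<longlongrightarrow> 0) class_limit"
  shows "(h \<longlongrightarrow> 0) class_limit"
proof -
  have "((\<lambda>z. h z / \<psi> (fst z) * \<psi> (fst z)) \<longlongrightarrow> 0 * 0) class_limit"
    by (intro tendsto_mult assms tendsto_class_limit window_tendsto_0)
  moreover have "\<forall>\<^sub>F z in class_limit. h z / \<psi> (fst z) * \<psi> (fst z) = h z"
    using class_limit_member
  proof eventually_elim
    case (elim z)
    thus ?case using \<psi>_pos[of "fst z"] by simp
  qed
  ultimately show ?thesis by (simp add: tendsto_cong)
qed

text \<open>The multiples of the spacing next to \<open>h0\<close>.  The index runs from \<open>-2\<close> to \<open>2\<close>, because replacing the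
proxy by its mean and rounding to the grid each move the bandwidth by at most one spacing.\<close>

definition gridpoint :: "int \<Rightarrow> nat \<times> (real \<Rightarrow> real) \<Rightarrow> real" where
  "gridpoint i z = of_int (\<lfloor>h0 z / spacing (fst z)\<rfloor> + i) * spacing (fst z)"

lemma gridpoint_ratio:
  assumes i: "i \<in> {-2..2}"
  shows "((\<lambda>z. gridpoint i z / h0 z) \<longlongrightarrow> 1) class_limit"
proof -
  have "((\<lambda>z. gridpoint i z / h0 z - 1) \<longlongrightarrow> 0) class_limit"
  proof (rule Lim_null_comparison)
    show "\<forall>\<^sub>F z in class_limit. norm (gridpoint i z / h0 z - 1) \<le> 3 / bw_scale proxy_lo * (1 / ln (real (fst z)) ^ 4)"
      using bw_scale_proxy_bounds class_limit_member h0_pos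
    proof eventually_elim
      case (elim z)
      define s where "s = spacing (fst z)"
      have s: "0 < s" using elim spacing_pos by (auto simp: s_def)
      have "\<bar>real_of_int i\<bar> \<le> 2" using i by auto
      hence "\<bar>of_int (\<lfloor>h0 z / s\<rfloor> + i) - h0 z / s\<bar> \<le> 3"
        unfolding of_int_add by linarith
      hence "\<bar>of_int (\<lfloor>h0 z / s\<rfloor> + i) - h0 z / s\<bar> * (s / h0 z) \<le> 3 * (s / h0 z)"
        using s elim by (intro mult_right_mono) auto
      moreover have "\<bar>of_int (\<lfloor>h0 z / s\<rfloor> + i) - h0 z / s\<bar> * (s / h0 z) = \<bar>gridpoint i z / h0 z - 1\<bar>"
      proof -
        have "0 \<le> s / h0 z" using s elim by simp
        hence "\<bar>of_int (\<lfloor>h0 z / s\<rfloor> + i) - h0 z / s\<bar> * (s / h0 z) = \<bar>(of_int (\<lfloor>h0 z / s\<rfloor> + i) - h0 z / s) * (s / h0 z)\<bar>"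
          by (simp only: abs_mult abs_of_nonneg)
        also have "(of_int (\<lfloor>h0 z / s\<rfloor> + i) - h0 z / s) * (s / h0 z) = gridpoint i z / h0 z - 1"
          using s elim unfolding gridpoint_def s_def[symmetric]
          by (simp add: left_diff_distrib diff_divide_distrib)
        finally show ?thesis .
      qed
      moreover have "3 * (s / h0 z) \<le> 3 / bw_scale proxy_lo * (1 / ln (real (fst z)) ^ 4)"
      proof -
        have "s / h0 z = (1 / ln (real (fst z)) ^ 4) / bw_scale (proxy_mean z)"
          using elim g_pos[of "fst z"] by (simp add: s_def spacing_def h0_def)
        also have "\<dots> \<le> (1 / ln (real (fst z)) ^ 4) / bw_scale proxy_lo"
          using elim bw_scale_proxy_lo_pos by (intro divide_left_mono mult_pos_pos) auto
        finally have "3 * (s / h0 z) \<le> 3 * (1 / ln (real (fst z)) ^ 4 / bw_scale proxy_lo)" by simp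
        thus ?thesis by (simp add: mult.commute)
      qed
      ultimately show ?case by simp
    qed
    show "((\<lambda>z. 3 / bw_scale proxy_lo * (1 / ln (real (fst z)) ^ 4)) \<longlongrightarrow> 0) class_limit"
      by (intro tendsto_mult_right_zero tendsto_class_limit inverse_ln_power) simp
  qed
  thus ?thesis by (simp add: LIM_zero_iff)
qed

lemma gridpoint_over_window:
  assumes i: "i \<in> {-2..2}"
  shows "((\<lambda>z. gridpoint i z / \<psi> (fst z)) \<longlongrightarrow> 0) class_limit"
proof -
  have "((\<lambda>z. gridpoint i z / h0 z * (h0 z / \<psi> (fst z))) \<longlongrightarrow> 1 * 0) class_limit"
    by (intro tendsto_mult gridpoint_ratio[OF i] h0_over_window)
  moreover have "\<forall>\<^sub>F z in class_limit. gridpoint i z / h0 z * (h0 z / \<psi> (fst z)) = gridpoint i z / \<psi> (fst z)"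
    using h0_pos by eventually_elim simp
  ultimately have "((\<lambda>z. gridpoint i z / \<psi> (fst z)) \<longlongrightarrow> 1 * 0) class_limit"
    by (rule Lim_transform_eventually)
  thus ?thesis by simp
qed

lemma gridpoint_near:
  assumes i: "i \<in> {-2..2}"
  shows "\<forall>\<^sub>F z in class_limit. 0 < gridpoint i z \<and> gridpoint i z \<le> \<psi> (fst z) \<and> gridpoint i z \<le> 2 * h0 z"
proof -
  have "\<forall>\<^sub>F z in class_limit. \<bar>gridpoint i z / h0 z - 1\<bar> < 1" "\<forall>\<^sub>F z in class_limit. gridpoint i z / \<psi> (fst z) < 1"
    using tendstoD[OF gridpoint_ratio[OF i], of 1] order_tendstoD(2)[OF gridpoint_over_window[OF i], of 1]
    by (simp_all add: dist_real_def)
  thus ?thesis using h0_pos class_limit_member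
  proof eventually_elim
    case (elim z)
    have "0 < gridpoint i z / h0 z" "gridpoint i z / h0 z < 2" using elim(1) by linarith+
    thus ?case using elim \<psi>_pos[of "fst z"] by (auto simp: field_simps)
  qed
qed

lemma h0_le_window: "\<forall>\<^sub>F z in class_limit. h0 z \<le> \<psi> (fst z)"
proof -
  have "\<forall>\<^sub>F z in class_limit. h0 z / \<psi> (fst z) < 1"
    using order_tendstoD(2)[OF h0_over_window, of 1] by simp
  thus ?thesis using class_limit_member
  proof eventually_elim
    case (elim z)
    thus ?case using \<psi>_pos[of "fst z"] by (auto simp: field_simps)
  qed
qed

end

section \<open>Exceptional events and coverage\<close>

context density_estimation
begin

abbreviation "\<P> z \<equiv> sample (fst z) (snd z)"

text \<open>The threshold is one logarithm smaller than the ratio of the grid spacing to \<open>g\<close>.  This leaves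
room for the Lipschitz constant of the map from the proxy to the bandwidth.\<close>

definition variance_event :: "nat \<times> (real \<Rightarrow> real) \<Rightarrow> (nat \<Rightarrow> real) set" where
  "variance_event z = {X \<in> space (\<P> z). 1 / ln (real (fst z)) ^ 5 \<le> \<bar>Vhat S K (fst z) X - proxy_mean z\<bar>}"

text \<open>As \<open>n g n\<close> is a positive power of \<open>n\<close>, Chebyshev's inequality tolerates any power of the
logarithm.\<close>

lemma variance_event_small:
  assumes "0 < \<epsilon>"
  shows "\<forall>\<^sub>F z in class_limit. measure (\<P> z) (variance_event z) \<le> \<epsilon>"
proof -
  define b where "b = 2 * real S / (2 * real S + 1)"
  have b: "0 < b" using S by (simp add: b_def)
  have "((\<lambda>z. 4 * B\<^sup>2 * proxy_hi * (ln (real (fst z)) ^ 10 / real (fst z) powr b)) \<longlongrightarrow> 0) class_limit"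
    by (intro tendsto_mult_right_zero tendsto_class_limit ln_power_over_powr b)
  from order_tendstoD(2)[OF this assms] show ?thesis
    using class_limit_member proxy_mean_bounds
  proof eventually_elim
    case (elim z)
    obtain n f where z: "z = (n, f)" by (cases z)
    have n: "2 \<le> n" using elim by (simp add: z)
    have ln: "0 < ln (real n)" using n by simp
    have ng: "n * g n = n powr b"
    proof -
      have "n * g n = n powr 1 * n powr (- 1 / (2 * real S + 1))" using n by (simp add: bandwidth_unit_def)
      also have "\<dots> = n powr (1 + - 1 / (2 * real S + 1))" by (rule powr_add[symmetric])
      also have "1 + - 1 / (2 * real S + 1) = b" by (simp add: b_def field_simps)
      finally show ?thesis .
    qed
    have "measure (sample n f) (variance_event z) \<le> 4 * B\<^sup>2 * proxy_mean (n, f) / (n * g n * (1 / ln (real n) ^ 5)\<^sup>2)"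
      unfolding variance_event_def z fst_conv snd_conv
      using elim n ln by (intro Vhat_concentration) (auto simp: z)
    also have "\<dots> = 4 * B\<^sup>2 * proxy_mean (n, f) * (ln (real n) ^ 10 / n powr b)"
      unfolding ng using ln by (simp add: power_divide flip: power_mult)
    also have "\<dots> \<le> 4 * B\<^sup>2 * proxy_hi * (ln (real n) ^ 10 / n powr b)"
      using elim ln by (intro mult_right_mono mult_left_mono) (auto simp: z)
    finally show ?case using elim by (simp add: z)
  qed
qed

lemma variance_event_measurable: "variance_event z \<in> sets (\<P> z)"
  unfolding variance_event_def by measurable

lemma Vhat_consistent:
  assumes f: "\<forall>\<^sub>F n in sequentially. even n \<longrightarrow> f \<in> \<D> n" and \<epsilon>: "0 < \<epsilon>"
  shows "(\<lambda>m. measure (sample (2 * m) f)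
    {X \<in> space (sample (2 * m) f). \<bar>Vhat S K (2 * m) X - f 0 * \<kappa>\<bar> > \<epsilon>}) \<longlonglongrightarrow> 0"
proof (rule tendstoI)
  fix e :: real assume e: "0 < e"
  have double: "filterlim (\<lambda>m::nat. 2 * m) at_top sequentially"
    by (rule filterlim_subseq) (simp add: strict_mono_def)
  have "\<forall>\<^sub>F z in class_limit. measure (\<P> z) (variance_event z) \<le> e / 2"
    using e by (intro variance_event_small) simp
  moreover have "\<forall>\<^sub>F z in class_limit. \<bar>proxy_mean z - snd z 0 * \<kappa>\<bar> < \<epsilon> / 2"
    using tendstoD[OF proxy_mean_tendsto, of "\<epsilon> / 2"] \<epsilon> by simp
  moreover have "\<forall>\<^sub>F z in class_limit. 1 / ln (real (fst z)) ^ 5 < \<epsilon> / 2"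
    using \<epsilon> by (intro class_limit_intro order_tendstoD(2)[OF inverse_ln_power]) auto
  ultimately have "\<forall>\<^sub>F z in class_limit. snd z \<in> \<D> (fst z) \<and>
      measure (\<P> z) {X \<in> space (\<P> z). \<bar>Vhat S K (fst z) X - snd z 0 * \<kappa>\<bar> > \<epsilon>} \<le> e / 2"
    using class_limit_member
  proof eventually_elim
    case (elim z)
    have "lebesgue_density (snd z)" using elim lebesgue_density by blast
    then interpret prob_space "\<P> z" by (rule prob_space_sample)
    have "prob {X \<in> space (\<P> z). \<bar>Vhat S K (fst z) X - snd z 0 * \<kappa>\<bar> > \<epsilon>} \<le> prob (variance_event z)"
    proof (rule finite_measure_mono[OF _ variance_event_measurable])
      show "{X \<in> space (\<P> z). \<bar>Vhat S K (fst z) X - snd z 0 * \<kappa>\<bar> > \<epsilon>} \<subseteq> variance_event z"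
      proof safe
        fix X assume "X \<in> space (\<P> z)" "\<epsilon> < \<bar>Vhat S K (fst z) X - snd z 0 * \<kappa>\<bar>"
        moreover from this(2) have "1 / ln (real (fst z)) ^ 5 \<le> \<bar>Vhat S K (fst z) X - proxy_mean z\<bar>"
          using elim(2,3) by linarith
        ultimately show "X \<in> variance_event z" by (simp add: variance_event_def)
      qed
    qed
    thus ?case using elim by simp
  qed
  hence "\<forall>\<^sub>F n in sequentially. even n \<longrightarrow> f \<in> \<D> n \<longrightarrow>
      measure (sample n f) {X \<in> space (sample n f). \<bar>Vhat S K n X - f 0 * \<kappa>\<bar> > \<epsilon>} \<le> e / 2"
    unfolding eventually_class_limit by (auto elim: eventually_mono)
  with f have "\<forall>\<^sub>F n in sequentially. even n \<longrightarrow>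
      measure (sample n f) {X \<in> space (sample n f). \<bar>Vhat S K n X - f 0 * \<kappa>\<bar> > \<epsilon>} \<le> e / 2"
    by eventually_elim blast
  from eventually_compose_filterlim[OF this double]
  show "\<forall>\<^sub>F m in sequentially. dist (measure (sample (2 * m) f)
      {X \<in> space (sample (2 * m) f). \<bar>Vhat S K (2 * m) X - f 0 * \<kappa>\<bar> > \<epsilon>}) 0 < e"
    by eventually_elim (use e in \<open>simp add: dist_real_def\<close>)
qed

end

context interval_level
begin

text \<open>The share of the radius set aside for each of the negligible errors.  It is small enough for the
exponent \<open>\<beta>\<close> below to exceed \<open>1\<close>.\<close>

definition \<delta> :: real where "\<delta> = 1 / (16 * real S)"

text \<open>The factor by which the deviation allowed at \<open>h0\<close> exceeds the sub-Gaussian deviation at level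
\<open>t\<close>, after the variance has been enlarged by \<open>(1 + \<delta>)\<^sup>2\<close>.\<close>

definition \<beta> :: real where "\<beta> = (1 - 3 * \<delta>) * (2 * real S + 1) / (2 * real S * (1 + \<delta>))"

lemma \<delta>_pos: "0 < \<delta>" using S by (simp add: \<delta>_def)

lemma \<delta>_le: "\<delta> \<le> 1 / 16" using S by (simp add: \<delta>_def field_simps)

lemma \<beta>_gt_1: "1 < \<beta>"
proof -
  have S0: "1 \<le> real S" using S by simp
  have "2 * real S * (1 + \<delta>) < (1 - 3 * \<delta>) * (2 * real S + 1)"
  proof -
    have "real S * \<delta> = 1 / 16" using S by (simp add: \<delta>_def)
    moreover have "\<delta> \<le> 1 / 16" by (rule \<delta>_le)
    ultimately show ?thesis by (simp add: algebra_simps)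
  qed
  moreover have "0 < 2 * real S * (1 + \<delta>)" using S0 \<delta>_pos by simp
  ultimately show ?thesis by (simp add: \<beta>_def)
qed

text \<open>The deviation allowed at \<open>h0\<close>: the radius at \<open>h0\<close> without the shares for the bias, for the
passage to a grid point and for the random radius.\<close>

definition \<tau> :: "nat \<times> (real \<Rightarrow> real) \<Rightarrow> real" where
  "\<tau> z = (1 - 3 * \<delta>) * (2 * real S + 1) * \<eta> * h0 z ^ S"

definition tail_event :: "real \<Rightarrow> nat \<times> (real \<Rightarrow> real) \<Rightarrow> (nat \<Rightarrow> real) set" where
  "tail_event \<sigma> z = {X \<in> space (\<P> z). \<tau> z \<le> \<sigma> * (fhat K (fst z) (h0 z) X - smoothed (snd z) (h0 z) K)}"

text \<open>The Gaussian choice \<open>\<theta> = \<tau> / D\<close>, where \<open>D\<close> slightly exceeds the variance factor, gives the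
exponent \<open>- n h0 \<tau>\<^sup>2 / (2 D)\<close>.  By \<open>h0_power\<close> this equals \<open>\<beta>\<^sup>2 ln t\<close>.  One factor \<open>1 + \<delta>\<close> of
\<open>D\<close> absorbs the difference between the second moment at scale \<open>h0\<close> and \<open>proxy_mean\<close>, the other
one the factor \<open>exp (2 \<theta> B)\<close>.\<close>

lemma tail_event_bound:
  assumes \<sigma>: "\<sigma> \<in> {1, -1}"
  shows "\<forall>\<^sub>F z in class_limit. measure (\<P> z) (tail_event \<sigma> z) \<le> t powr (\<beta>\<^sup>2)"
proof -
  define w where "w z = smoothed (snd z) (h0 z) (\<lambda>u. (K u)\<^sup>2)" for z
  define D where "D z = proxy_mean z * (1 + \<delta>)\<^sup>2" for z
  define \<theta> where "\<theta> z = \<tau> z / D z" for z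
  have "((\<lambda>z. w z - snd z 0 * \<kappa>) \<longlongrightarrow> 0) class_limit"
    unfolding w_def by (rule smoothed_square_tendsto[OF h0_over_window eventually_mono[OF h0_pos]]) simp
  from tendsto_diff[OF this proxy_mean_tendsto] have "((\<lambda>z. w z - proxy_mean z) \<longlongrightarrow> 0) class_limit" by simp
  moreover have "0 < \<delta> * proxy_lo" using \<delta>_pos proxy_lo_pos by simp
  ultimately have "\<forall>\<^sub>F z in class_limit. w z - proxy_mean z < \<delta> * proxy_lo"
    by (rule order_tendstoD(2))
  hence w_le: "\<forall>\<^sub>F z in class_limit. w z \<le> (1 + \<delta>) * proxy_mean z"
    using proxy_mean_bounds
  proof eventually_elim
    case (elim z)
    have "\<delta> * proxy_lo \<le> \<delta> * proxy_mean z" using elim \<delta>_pos by (intro mult_left_mono) auto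
    thus ?case using elim by (simp add: algebra_simps)
  qed
  have \<tau>0: "(\<tau> \<longlongrightarrow> 0) class_limit"
  proof -
    have "((\<lambda>z. h0 z ^ S) \<longlongrightarrow> 0 ^ S) class_limit"
      by (rule tendsto_power[OF tendsto_0_if_over_window[OF h0_over_window]])
    hence "((\<lambda>z. h0 z ^ S) \<longlongrightarrow> 0) class_limit" using S by (simp add: power_0_left)
    thus ?thesis unfolding \<tau>_def by (rule tendsto_mult_right_zero)
  qed
  have D_ge: "\<forall>\<^sub>F z in class_limit. proxy_lo \<le> D z"
    using proxy_mean_bounds
  proof eventually_elim
    case (elim z)
    have "proxy_mean z * 1 \<le> proxy_mean z * (1 + \<delta>)\<^sup>2"
      using elim proxy_lo_pos \<delta>_pos by (intro mult_left_mono one_le_power) auto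
    thus ?case using elim by (simp add: D_def)
  qed
  have \<tau>_nonneg: "\<forall>\<^sub>F z in class_limit. 0 \<le> \<tau> z"
    using h0_pos
  proof eventually_elim
    case (elim z)
    thus ?case unfolding \<tau>_def using \<eta> \<delta>_le by (intro mult_nonneg_nonneg) auto
  qed
  have "(\<theta> \<longlongrightarrow> 0) class_limit"
  proof (rule Lim_null_comparison)
    show "\<forall>\<^sub>F z in class_limit. norm (\<theta> z) \<le> 1 / proxy_lo * \<tau> z"
      using D_ge \<tau>_nonneg
    proof eventually_elim
      case (elim z)
      have "\<tau> z / D z \<le> \<tau> z / proxy_lo" using elim proxy_lo_pos by (intro divide_left_mono) auto
      thus ?case using elim proxy_lo_pos by (simp add: \<theta>_def)
    qed
    show "((\<lambda>z. 1 / proxy_lo * \<tau> z) \<longlongrightarrow> 0) class_limit" by (rule tendsto_mult_right_zero[OF \<tau>0])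
  qed
  hence "((\<lambda>z. exp (2 * \<theta> z * B)) \<longlongrightarrow> exp (2 * 0 * B)) class_limit"
    by (intro tendsto_intros)
  hence exp_le: "\<forall>\<^sub>F z in class_limit. exp (2 * \<theta> z * B) < 1 + \<delta>"
    by (rule order_tendstoD(2)) (simp add: \<delta>_pos)
  show ?thesis
    using w_le D_ge \<tau>_nonneg exp_le class_limit_member h0_pos h0_le_window h0_power proxy_mean_bounds
  proof eventually_elim
    case (elim z)
    define n f where "n = fst z" and "f = snd z"
    have proxy_mean: "0 < proxy_mean z" and D: "0 < D z" using elim proxy_lo_pos by auto
    have \<theta>: "0 \<le> \<theta> z" using elim D by (simp add: \<theta>_def)
    have w0: "0 \<le> w z"
      using lebesgue_density[of f n] elim by (simp add: w_def f_def n_def smoothed_def lebesgue_density_def)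
    have "measure (\<P> z) (tail_event \<sigma> z)
        \<le> exp (- \<theta> z * (n * h0 z * \<tau> z) + n * ((\<theta> z)\<^sup>2 * (h0 z * w z) / 2 * exp (2 * \<theta> z * B)))"
      unfolding tail_event_def w_def n_def
      using elim by (intro fhat_deviation \<sigma> \<theta>) auto
    also have "\<dots> \<le> exp (- (\<beta>\<^sup>2 * ln (1 / t)))"
    proof -
      define q where "q = n * h0 z * (\<tau> z)\<^sup>2 / D z"
      have "n * ((\<theta> z)\<^sup>2 * (h0 z * w z) / 2 * exp (2 * \<theta> z * B))
          \<le> n * ((\<theta> z)\<^sup>2 * (h0 z * ((1 + \<delta>) * proxy_mean z)) / 2 * (1 + \<delta>))"
        using elim w0 proxy_mean \<delta>_pos by (intro mult_left_mono mult_mono divide_right_mono) auto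
      also have "\<dots> = n * h0 z * (\<theta> z)\<^sup>2 * D z / 2"
        by (simp add: D_def power2_eq_square)
      also have "\<dots> = q / 2"
        using D by (simp add: q_def \<theta>_def power2_eq_square)
      finally have "n * ((\<theta> z)\<^sup>2 * (h0 z * w z) / 2 * exp (2 * \<theta> z * B)) \<le> q / 2" .
      moreover have "- \<theta> z * (n * h0 z * \<tau> z) = - q"
        by (simp add: q_def \<theta>_def power2_eq_square)
      ultimately have "- \<theta> z * (n * h0 z * \<tau> z) + n * ((\<theta> z)\<^sup>2 * (h0 z * w z) / 2 * exp (2 * \<theta> z * B)) \<le> - q / 2"
        by linarith
      moreover have "q / 2 = \<beta>\<^sup>2 * ln (1 / t)"
      proof -
        define b where "b = (1 - 3 * \<delta>) * (2 * real S + 1)"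
        have "n * h0 z * (\<tau> z)\<^sup>2 = b\<^sup>2 * \<eta>\<^sup>2 * (n * h0 z * (h0 z ^ S)\<^sup>2)"
          by (simp add: \<tau>_def b_def power_mult_distrib)
        also have "n * h0 z * (h0 z ^ S)\<^sup>2 = A * proxy_mean z" using elim by (simp add: n_def)
        finally have "q / 2 = b\<^sup>2 * (\<eta>\<^sup>2 * A) / (2 * (1 + \<delta>)\<^sup>2)"
          using proxy_mean by (simp add: q_def D_def)
        also have "\<eta>\<^sup>2 * A = 2 * ln (1 / t) / (4 * (real S)\<^sup>2)" using \<eta> by (simp add: A_def)
        finally have "q / 2 = b\<^sup>2 * (2 * ln (1 / t) / (4 * (real S)\<^sup>2)) / (2 * (1 + \<delta>)\<^sup>2)" .
        moreover have "\<beta> = b / (2 * real S * (1 + \<delta>))" by (simp add: \<beta>_def b_def)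
        ultimately show ?thesis by (simp add: power_divide power_mult_distrib mult.commute)
      qed
      ultimately show ?thesis by simp
    qed
    also have "\<dots> = t powr (\<beta>\<^sup>2)" using t by (simp add: powr_def ln_div)
    finally show ?case .
  qed
qed

definition transfer_event :: "int \<Rightarrow> nat \<times> (real \<Rightarrow> real) \<Rightarrow> (nat \<Rightarrow> real) set" where
  "transfer_event i z = {X \<in> space (\<P> z). \<delta> * \<eta> * h0 z ^ S
    \<le> \<bar>fhat K (fst z) (gridpoint i z) X - fhat K (fst z) (h0 z) X
        - (smoothed (snd z) (gridpoint i z) K - smoothed (snd z) (h0 z) K)\<bar>}"

text \<open>By \<open>h0_power\<close> the noise level \<open>1 / (n h0)\<close> is a bounded multiple of \<open>(h0 ^ S)\<^sup>2\<close>, so the bound of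
\<open>fhat_difference_deviation\<close> is a constant times the dilation error.\<close>

lemma transfer_event_small:
  assumes i: "i \<in> {-2..2}" and \<epsilon>: "0 < \<epsilon>"
  shows "\<forall>\<^sub>F z in class_limit. measure (\<P> z) (transfer_event i z) \<le> \<epsilon>"
proof -
  define \<omega> where "\<omega> z = dilation_error (h0 z / gridpoint i z)" for z
  have "((\<lambda>z. inverse (gridpoint i z / h0 z)) \<longlongrightarrow> inverse 1) class_limit"
    by (intro tendsto_inverse gridpoint_ratio[OF i]) simp
  hence "(\<omega> \<longlongrightarrow> 0) class_limit"
    unfolding \<omega>_def by (intro dilation_error_tendsto) simp
  hence "((\<lambda>z. C / ((\<delta> * \<eta>)\<^sup>2 * (A * proxy_lo)) * \<omega> z) \<longlongrightarrow> 0) class_limit"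
    by (rule tendsto_mult_right_zero)
  from order_tendstoD(2)[OF this \<epsilon>] show ?thesis
    using class_limit_member proxy_mean_bounds h0_pos h0_le_window gridpoint_near[OF i] h0_power density_0_bounds
  proof eventually_elim
    case (elim z)
    define n f where "n = fst z" and "f = snd z"
    have a: "0 < \<delta> * \<eta> * h0 z ^ S" using \<delta>_pos \<eta> elim by simp
    have C: "0 \<le> C * \<omega> z" using elim c by (auto simp: \<omega>_def dilation_error_def)
    have "measure (\<P> z) (transfer_event i z) \<le> C * \<omega> z / (n * h0 z * (\<delta> * \<eta> * h0 z ^ S)\<^sup>2)"
      unfolding transfer_event_def n_def \<omega>_def using elim a by (intro fhat_difference_deviation) auto
    also have "n * h0 z * (\<delta> * \<eta> * h0 z ^ S)\<^sup>2 = (\<delta> * \<eta>)\<^sup>2 * (n * h0 z * (h0 z ^ S)\<^sup>2)"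
      by (simp add: power_mult_distrib)
    also have "n * h0 z * (h0 z ^ S)\<^sup>2 = A * proxy_mean z" using elim by (simp add: n_def)
    also have "C * \<omega> z / ((\<delta> * \<eta>)\<^sup>2 * (A * proxy_mean z)) \<le> C * \<omega> z / ((\<delta> * \<eta>)\<^sup>2 * (A * proxy_lo))"
      using C elim A_pos proxy_lo_pos \<delta>_pos \<eta> by (intro divide_left_mono mult_left_mono mult_pos_pos) auto
    finally show ?case using elim by simp
  qed
qed

lemma gridpoint_bias:
  assumes i: "i \<in> {-2..2}"
  shows "\<forall>\<^sub>F z in class_limit. \<bar>smoothed (snd z) (gridpoint i z) K - snd z 0\<bar> \<le> \<delta> * \<eta> * h0 z ^ S"
proof -
  have "((\<lambda>z. r (gridpoint i z)) \<longlongrightarrow> 0) class_limit"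
    by (rule modulus_tendsto_0[OF tendsto_0_if_over_window[OF gridpoint_over_window[OF i]]
          eventually_mono[OF gridpoint_near[OF i]]]) simp
  hence "((\<lambda>z. 2 * M * B * 2 ^ S * r (gridpoint i z)) \<longlongrightarrow> 0) class_limit"
    by (rule tendsto_mult_right_zero)
  moreover have "0 < \<delta> * \<eta>" using \<delta>_pos \<eta> by simp
  ultimately have "\<forall>\<^sub>F z in class_limit. 2 * M * B * 2 ^ S * r (gridpoint i z) < \<delta> * \<eta>"
    by (rule order_tendstoD(2))
  thus ?thesis using class_limit_member gridpoint_near[OF i] h0_pos
  proof eventually_elim
    case (elim z)
    have "\<bar>smoothed (snd z) (gridpoint i z) K - snd z 0\<bar>
        \<le> 2 * (M * r (gridpoint i z) * gridpoint i z ^ S * B)"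
      using elim by (intro smoothed_bias) auto
    also have "\<dots> \<le> 2 * (M * r (gridpoint i z) * (2 * h0 z) ^ S * B)"
      using elim M B_nonneg r_nonneg by (intro mult_left_mono mult_right_mono power_mono) auto
    also have "\<dots> = 2 * M * B * 2 ^ S * r (gridpoint i z) * h0 z ^ S"
      by (simp add: power_mult_distrib)
    also have "\<dots> \<le> \<delta> * \<eta> * h0 z ^ S" using elim by (intro mult_right_mono) auto
    finally show ?case .
  qed
qed

lemma ln_large:
  "\<forall>\<^sub>F z in class_limit. x \<le> ln (real (fst z))"
  by (rule class_limit_intro) (use ln_n_at_top in \<open>simp add: filterlim_at_top\<close>)

text \<open>The first bound says that the unrounded bandwidth lies within one grid spacing of \<open>h0\<close>.  The
second is the form in which the radius is compared with its value at \<open>h0\<close>.\<close>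

lemma bw_scale_Vhat_near:
  "\<forall>\<^sub>F z in class_limit. \<forall>X\<in>space (\<P> z) - variance_event z.
    \<bar>bw_scale (Vhat S K (fst z) X) - bw_scale (proxy_mean z)\<bar> \<le> 1 / ln (real (fst z)) ^ 4 \<and>
    (1 - \<delta> / S) * bw_scale (proxy_mean z) \<le> bw_scale (Vhat S K (fst z) X)"
proof -
  define q where "q = A / bw_scale proxy_lo ^ (2 * S)"
  have q: "0 < q" using A_pos bw_scale_proxy_lo_pos by (simp add: q_def)
  have "((\<lambda>z. q * (1 / ln (real (fst z)) ^ 5)) \<longlongrightarrow> 0) class_limit"
    by (intro tendsto_mult_right_zero tendsto_class_limit inverse_ln_power) simp
  moreover have "0 < \<delta> / S * bw_scale proxy_lo" using \<delta>_pos S bw_scale_proxy_lo_pos by simp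
  ultimately have "\<forall>\<^sub>F z in class_limit. q * (1 / ln (real (fst z)) ^ 5) < \<delta> / S * bw_scale proxy_lo"
    by (rule order_tendstoD(2))
  thus ?thesis using ln_large[of q] bw_scale_proxy_bounds proxy_mean_bounds class_limit_member
  proof eventually_elim
    case (elim z)
    define l where "l = ln (real (fst z))"
    have l: "0 < l" "q \<le> l" using elim q by (auto simp: l_def)
    show ?case
    proof (rule ballI)
      fix X assume X: "X \<in> space (\<P> z) - variance_event z"
      define V where "V = Vhat S K (fst z) X"
      have "\<bar>V - proxy_mean z\<bar> < 1 / l ^ 5" using X by (auto simp: variance_event_def V_def l_def)
      have "\<bar>bw_scale V - bw_scale (proxy_mean z)\<bar> \<le> A * \<bar>V - proxy_mean z\<bar> / bw_scale (proxy_mean z) ^ (2 * S)"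
        using elim proxy_lo_pos by (intro bw_scale_diff) (auto simp: V_def Vhat_nonneg)
      also have "\<dots> \<le> A * (1 / l ^ 5) / bw_scale proxy_lo ^ (2 * S)"
        using elim A_pos bw_scale_proxy_lo_pos l \<open>\<bar>V - proxy_mean z\<bar> < 1 / l ^ 5\<close>
        by (intro frac_le mult_left_mono power_mono mult_nonneg_nonneg) auto
      also have "\<dots> = q * (1 / l ^ 5)" by (simp add: q_def)
      finally have diff: "\<bar>bw_scale V - bw_scale (proxy_mean z)\<bar> \<le> q * (1 / l ^ 5)" .
      have "q * (1 / l ^ 5) \<le> l * (1 / l ^ 5)" using l by (intro mult_right_mono) auto
      also have "\<dots> = 1 / l ^ 4" using l by (simp add: power_numeral_reduce)
      finally have 1: "\<bar>bw_scale V - bw_scale (proxy_mean z)\<bar> \<le> 1 / l ^ 4" using diff by linarith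
      have "\<delta> / S * bw_scale proxy_lo \<le> \<delta> / S * bw_scale (proxy_mean z)" using elim \<delta>_pos by (intro mult_left_mono) auto
      hence "bw_scale (proxy_mean z) - \<delta> / S * bw_scale (proxy_mean z) \<le> bw_scale V" using diff elim(1) unfolding l_def[symmetric] by linarith
      hence "(1 - \<delta> / S) * bw_scale (proxy_mean z) \<le> bw_scale V" by (simp add: left_diff_distrib)
      with 1 show "\<bar>bw_scale (Vhat S K (fst z) X) - bw_scale (proxy_mean z)\<bar> \<le> 1 / ln (real (fst z)) ^ 4 \<and>
          (1 - \<delta> / S) * bw_scale (proxy_mean z) \<le> bw_scale (Vhat S K (fst z) X)"
        by (simp add: V_def l_def)
    qed
  qed
qed

text \<open>The grid reaches from \<open>g / ln^4 n\<close> to about \<open>g ln n\<close> and thus contains bounded multiples of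
\<open>g\<close> well inside, where rounding costs at most one spacing.\<close>

lemma htilde_is_gridpoint:
  "\<forall>\<^sub>F z in class_limit. bandwidths S (fst z) \<noteq> {} \<and> (\<forall>X\<in>space (\<P> z) - variance_event z.
    \<exists>i\<in>{-2..2}. htilde S \<eta> K (fst z) t X = gridpoint i z)"
  using bw_scale_Vhat_near bw_scale_proxy_bounds class_limit_member ln_large[of "max 2 (max (2 / bw_scale proxy_lo) (bw_scale proxy_hi + 2))"]
proof eventually_elim
  case (elim z)
  define n where "n = fst z"
  define l where "l = ln (real n)"
  define s where "s = spacing n"
  have n: "2 \<le> n" using elim by (simp add: n_def)
  have s: "0 < s" using spacing_pos[OF n] by (simp add: s_def)
  have l: "2 \<le> l" "2 / bw_scale proxy_lo \<le> l" "bw_scale proxy_hi + 2 \<le> l" using elim by (auto simp: l_def n_def)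
  have l4: "1 \<le> l ^ 4" "l \<le> l ^ 4"
    using l power_increasing[of 0 4 l] power_increasing[of 1 4 l] by auto
  have range: "1 \<le> x * l ^ 4" "x * l ^ 4 \<le> l ^ 5 - 1" if "\<bar>x - bw_scale (proxy_mean z)\<bar> \<le> 1 / l ^ 4" for x
  proof -
    have "\<bar>x - bw_scale (proxy_mean z)\<bar> * l ^ 4 \<le> 1" using that l by (simp add: field_simps)
    hence x: "\<bar>x * l ^ 4 - bw_scale (proxy_mean z) * l ^ 4\<bar> \<le> 1"
      using l4 by (simp flip: left_diff_distrib add: abs_mult)
    have "2 \<le> bw_scale proxy_lo * l" using l bw_scale_proxy_lo_pos by (simp add: field_simps)
    also have "\<dots> \<le> bw_scale (proxy_mean z) * l ^ 4" using elim l4 l bw_scale_nonneg by (intro mult_mono) auto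
    finally show "1 \<le> x * l ^ 4" using x by linarith
    have "bw_scale (proxy_mean z) * l ^ 4 \<le> (l - 2) * l ^ 4" using elim l l4 by (intro mult_right_mono) auto
    also have "\<dots> = l ^ 5 - 2 * l ^ 4" by (simp add: algebra_simps power_numeral_reduce)
    finally show "x * l ^ 4 \<le> l ^ 5 - 1" using x l4 by linarith
  qed
  have over: "(g n * x) / s = x * l ^ 4" for x
    using g_pos[OF n] l by (simp add: s_def spacing_def l_def)
  have ne: "bandwidths S n \<noteq> {}"
  proof -
    have "1 \<le> g n * bw_scale (proxy_mean z) / spacing n" "g n * bw_scale (proxy_mean z) / spacing n \<le> ln (real n) ^ 5 - 1"
      unfolding s_def[symmetric] over using range[of "bw_scale (proxy_mean z)"] l by (auto simp: l_def)
    from nearest_bandwidth[OF n this] show ?thesis by blast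
  qed
  moreover have "\<exists>i\<in>{-2..2}. htilde S \<eta> K n t X = gridpoint i z" if X: "X \<in> space (\<P> z) - variance_event z" for X
  proof -
    define V where "V = Vhat S K n X"
    define y where "y = g n * bw_scale V"
    have near: "\<bar>bw_scale V - bw_scale (proxy_mean z)\<bar> \<le> 1 / l ^ 4"
      using elim X by (auto simp: V_def n_def l_def)
    have y: "1 \<le> y / spacing n" "y / spacing n \<le> ln (real n) ^ 5 - 1"
      unfolding y_def s_def[symmetric] over l_def[symmetric] using range[OF near] by auto
    obtain j :: nat where j: "nearest (bandwidths S n) y = j * spacing n" "\<bar>j * spacing n - y\<bar> \<le> spacing n"
      by (rule nearest_bandwidth[OF n y])
    have "\<bar>y - h0 z\<bar> = g n * \<bar>bw_scale V - bw_scale (proxy_mean z)\<bar>"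
      using g_pos[OF n] by (simp add: y_def h0_def n_def abs_mult flip: right_diff_distrib)
    also have "\<dots> \<le> g n * (1 / l ^ 4)" using near g_pos[OF n] by (intro mult_left_mono) auto
    also have "\<dots> = s" by (simp add: s_def spacing_def l_def)
    finally have "\<bar>j * s - h0 z\<bar> \<le> 2 * s" using j(2) by (simp add: s_def)
    moreover have "j * s - h0 z = (j - h0 z / s) * s" using s by (simp add: left_diff_distrib)
    ultimately have "\<bar>j - h0 z / s\<bar> \<le> 2" using s by (simp add: abs_mult)
    hence "int j - \<lfloor>h0 z / s\<rfloor> \<in> {-2..2}" by (auto simp: abs_le_iff) linarith+
    moreover have "gridpoint (int j - \<lfloor>h0 z / s\<rfloor>) z = j * s"
      by (simp add: gridpoint_def s_def n_def)
    ultimately show ?thesis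
      using j(1) by (intro bexI[of _ "int j - \<lfloor>h0 z / s\<rfloor>"]) (simp_all add: htilde_eq_nearest hhat_eq y_def V_def s_def)
  qed
  ultimately show ?case by (simp add: n_def)
qed

definition exceptional :: "nat \<times> (real \<Rightarrow> real) \<Rightarrow> (nat \<Rightarrow> real) set" where
  "exceptional z = variance_event z \<union> (\<Union>i\<in>{-2..2}. transfer_event i z)"

text \<open>The error at the selected grid point is split into its bias, the change of the centred estimator
on the way from \<open>h0\<close>, and the centred estimator at \<open>h0\<close>.  The three bounds add up to less than the
lower bound \<open>(2 S + 1) \<eta> (1 - \<delta>) h0^S\<close> for the radius.\<close>

lemma fstar_error_off_exceptional:
  assumes \<sigma>: "\<sigma> \<in> {1, -1}"
  shows "\<forall>\<^sub>F z in class_limit. \<forall>X\<in>space (\<P> z) - exceptional z - tail_event \<sigma> z.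
    \<sigma> * (fstar S \<eta> K (fst z) t X - snd z 0) \<le> radius S \<eta> K (fst z) t X"
proof -
  have "\<forall>\<^sub>F z in class_limit. \<forall>i\<in>{-2..2}. \<bar>smoothed (snd z) (gridpoint i z) K - snd z 0\<bar> \<le> \<delta> * \<eta> * h0 z ^ S"
    by (intro eventually_ball_finite ballI gridpoint_bias) auto
  thus ?thesis using htilde_is_gridpoint bw_scale_Vhat_near h0_pos class_limit_member
  proof eventually_elim
    case (elim z)
    define n f where "n = fst z" and "f = snd z"
    define e where "e = \<delta> * \<eta> * h0 z ^ S"
    show ?case
    proof (rule ballI)
      fix X assume X: "X \<in> space (\<P> z) - exceptional z - tail_event \<sigma> z"
      hence XV: "X \<in> space (\<P> z) - variance_event z" by (auto simp: exceptional_def)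
      then obtain i where i: "i \<in> {-2..2}" and htilde: "htilde S \<eta> K n t X = gridpoint i z"
        using elim unfolding n_def by blast
      define m where "m h = smoothed f h K" for h
      have bias: "\<bar>m (gridpoint i z) - f 0\<bar> \<le> e" using elim(1) i by (simp add: m_def f_def e_def)
      have transfer: "\<bar>fhat K n (gridpoint i z) X - fhat K n (h0 z) X - (m (gridpoint i z) - m (h0 z))\<bar> < e"
      proof -
        have "X \<notin> transfer_event i z" using X i by (auto simp: exceptional_def)
        thus ?thesis using X by (auto simp: transfer_event_def m_def f_def n_def e_def)
      qed
      have tail: "\<sigma> * (fhat K n (h0 z) X - m (h0 z)) < \<tau> z"
        using X by (auto simp: tail_event_def m_def f_def n_def)
      have abs: "\<sigma> * x \<le> \<bar>x\<bar>" for x using \<sigma> by auto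
      have "\<sigma> * (fstar S \<eta> K n t X - f 0) = \<sigma> * (m (gridpoint i z) - f 0)
          + \<sigma> * (fhat K n (gridpoint i z) X - fhat K n (h0 z) X - (m (gridpoint i z) - m (h0 z)))
          + \<sigma> * (fhat K n (h0 z) X - m (h0 z))"
        by (simp add: fstar_def htilde algebra_simps)
      also have "\<dots> \<le> e + e + \<tau> z"
        using bias transfer tail abs[of "m (gridpoint i z) - f 0"]
          abs[of "fhat K n (gridpoint i z) X - fhat K n (h0 z) X - (m (gridpoint i z) - m (h0 z))"] by linarith
      also have "\<dots> \<le> (2 * real S + 1) * \<eta> * ((1 - \<delta>) * h0 z ^ S)"
      proof -
        have "0 \<le> \<delta> * (\<eta> * h0 z ^ S) * real S" using \<delta>_pos \<eta> elim by simp
        thus ?thesis by (simp add: e_def \<tau>_def algebra_simps)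
      qed
      also have "\<dots> \<le> (2 * real S + 1) * \<eta> * (g n * bw_scale (Vhat S K n X)) ^ S"
      proof -
        have \<delta>S: "0 \<le> \<delta> / S" "\<delta> / S \<le> 1"
          using \<delta>_pos \<delta>_le S by (auto simp: field_simps)
        \<comment> \<open>The loss in the bandwidth is \<open>\<delta> / S\<close>, so that the loss in its \<open>S\<close>-th power is at most \<open>\<delta>\<close>.\<close>
        have "1 + real S * (- (\<delta> / S)) \<le> (1 + - (\<delta> / S)) ^ S"
          using \<delta>S by (intro Bernoulli_inequality) auto
        hence "(1 - \<delta>) * h0 z ^ S \<le> (1 - \<delta> / S) ^ S * h0 z ^ S"
          using S elim by (intro mult_right_mono) auto
        also have "\<dots> = (g n * ((1 - \<delta> / S) * bw_scale (proxy_mean z))) ^ S"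
          by (simp add: h0_def n_def power_mult_distrib)
        also have "\<dots> \<le> (g n * bw_scale (Vhat S K n X)) ^ S"
          using elim XV \<delta>S g_pos[of n] bw_scale_nonneg by (intro power_mono mult_left_mono mult_nonneg_nonneg) (auto simp: n_def)
        finally show ?thesis using \<eta> by (intro mult_left_mono) auto
      qed
      also have "\<dots> \<le> radius S \<eta> K n t X" by (rule radius_ge)
      finally show "\<sigma> * (fstar S \<eta> K (fst z) t X - snd z 0) \<le> radius S \<eta> K (fst z) t X"
        by (simp add: n_def f_def)
    qed
  qed
qed

lemma events_measurable:
  shows tail_event_measurable: "tail_event \<sigma> z \<in> sets (\<P> z)"
    and transfer_event_measurable: "transfer_event i z \<in> sets (\<P> z)"
    and exceptional_measurable: "exceptional z \<in> sets (\<P> z)"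
proof -
  show "tail_event \<sigma> z \<in> sets (\<P> z)" unfolding tail_event_def by measurable
  have **: "transfer_event i z \<in> sets (\<P> z)" for i unfolding transfer_event_def by measurable
  show "transfer_event i z \<in> sets (\<P> z)" by (rule **)
  show "exceptional z \<in> sets (\<P> z)"
    unfolding exceptional_def by (intro sets.Un sets.finite_UN variance_event_measurable **) simp
qed

lemma exceptional_small:
  assumes "0 < \<epsilon>"
  shows "\<forall>\<^sub>F z in class_limit. measure (\<P> z) (exceptional z) \<le> \<epsilon>"
proof -
  have \<epsilon>: "0 < \<epsilon> / 6" using assms by simp
  have "\<forall>\<^sub>F z in class_limit. \<forall>i\<in>{-2..2}. measure (\<P> z) (transfer_event i z) \<le> \<epsilon> / 6"
    by (rule eventually_ball_finite) (use transfer_event_small[OF _ \<epsilon>] in auto)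
  thus ?thesis using variance_event_small[OF \<epsilon>] class_limit_member
  proof eventually_elim
    case (elim z)
    have "lebesgue_density (snd z)" using elim lebesgue_density by blast
    then interpret prob_space "\<P> z" by (rule prob_space_sample)
    have "prob (exceptional z) \<le> \<epsilon> / 6 + card {-2..2::int} * (\<epsilon> / 6)"
      unfolding exceptional_def
      by (rule prob_Un_UN_le) (use elim in \<open>simp_all add: events_measurable variance_event_measurable\<close>)
    thus ?case by simp
  qed
qed

text \<open>The sign \<open>1\<close> stands for the lower confidence bound, \<open>-1\<close> for the upper one, and both together for
the interval.\<close>

definition coverage :: "real set \<Rightarrow> nat \<times> (real \<Rightarrow> real) \<Rightarrow> (nat \<Rightarrow> real) set" where
  "coverage \<Sigma> z = {X \<in> space (\<P> z). \<forall>\<sigma>\<in>\<Sigma>.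
    \<sigma> * (fstar S \<eta> K (fst z) t X - snd z 0) \<le> radius S \<eta> K (fst z) t X}"

text \<open>The exceptional event has to fit into the gap between \<open>card \<Sigma> * t powr \<beta>\<^sup>2\<close> and \<open>\<alpha>\<close>.\<close>

lemma coverage_ge:
  assumes \<Sigma>: "\<Sigma> \<subseteq> {1, -1}" and \<alpha>: "card \<Sigma> * t powr (\<beta>\<^sup>2) < \<alpha>"
  shows "\<forall>\<^sub>F z in class_limit. 1 - \<alpha> \<le> measure (\<P> z) (coverage \<Sigma> z)"
proof -
  have fin: "finite \<Sigma>" using \<Sigma> by (rule finite_subset) simp
  have "0 < \<alpha> - card \<Sigma> * t powr (\<beta>\<^sup>2)" using \<alpha> by simp
  from exceptional_small[OF this]
  have "\<forall>\<^sub>F z in class_limit. measure (\<P> z) (exceptional z) \<le> \<alpha> - card \<Sigma> * t powr (\<beta>\<^sup>2)" .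
  moreover have "\<forall>\<^sub>F z in class_limit. \<forall>\<sigma>\<in>\<Sigma>. measure (\<P> z) (tail_event \<sigma> z) \<le> t powr (\<beta>\<^sup>2)"
    by (rule eventually_ball_finite[OF fin]) (use \<Sigma> tail_event_bound in blast)
  moreover have "\<forall>\<^sub>F z in class_limit. \<forall>\<sigma>\<in>\<Sigma>. \<forall>X\<in>space (\<P> z) - exceptional z - tail_event \<sigma> z.
      \<sigma> * (fstar S \<eta> K (fst z) t X - snd z 0) \<le> radius S \<eta> K (fst z) t X"
    by (rule eventually_ball_finite[OF fin]) (use \<Sigma> fstar_error_off_exceptional in blast)
  ultimately show ?thesis using class_limit_member htilde_is_gridpoint
  proof eventually_elim
    case (elim z)
    have "lebesgue_density (snd z)" using elim lebesgue_density by blast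
    then interpret prob_space "\<P> z" by (rule prob_space_sample)
    have fstar: "fstar S \<eta> K (fst z) t \<in> borel_measurable (\<P> z)"
      using elim by (intro fstar_measurable) blast
    have "{X \<in> space (\<P> z). \<sigma> * (fstar S \<eta> K (fst z) t X - snd z 0) \<le> radius S \<eta> K (fst z) t X} \<in> events" for \<sigma>
      by (intro borel_measurable_le radius_measurable borel_measurable_times borel_measurable_diff
          borel_measurable_const fstar)
    hence cov: "coverage \<Sigma> z \<in> events"
      unfolding coverage_def by (rule sets.sets_Collect_finite_All[OF _ fin])
    define bad where "bad = exceptional z \<union> (\<Union>\<sigma>\<in>\<Sigma>. tail_event \<sigma> z)"
    have bad: "bad \<in> events"
      unfolding bad_def by (intro sets.Un sets.finite_UN events_measurable fin)
    have "prob bad \<le> (\<alpha> - card \<Sigma> * t powr (\<beta>\<^sup>2)) + card \<Sigma> * t powr (\<beta>\<^sup>2)"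
      unfolding bad_def by (rule prob_Un_UN_le) (use elim fin in \<open>simp_all add: events_measurable\<close>)
    hence "prob bad \<le> \<alpha>" by simp
    hence "1 - \<alpha> \<le> prob (space (\<P> z) - bad)" using prob_compl[OF bad] by simp
    also have "\<dots> \<le> prob (coverage \<Sigma> z)"
      using elim cov by (intro finite_measure_mono) (auto simp: bad_def coverage_def)
    finally show ?case .
  qed
qed

end

section \<open>The coverage theorem\<close>

lemma (in interval_level) powr_\<beta>_less: "t powr (\<beta>\<^sup>2) < t"
proof -
  have "1 < \<beta>\<^sup>2" using \<beta>_gt_1 by (simp add: one_less_power)
  hence "\<beta>\<^sup>2 * ln t < 1 * ln t" using t by (intro mult_strict_right_mono_neg) auto
  hence "exp (\<beta>\<^sup>2 * ln t) < exp (ln t)" by simp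
  moreover have "t powr (\<beta>\<^sup>2) = exp (\<beta>\<^sup>2 * ln t)" using t by (simp add: powr_def)
  ultimately show ?thesis using t by simp
qed

theorem theorem4:
  fixes S :: nat and p :: position and K r :: "real \<Rightarrow> real" and c C M \<alpha> \<eta> :: real
  assumes "1 \<le> S" and "order_kernel S p K" and "modulus r" and "0 < M" and "0 < c"
    and "0 < \<alpha>" and "\<alpha> < 1" and "0 < \<eta>"
  shows
    "(\<exists>CE CE' :: nat \<Rightarrow> real. \<exists>\<kappa>1>0. \<exists>\<kappa>2>0.
        CE \<in> O(\<lambda>n. exp (- (real n powr \<kappa>1))) \<and> CE' \<in> O(\<lambda>n. exp (- (real n powr \<kappa>2))) \<and>
        (\<forall>n\<ge>2. even n \<longrightarrow>
          (INF f\<in>density_class S p c C M r n. ereal (measure (sample n f)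
             {X \<in> space (sample n f). fstar S \<eta> K n \<alpha> X \<ge> f 0 - radius S \<eta> K n \<alpha> X}))
            \<ge> ereal (1 - \<alpha> - CE n) \<and>
          (INF f\<in>density_class S p c C M r n. ereal (measure (sample n f)
             {X \<in> space (sample n f). f 0 \<ge> fstar S \<eta> K n \<alpha> X - radius S \<eta> K n \<alpha> X}))
            \<ge> ereal (1 - \<alpha> - CE n) \<and>
          (INF f\<in>density_class S p c C M r n. ereal (measure (sample n f)
             {X \<in> space (sample n f).
                f 0 \<in> {fstar S \<eta> K n (\<alpha> / 2) X - radius S \<eta> K n (\<alpha> / 2) X ..
                       fstar S \<eta> K n (\<alpha> / 2) X + radius S \<eta> K n (\<alpha> / 2) X}}))
            \<ge> ereal (1 - \<alpha> - CE' n))) \<and>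
     (\<forall>f. (\<forall>\<^sub>F n in sequentially. even n \<longrightarrow> f \<in> density_class S p c C M r n) \<longrightarrow>
        (\<forall>\<epsilon>>0. (\<lambda>m. measure (sample (2 * m) f)
            {X \<in> space (sample (2 * m) f).
               \<bar>Vhat S K (2 * m) X - f 0 * (LINT u:kernel_interval p|lborel. (K u)\<^sup>2)\<bar> > \<epsilon>})
          \<longlonglongrightarrow> 0))"
proof -
  obtain B where B: "\<And>u. \<bar>K u\<bar> \<le> B"
    using assms(2) by (auto simp: order_kernel_def bounded_iff)
  interpret density_estimation S p K r B c C M
    by unfold_locales (use assms B in auto)
  interpret one: interval_level S p K r B c C M \<eta> \<alpha>
    by unfold_locales (use assms in auto)
  interpret two: interval_level S p K r B c C M \<eta> "\<alpha> / 2"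
    by unfold_locales (use assms in auto)
  have "\<forall>\<^sub>F z in class_limit. 1 - \<alpha> \<le> measure (\<P> z) (one.coverage {-1} z)"
    using one.powr_\<beta>_less by (intro one.coverage_ge) auto
  moreover have "\<forall>\<^sub>F z in class_limit. 1 - \<alpha> \<le> measure (\<P> z) (one.coverage {1} z)"
    using one.powr_\<beta>_less by (intro one.coverage_ge) auto
  moreover have "\<forall>\<^sub>F z in class_limit. 1 - \<alpha> \<le> measure (\<P> z) (two.coverage {1, -1} z)"
    using two.powr_\<beta>_less by (intro two.coverage_ge) auto
  ultimately have "\<forall>\<^sub>F z in class_limit. 1 - \<alpha> \<le> measure (\<P> z) (one.coverage {-1} z) \<and>
      1 - \<alpha> \<le> measure (\<P> z) (one.coverage {1} z) \<and> 1 - \<alpha> \<le> measure (\<P> z) (two.coverage {1, -1} z)"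
    by (intro eventually_conj)
  then obtain N where N: "\<And>n f. N \<le> n \<Longrightarrow> even n \<Longrightarrow> f \<in> \<D> n \<Longrightarrow>
      1 - \<alpha> \<le> measure (sample n f) (one.coverage {-1} (n, f)) \<and>
      1 - \<alpha> \<le> measure (sample n f) (one.coverage {1} (n, f)) \<and>
      1 - \<alpha> \<le> measure (sample n f) (two.coverage {1, -1} (n, f))"
    unfolding eventually_class_limit eventually_sequentially by auto
  \<comment> \<open>Before \<open>N\<close> the claim is trivial with error term \<open>1\<close>; from \<open>N\<close> on error term \<open>0\<close> will do.\<close>
  define CE :: "nat \<Rightarrow> real" where "CE n = (if n < N then 1 else 0)" for n
  have CE: "CE \<in> O(\<lambda>n. exp (- (real n powr 1)))"
    by (intro bigoI[of _ 1] eventually_sequentiallyI[of N]) (simp add: CE_def)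
  have ge: "1 - \<alpha> - CE n \<le> measure (sample n f) E"
    if "N \<le> n \<Longrightarrow> 1 - \<alpha> \<le> measure (sample n f) E" for n f E
  proof (cases "n < N")
    case True
    have "1 - \<alpha> - CE n \<le> 0" using True assms by (simp add: CE_def)
    thus ?thesis using measure_nonneg by (rule order_trans)
  qed (use that in \<open>simp add: CE_def\<close>)
  have sets: "{X \<in> space (sample n f). fstar S \<eta> K n \<alpha> X \<ge> f 0 - radius S \<eta> K n \<alpha> X}
      = one.coverage {-1} (n, f)"
    "{X \<in> space (sample n f). f 0 \<ge> fstar S \<eta> K n \<alpha> X - radius S \<eta> K n \<alpha> X}
      = one.coverage {1} (n, f)"
    "{X \<in> space (sample n f).
      f 0 \<in> {fstar S \<eta> K n (\<alpha> / 2) X - radius S \<eta> K n (\<alpha> / 2) X ..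
             fstar S \<eta> K n (\<alpha> / 2) X + radius S \<eta> K n (\<alpha> / 2) X}}
      = two.coverage {1, -1} (n, f)" for n f
    unfolding one.coverage_def two.coverage_def by (auto simp: algebra_simps)
  have INF_ge: "ereal (1 - \<alpha> - CE n) \<le> (INF f\<in>\<D> n. ereal (measure (sample n f) (E n f)))"
    if "\<And>f. f \<in> \<D> n \<Longrightarrow> N \<le> n \<Longrightarrow> 1 - \<alpha> \<le> measure (sample n f) (E n f)"
    for n and E :: "nat \<Rightarrow> (real \<Rightarrow> real) \<Rightarrow> (nat \<Rightarrow> real) set"
    using ge that by (intro INF_greatest) simp
  have exists: "\<exists>CE CE' :: nat \<Rightarrow> real. \<exists>\<kappa>1>0. \<exists>\<kappa>2>0.
      CE \<in> O(\<lambda>n. exp (- (real n powr \<kappa>1))) \<and> CE' \<in> O(\<lambda>n. exp (- (real n powr \<kappa>2))) \<and> Q CE CE'"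
    if "Q CE CE" for Q
    using CE that zero_less_one by blast
  show ?thesis
    unfolding \<kappa>_eq sets
    by (intro conjI exists allI impI INF_ge Vhat_consistent) (use N in blast)+
qed

end
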